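(* Let $\Lambda$ be a sequence in $\mathbb{D}$ satisfying the Blaschke condition $\sum_{\lambda\in\Lambda}(1-|\lambda|)<\infty$. (a) If $\Lambda\in\mathrm{Int}\,N$ then $\varphi_\Lambda^H\in L^1_w(\partial\mathbb{D})$. If $\Lambda\in\mathrm{Int}\,N^+$ then $\varphi_\Lambda^H\in L^1_{w,0}(\partial\mathbb{D})$. (b) If $M\varphi_\Lambda\in L^1(\partial\mathbb{D})$ then $\Lambda\in\mathrm{Int}\,N^+$ (and hence $\Lambda\in\mathrm{Int}\,N$).
   Context: $\mathbb{D}$ is the open unit disc, $\sigma$ is normalized Lebesgue measure on $\partial\mathbb{D}$. A sequence $\Lambda\subset\mathbb{D}$ means a discrete sequence of (distinct) points. The Nevanlinna class is $N=\{f\in\mathrm{Hol}(\mathbb{D}):\lim_{r\to1}\frac1{2\pi}\int_0^{2\pi}\log^+|f(re^{i\theta})|\,d\theta<\infty\}$, and the Smirnov class $N^+$ is the set of $f\in N$ with $\lim_{r\to1}\frac1{2\pi}\int_0^{2\pi}\log^+|f(re^{i\theta})|\,d\theta=\frac1{2\pi}\int_0^{2\pi}\log^+|f(e^{i\theta})|\,d\theta$ (non-tangential boundary values). For a space $X$ of holomorphic functions on $\mathbb{D}$, $X|\Lambda=\{(f(\lambda))_{\lambda\in\Lambda}:f\in X\}$, and $\Lambda\in\mathrm{Int}\,X$ ($\Lambda$ is free interpolating for $X$) means that $X|\Lambda$ is ideal: $(a_\lambda)\in X|\Lambda$ and $(\omega_\lambda)\in\ell^\infty$ imply $(\omega_\lambda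 a_\lambda)\in X|\Lambda$. For $\lambda\in\mathbb{D}$, $b_\lambda(z)=\frac{|\lambda|}{\lambda}\frac{\lambda-z}{1-\overline{\lambda}z}$ ($b_0(z)=z$). For $\lambda\in\Lambda$, $B_\lambda=\prod_{\lambda'\in\Lambda\setminus\{\lambda\}}b_{\lambda'}$; $\varphi_\Lambda(\lambda)=\log|B_\lambda(\lambda)|^{-1}$ for $\lambda\in\Lambda$ and $\varphi_\Lambda(z)=0$ for $z\in\mathbb{D}\setminus\Lambda$. Fix an aperture $\alpha\ge1$. The Stolz angle at $\zeta\in\partial\mathbb{D}$ is $\Gamma(\zeta)=\{z\in\mathbb{D}:|z-\zeta|\le\alpha(1-|z|^2)\}$, and $I_z=\{\zeta\in\partial\mathbb{D}:z\in\Gamma(\zeta)\}$. For $f:\mathbb{D}\to[0,\infty)$, $Mf(\zeta)=\sup_{\Gamma(\zeta)}f$ and $f^H(\zeta)=\sup_{z\in\mathbb{D}}f(z)\chi_{I_z}^*(\zeta)$, where for a nonnegative $u$ on $\partial\mathbb{D}$, $u^*(x)=\sup_{I\ni x}\frac1{\sigma(I)}\int_I u\,d\sigma$ (supremum over arcs $I$ containing $x$) is the Hardy–Littlewood maximal function. $L^1_w(\partial\mathbb{D})$ is the set of measurable $f$ with $\sup_{t>0}t\,\sigma\{|f|>t\}<\infty$; $L^1_{w,0}(\partial\mathbb{D})$ is the set of measurable $f$ with $\lim_{t\to\infty}t\,\sigma\{|f|>t\}=0$. *)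

theory Defs
  imports "HOL-Analysis.Analysis"
begin

section \<open>Nevanlinna and Smirnov classes\<close>

definition log_plus :: "real \<Rightarrow> real" where
  "log_plus x = ln (max 1 x)"

definition log_plus_mean :: "(complex \<Rightarrow> complex) \<Rightarrow> real \<Rightarrow> ennreal" where
  "log_plus_mean f r =
     ennreal (1 / (2 * pi)) *
     (\<integral>\<^sup>+ t \<in> {0..2 * pi}. ennreal (log_plus (norm (f (of_real r * cis t)))) \<partial>lebesgue)"

definition nevanlinna :: "(complex \<Rightarrow> complex) set" where
  "nevanlinna = {f. f holomorphic_on ball 0 1 \<and>
     (\<exists>L. L < \<infinity> \<and> (log_plus_mean f \<longlongrightarrow> L) (at_left 1))}"

definition stolz :: "real \<Rightarrow> complex \<Rightarrow> complex set" where
  "stolz \<alpha> \<zeta> = {z \<in> ball 0 1. norm (z - \<zeta>) \<le> \<alpha> * (1 - (norm z)\<^sup>2)}"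

definition has_nt_limit :: "(complex \<Rightarrow> complex) \<Rightarrow> complex \<Rightarrow> complex \<Rightarrow> bool" where
  "has_nt_limit f l \<zeta> \<longleftrightarrow> (\<forall>\<alpha>\<ge>1. (f \<longlongrightarrow> l) (at \<zeta> within stolz \<alpha> \<zeta>))"

text \<open>For functions of the Nevanlinna class the non-tangential limit exists at almost
  every boundary point (Fatou), so the value of the description operator elsewhere
  does not affect the integral in the definition of the Smirnov class.\<close>

definition nt_boundary :: "(complex \<Rightarrow> complex) \<Rightarrow> complex \<Rightarrow> complex" where
  "nt_boundary f \<zeta> = (THE l. has_nt_limit f l \<zeta>)"

definition smirnov :: "(complex \<Rightarrow> complex) set" where
  "smirnov = {f \<in> nevanlinna.
     (log_plus_mean f \<longlongrightarrow>
        ennreal (1 / (2 * pi)) *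
        (\<integral>\<^sup>+ t \<in> {0..2 * pi}. ennreal (log_plus (norm (nt_boundary f (cis t)))) \<partial>lebesgue))
     (at_left 1)}"

section \<open>Free interpolation\<close>

definition trace_space :: "(complex \<Rightarrow> complex) set \<Rightarrow> complex set \<Rightarrow> (complex \<Rightarrow> complex) set" where
  "trace_space X \<Lambda> = (\<lambda>f. restrict f \<Lambda>) ` X"

definition free_interpolating :: "complex set \<Rightarrow> (complex \<Rightarrow> complex) set \<Rightarrow> bool" where
  "free_interpolating \<Lambda> X \<longleftrightarrow>
     (\<forall>a \<in> trace_space X \<Lambda>. \<forall>\<omega> :: complex \<Rightarrow> complex. bounded (\<omega> ` \<Lambda>) \<longrightarrow>
        restrict (\<lambda>l. \<omega> l * a l) \<Lambda> \<in> trace_space X \<Lambda>)"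

section \<open>Blaschke products\<close>

definition blaschke_factor :: "complex \<Rightarrow> complex \<Rightarrow> complex" where
  "blaschke_factor l z =
     (if l = 0 then z else of_real (norm l) / l * ((l - z) / (1 - cnj l * z)))"

text \<open>The infinite product is the limit of the net of finite subproducts; under the
  Blaschke condition it converges absolutely, so every enumeration gives the same value.\<close>

definition blaschke_product :: "complex set \<Rightarrow> complex \<Rightarrow> complex" where
  "blaschke_product A z =
     Lim (finite_subsets_at_top A) (\<lambda>F. \<Prod>l\<in>F. blaschke_factor l z)"

definition phi :: "complex set \<Rightarrow> complex \<Rightarrow> real" where
  "phi \<Lambda> z = (if z \<in> \<Lambda> then ln (inverse (norm (blaschke_product (\<Lambda> - {z}) z))) else 0)"

section \<open>Maximal functions on the circle\<close>

definition circle_measure :: "complex measure" where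
  "circle_measure = completion
     (distr (uniform_measure lborel {0..2 * pi}) (restrict_space borel (sphere 0 1)) cis)"

definition shadow :: "real \<Rightarrow> complex \<Rightarrow> complex set" where
  "shadow \<alpha> z = {\<zeta> \<in> sphere 0 1. z \<in> stolz \<alpha> \<zeta>}"

definition nt_maximal :: "real \<Rightarrow> (complex \<Rightarrow> real) \<Rightarrow> complex \<Rightarrow> ennreal" where
  "nt_maximal \<alpha> f \<zeta> = (SUP z \<in> stolz \<alpha> \<zeta>. ennreal (f z))"

text \<open>Nondegenerate closed arcs. Open and half-open arcs yield the same maximal function,
  since enlarging or shrinking an arc slightly changes the average only slightly.\<close>

definition circle_arcs :: "complex set set" where
  "circle_arcs = {cis ` {a..b} | a b. a < b \<and> b \<le> a + 2 * pi}"

definition hl_maximal :: "(complex \<Rightarrow> ennreal) \<Rightarrow> complex \<Rightarrow> ennreal" where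
  "hl_maximal u x = (SUP I \<in> {I \<in> circle_arcs. x \<in> I}.
     (\<integral>\<^sup>+ \<zeta> \<in> I. u \<zeta> \<partial>circle_measure) / emeasure circle_measure I)"

definition H_maximal :: "real \<Rightarrow> (complex \<Rightarrow> real) \<Rightarrow> complex \<Rightarrow> ennreal" where
  "H_maximal \<alpha> f \<zeta> = (SUP z \<in> ball 0 1. ennreal (f z) * hl_maximal (indicator (shadow \<alpha> z)) \<zeta>)"

section \<open>Function spaces on the circle\<close>

text \<open>Maximal functions may take the value infinity, so the spaces are stated for
  functions with values in [0,\<infinity>]. Membership forces finiteness almost everywhere.\<close>

definition L1_circle :: "(complex \<Rightarrow> ennreal) set" where
  "L1_circle = {f \<in> borel_measurable circle_measure. (\<integral>\<^sup>+ \<zeta>. f \<zeta> \<partial>circle_measure) < \<infinity>}"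

definition weak_L1_circle :: "(complex \<Rightarrow> ennreal) set" where
  "weak_L1_circle = {f \<in> borel_measurable circle_measure.
     (SUP t \<in> {0::real<..}.
        ennreal t * emeasure circle_measure {\<zeta> \<in> sphere 0 1. f \<zeta> > ennreal t}) < \<infinity>}"

definition weak_L1_0_circle :: "(complex \<Rightarrow> ennreal) set" where
  "weak_L1_0_circle = {f \<in> borel_measurable circle_measure.
     ((\<lambda>t::real. ennreal t * emeasure circle_measure {\<zeta> \<in> sphere 0 1. f \<zeta> > ennreal t})
        \<longlongrightarrow> 0) at_top}"

end

theory Submission
  imports Defs "HOL-Complex_Analysis.Complex_Analysis" "HOL-Probability.Probability_Measure"
begin

text \<open>For \<open>z \<in> \<Lambda>\<close> the number \<open>phi \<Lambda> z\<close> is the sum over the other points \<open>a\<close> of \<open>\<Lambda>\<close> of Green's function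
\<open>green z a\<close>, the logarithm of the reciprocal pseudohyperbolic distance (\<open>phi_has_sum\<close>).

Interpolation implies the maximal estimates. If \<open>f\<close> vanishes on a finite set \<open>A\<close> and equals 1 at \<open>z\<close>,
then Jensen's inequality bounds the sum of \<open>green a z\<close> over \<open>A\<close> by the Poisson integral at \<open>z\<close> of
\<open>log\<^sup>+|f|\<close> over circles of radius close to 1. Interpolating zeros and ones thus controls the part
of \<open>phi\<close> that lies across a partition of \<open>\<Lambda>\<close>. Now consider \<open>\<Lambda>\<close> as a complete graph whose edges have
the weights \<open>green\<close>: a cut which cannot be improved by moving one point catches at least half of the
weight at every vertex. Such a cut exists for a finite set by maximality and for \<open>\<Lambda>\<close> by compactness
(\<open>countable_cut\<close>), so two functions, with values 0 and 1 interchanged, control all of \<open>phi\<close>. Next, the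
Poisson kernel of \<open>z\<close> is at most of order \<open>(1 - |z|) / |\<xi> - z|\<^sup>2\<close> at \<open>\<xi>\<close>, while the maximal function of
the shadow of \<open>z\<close> at \<open>\<zeta>\<close> is at most of order \<open>(1 - |z|) / |\<zeta> - z|\<close>. Summing over dyadic shells
shows that the product of the latter with a Poisson integral at \<open>z\<close> is at most a constant times the
maximal function of the integrand at \<open>\<zeta>\<close>, and Vitali's covering lemma finishes the proof. For the
Smirnov class the boundary logarithms are uniformly integrable: after subtraction of a constant \<open>K\<close>
their mass is as small as desired, and \<open>K\<close> only affects levels below \<open>4 K\<close>.

The maximal condition implies interpolation. The nontangential maximal function is at least
\<open>phi \<Lambda> l\<close> on the shadow of \<open>l\<close>, whose harmonic measure seen from \<open>l\<close> is bounded below; so \<open>phi\<close> is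
dominated by the Poisson integral of an integrable function \<open>w\<close>. Let \<open>F\<close> be its Herglotz integral.
Given bounded data \<open>\<omega>\<close>, the values \<open>c l = \<omega> l * exp (- F l)\<close> are, up to a constant factor, bounded by
the modulus of the Blaschke product of \<open>\<Lambda> - {l}\<close> at \<open>l\<close>. A Lagrange type sum with squared Cauchy
kernels interpolates them, and its means over circles are bounded because the integral of the kernel
of \<open>l\<close> is of order \<open>1 - |l|\<close>. Multiplication by \<open>exp F\<close> gives a Smirnov function with values \<open>\<omega>\<close>, and such functions
multiply both classes into themselves.

The Smirnov class is defined through boundary values. It is the class of holomorphic functions for
which \<open>log\<^sup>+|f|\<close> is uniformly integrable over circles (\<open>smirnov_iff\<close>); this rests on Fatou's theorem
in the Nevanlinna class (\<open>Fatou_nevanlinna\<close>), obtained by writing \<open>f\<close> as a quotient of bounded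
functions. Bounded functions have nontangential limits because their Taylor polynomials
approximate them in the mean, uniformly in the radius, and the nontangential maximal function
obeys the same weak type estimate as above.\<close>

section \<open>Normalised arc length on the circle\<close>

text \<open>The angle, uniformly distributed. Integrals over circles are taken against this measure: the functions
  \<open>t \<mapsto> f (r * cis t)\<close> are continuous on the whole line even if \<open>f\<close> is only known in the disc.\<close>

definition ang :: "real measure" where
  "ang = uniform_measure lborel {0..2 * pi}"

lemma sets_ang [simp, measurable_cong]: "sets ang = sets borel"
  by (simp add: ang_def)

lemma space_ang [simp]: "space ang = UNIV"
  by (simp add: ang_def)

interpretation ang: prob_space ang
  unfolding ang_def by (intro prob_space_uniform_measure) auto

lemma measure_ang [simp]: "measure ang UNIV = 1"
  using ang.prob_space by simp

lemma AE_ang: "AE t in ang. t \<in> {0..2 * pi}"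
  unfolding ang_def by (subst AE_uniform_measure) auto

lemma nn_integral_ang:
  assumes [measurable]: "h \<in> borel_measurable borel"
  shows "(\<integral>\<^sup>+t. h t \<partial>ang) = ennreal (1 / (2 * pi)) * (\<integral>\<^sup>+ t \<in> {0..2 * pi}. h t \<partial>lborel)"
proof -
  have "(\<integral>\<^sup>+t. h t \<partial>ang) = (\<integral>\<^sup>+ t \<in> {0..2 * pi}. h t \<partial>lborel) / ennreal (2 * pi)"
    unfolding ang_def by (simp add: nn_integral_uniform_measure)
  also have "\<dots> = ennreal (1 / (2 * pi)) * (\<integral>\<^sup>+ t \<in> {0..2 * pi}. h t \<partial>lborel)"
    by (simp add: divide_ennreal_def inverse_ennreal field_simps inverse_eq_divide)
  finally show ?thesis .
qed

lemma ang_density: "ang = density lborel (\<lambda>t. ennreal (indicator {0..2*pi} t / (2 * pi)))"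
proof -
  have "(\<lambda>t. indicator {0..2*pi} t / emeasure lborel {0..2*pi}) = (\<lambda>t. ennreal (indicator {0..2*pi} t / (2 * pi)))"
    by (auto simp: fun_eq_iff indicator_def divide_ennreal simp flip: ennreal_1)
  then show ?thesis by (simp add: ang_def uniform_measure_def)
qed

lemma borel_measurable_ang_cont [simp]:
  fixes g :: "real \<Rightarrow> 'a::topological_space"
  assumes "continuous_on UNIV g" shows "g \<in> borel_measurable ang"
  using borel_measurable_continuous_onI[OF assms] by (simp cong: measurable_cong_sets)

lemma integrable_ang_cont:
  fixes g :: "real \<Rightarrow> 'a::euclidean_space"
  assumes "continuous_on UNIV g"
  shows "integrable ang g"
proof -
  have "compact (g ` {0..2*pi})"
    by (intro compact_continuous_image continuous_on_subset[OF assms]) auto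
  then have "bounded (g ` {0..2*pi})" by (rule compact_imp_bounded)
  then obtain B where "\<forall>x\<in>g ` {0..2*pi}. norm x \<le> B" unfolding bounded_iff by blast
  then have B: "norm (g t) \<le> B" if "t \<in> {0..2*pi}" for t using that by blast
  have "AE t in ang. norm (g t) \<le> B" using AE_ang by eventually_elim (rule B)
  then show ?thesis by (rule ang.integrable_const_bound) (simp add: assms)
qed

lemma ang_has_integral:
  fixes g :: "real \<Rightarrow> complex"
  assumes "continuous_on UNIV g"
  shows "(g has_integral (of_real (2 * pi) * (\<integral>t. g t \<partial>ang))) {0..2 * pi}"
proof -
  have gm: "g \<in> borel_measurable lborel" using borel_measurable_continuous_onI[OF assms] by simp
  have int: "integrable lborel (\<lambda>t. (indicator {0..2*pi} t / (2 * pi)) *\<^sub>R g t)"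
    using integrable_ang_cont[OF assms] gm unfolding ang_density
    by (subst (asm) integrable_density) auto
  have eq: "(\<integral>t. g t \<partial>ang) = (\<integral>t. (indicator {0..2*pi} t / (2 * pi)) *\<^sub>R g t \<partial>lborel)"
    unfolding ang_density using gm by (subst integral_density) auto
  have "((\<lambda>t. (indicator {0..2*pi} t / (2 * pi)) *\<^sub>R g t) has_integral (\<integral>t. g t \<partial>ang)) UNIV"
    unfolding eq by (rule has_integral_integral_lborel[OF int])
  then have "((\<lambda>t. of_real (2 * pi) * ((indicator {0..2*pi} t / (2 * pi)) *\<^sub>R g t)) has_integral of_real (2 * pi) * (\<integral>t. g t \<partial>ang)) UNIV"
    by (rule has_integral_mult_right)
  also have "(\<lambda>t. of_real (2 * pi) * ((indicator {0..2*pi} t / (2 * pi)) *\<^sub>R g t)) = (\<lambda>t. if t \<in> {0..2*pi} then g t else 0)"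
    by (auto simp: fun_eq_iff indicator_def scaleR_conv_of_real)
  finally show ?thesis by (simp only: has_integral_restrict_UNIV)
qed

text \<open>Normalised arc length as a Borel measure on the whole plane. Discs, Vitali coverings and Borel
  functions of a complex variable can then be used as they are; only the final statements
  refer to the completed measure on the circle.\<close>

definition circ :: "complex measure" where
  "circ = distr ang borel cis"

lemma sets_circ [simp, measurable_cong]: "sets circ = sets borel"
  by (simp add: circ_def)

lemma space_circ [simp]: "space circ = UNIV"
  by (simp add: circ_def)

lemma cis_borel [measurable]: "cis \<in> borel_measurable borel"
  by (intro borel_measurable_continuous_onI continuous_intros)

interpretation circ: prob_space circ
  unfolding circ_def by (intro ang.prob_space_distr) auto

lemma emeasure_circ:
  assumes [measurable]: "A \<in> sets borel"
  shows "emeasure circ A = ennreal (1 / (2 * pi)) * emeasure lborel ({0..2 * pi} \<inter> cis -` A)"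
proof -
  have X: "cis -` A \<in> sets borel"
    using measurable_sets[OF cis_borel assms] by simp
  have "emeasure circ A = emeasure ang (cis -` A)"
    unfolding circ_def by (subst emeasure_distr) auto
  also have "\<dots> = emeasure lborel ({0..2 * pi} \<inter> cis -` A) / ennreal (2 * pi)"
    unfolding ang_def using X by (subst emeasure_uniform_measure) auto
  also have "\<dots> = ennreal (1 / (2 * pi)) * emeasure lborel ({0..2 * pi} \<inter> cis -` A)"
    by (simp add: divide_ennreal_def inverse_ennreal inverse_eq_divide mult.commute)
  finally show ?thesis .
qed

lemma AE_circ_sphere: "AE \<zeta> in circ. \<zeta> \<in> sphere 0 1"
  unfolding circ_def by (subst AE_distr_iff) auto

lemma cis_measurable_sphere:
  "cis \<in> measurable (uniform_measure lborel {0..2 * pi}) (restrict_space borel (sphere 0 1))"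
  by (rule measurable_restrict_space2) auto

lemma space_circle_measure [simp]: "space circle_measure = sphere 0 1"
  by (simp add: circle_measure_def space_restrict_space)

lemma circle_measure_sets:
  assumes "A \<in> sets borel"
  shows "A \<inter> sphere 0 1 \<in> sets circle_measure"
    and "emeasure circle_measure (A \<inter> sphere 0 1) = emeasure circ A"
proof -
  let ?D = "distr (uniform_measure lborel {0..2 * pi}) (restrict_space borel (sphere 0 1)) cis"
  have s: "A \<inter> sphere 0 1 \<in> sets ?D"
    using assms by (auto simp: sets_restrict_space)
  then show "A \<inter> sphere 0 1 \<in> sets circle_measure"
    by (simp add: circle_measure_def)
  have "emeasure circle_measure (A \<inter> sphere 0 1) = emeasure ?D (A \<inter> sphere 0 1)"
    unfolding circle_measure_def using s by simp
  also have "\<dots> = emeasure (uniform_measure lborel {0..2 * pi}) (cis -` (A \<inter> sphere 0 1))"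
    using emeasure_distr[OF cis_measurable_sphere, of "A \<inter> sphere 0 1"] s by simp
  also have "cis -` (A \<inter> sphere 0 1) = cis -` A" by auto
  also have "emeasure (uniform_measure lborel {0..2 * pi}) (cis -` A) = emeasure circ A"
    unfolding circ_def ang_def using assms by (subst emeasure_distr) auto
  finally show "emeasure circle_measure (A \<inter> sphere 0 1) = emeasure circ A" .
qed

text \<open>Weak type estimates are proved for outer measure, where no measurability has to be checked on the way;
  measurability of the superlevel sets enters once, here.\<close>

lemma emeasure_circle_measure_le:
  assumes "E \<in> sets circle_measure"
  shows "emeasure circle_measure E \<le> outer_measure_of circ E"
  unfolding outer_measure_of_def
proof (rule INF_greatest, clarify)
  fix B assume B: "B \<in> sets circ" "E \<subseteq> B"
  have "emeasure circle_measure E \<le> emeasure circle_measure (B \<inter> sphere 0 1)"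
    using B circle_measure_sets[of B] sets.sets_into_space[OF assms] by (intro emeasure_mono) auto
  also have "\<dots> = emeasure circ B" using B circle_measure_sets by simp
  finally show "emeasure circle_measure E \<le> emeasure circ B" .
qed

text \<open>Passage from the completed measure to a Borel function. Only an inequality is kept, as the function is
  going to serve as an upper bound.\<close>

lemma nn_integral_circle_measure:
  assumes f: "f \<in> borel_measurable circle_measure"
  obtains g :: "complex \<Rightarrow> ennreal" where "g \<in> borel_measurable borel"
    "(\<integral>\<^sup>+\<zeta>. g \<zeta> \<partial>circ) = (\<integral>\<^sup>+\<zeta>. f \<zeta> \<partial>circle_measure)"
    "AE \<zeta> in circ. g \<zeta> \<ge> f \<zeta>"
proof -
  let ?S = "restrict_space borel (sphere 0 1) :: complex measure"
  let ?D = "distr (uniform_measure lborel {0..2 * pi}) ?S cis"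
  obtain g' where g': "g' \<in> borel_measurable ?D" and ae: "AE x in ?D. f x = g' x"
    using completion_ex_borel_measurable[OF f[unfolded circle_measure_def]] by blast
  have g'S: "g' \<in> borel_measurable ?S" using g' by simp
  define g where "g = (\<lambda>x. if x \<in> sphere 0 1 then g' x else 0)"
  have gm: "g \<in> borel_measurable borel"
  proof -
    have "(\<lambda>x. g' x * indicator (sphere 0 1) x) \<in> borel_measurable borel"
      using g'S borel_measurable_restrict_space_iff_ennreal[of "sphere 0 1" borel g'] by simp
    moreover have "(\<lambda>x. g' x * indicator (sphere 0 1) x) = g"
      by (auto simp: g_def indicator_def)
    ultimately show ?thesis by simp
  qed
  have 1: "(\<integral>\<^sup>+\<zeta>. g \<zeta> \<partial>circ) = (\<integral>\<^sup>+\<zeta>. f \<zeta> \<partial>circle_measure)"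
  proof -
    have "(\<integral>\<^sup>+\<zeta>. f \<zeta> \<partial>circle_measure) = (\<integral>\<^sup>+\<zeta>. g' \<zeta> \<partial>circle_measure)"
      unfolding circle_measure_def using AE_completion[OF ae] by (rule nn_integral_cong_AE)
    also have "\<dots> = (\<integral>\<^sup>+\<zeta>. g' \<zeta> \<partial>?D)"
      unfolding circle_measure_def by (simp add: nn_integral_completion)
    also have "\<dots> = (\<integral>\<^sup>+t. g' (cis t) \<partial>uniform_measure lborel {0..2 * pi})"
      using nn_integral_distr[OF cis_measurable_sphere g'] by simp
    also have "\<dots> = (\<integral>\<^sup>+t. g (cis t) \<partial>uniform_measure lborel {0..2 * pi})"
      by (simp add: g_def)
    also have "\<dots> = (\<integral>\<^sup>+\<zeta>. g \<zeta> \<partial>circ)"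
      unfolding circ_def ang_def using gm by (simp add: nn_integral_distr)
    finally show ?thesis by simp
  qed
  have 2: "AE \<zeta> in circ. g \<zeta> \<ge> f \<zeta>"
  proof -
    obtain N where N: "{x \<in> space ?D. f x \<noteq> g' x} \<subseteq> N" "emeasure ?D N = 0" "N \<in> sets ?D"
      by (rule AE_E[OF ae])
    then obtain N' where N': "N' \<in> sets borel" "N = N' \<inter> sphere 0 1"
      by (auto simp: sets_restrict_space)
    have "emeasure circ N' = emeasure ?D N"
      using circle_measure_sets(2)[OF N'(1)] N' N(3) unfolding circle_measure_def by simp
    then have "N' \<in> null_sets circ" using N(2) N'(1) by auto
    then have "AE x in circ. x \<notin> N'" by (rule AE_not_in)
    with AE_circ_sphere show ?thesis
    proof eventually_elim
      case (elim x)
      then have "x \<notin> N" using N' by simp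
      moreover have "x \<in> space ?D" using elim by (simp add: space_restrict_space)
      ultimately have "f x = g' x" using N(1) by blast
      then show ?case using elim by (simp add: g_def)
    qed
  qed
  from that[OF gm 1 2] show ?thesis .
qed

lemma dist_cis_squared: "(dist (cis s) (cis t))\<^sup>2 = (2 * sin ((s - t) / 2))\<^sup>2"
proof -
  have "(dist (cis s) (cis t))\<^sup>2 = (cos s - cos t)\<^sup>2 + (sin s - sin t)\<^sup>2"
    by (simp add: dist_norm cmod_power2)
  also have "\<dots> = 2 - 2 * cos (s - t)"
    using sin_cos_squared_add3[of s] sin_cos_squared_add3[of t]
    by (simp add: cos_diff power2_eq_square algebra_simps)
  also have "\<dots> = (2 * sin ((s - t) / 2))\<^sup>2"
  proof -
    have "2 * ((s - t) / 2) = s - t" by simp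
    then show ?thesis using cos_double_sin[of "(s - t) / 2"] by (simp only: power_mult_distrib) simp
  qed
  finally show ?thesis .
qed

lemma dist_cis: "dist (cis s) (cis t) = 2 * \<bar>sin ((s - t) / 2)\<bar>"
  using arg_cong[OF dist_cis_squared[of s t], of sqrt] by (simp only: real_sqrt_abs) (simp add: abs_mult)

lemma dist_cis_le: "dist (cis s) (cis t) \<le> \<bar>s - t\<bar>"
  using abs_sin_x_le_abs_x[of "(s-t)/2"] unfolding dist_cis by (simp add: abs_divide)

text \<open>By the mean value theorem \<open>sin u \<ge> u * cos u\<close>, and the cosine is at least 1/2 as long as the sine
  is at most 1/4.\<close>

lemma small_sin:
  assumes "0 \<le> u" "u \<le> pi / 2" "sin u \<le> 1 / 4"
  shows "u \<le> 2 * sin u"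
proof (cases "u = 0")
  case False
  then have u: "0 < u" using assms by simp
  then obtain z where z: "0 < z" "z < u" "sin u - sin 0 = (u - 0) * cos z"
    using MVT2[of 0 u sin cos] by (auto intro: DERIV_sin)
  have c0: "cos u \<ge> 0" using assms by (intro cos_ge_zero) auto
  have s0: "sin u \<ge> 0" using assms pi_gt_zero by (intro sin_ge_zero) linarith+
  have "(sin u)\<^sup>2 \<le> (1/4)\<^sup>2" using s0 assms by (intro power_mono) auto
  then have "(cos u)\<^sup>2 \<ge> (1/2)\<^sup>2" using sin_cos_squared_add[of u] by (simp add: power2_eq_square)
  then have "cos u \<ge> 1/2" using c0 by (rule power2_le_imp_le)
  moreover have "cos u \<le> cos z" using z assms pi_gt_zero by (intro cos_monotone_0_pi_le) linarith+
  ultimately have "u * (1/2) \<le> u * cos z" using u by (intro mult_left_mono) auto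
  then show ?thesis using z by simp
qed simp

lemma sphere_cis: "\<zeta> \<in> sphere 0 1 \<Longrightarrow> \<exists>t\<in>{0..<2*pi}. \<zeta> = cis t"
proof -
  assume "\<zeta> \<in> sphere 0 1"
  then have "\<zeta> = cis (Arg2pi \<zeta>)" by (auto simp: cis_conv_exp complex_norm_eq_1_exp)
  then show ?thesis using Arg2pi_ge_0[of \<zeta>] Arg2pi_lt_2pi[of \<zeta>] by (intro bexI[of _ "Arg2pi \<zeta>"]) auto
qed

text \<open>A chord of length \<open>\<rho> < 1/2\<close> spans an angle of at most \<open>2 * \<rho>\<close>. In the interval from 0 to \<open>2 * pi\<close> a
  small arc may be split at the end points, hence the three intervals in the proof.\<close>

lemma emeasure_circ_cball:
  assumes "a \<in> sphere 0 1" "0 \<le> \<rho>"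
  shows "emeasure circ (cball a \<rho>) \<le> ennreal (2 * \<rho>)"
proof (cases "\<rho> < 1/2")
  case False
  have "emeasure circ (cball a \<rho>) \<le> 1" by (rule circ.emeasure_le_1)
  also have "1 = ennreal 1" by simp
  also have "\<dots> \<le> ennreal (2 * \<rho>)" using False by (intro ennreal_leI) auto
  finally show ?thesis .
next
  case True
  obtain \<theta> where \<theta>: "\<theta> \<in> {0..<2*pi}" "a = cis \<theta>" using sphere_cis[OF assms(1)] by auto
  have sub: "{0..2 * pi} \<inter> cis -` cball a \<rho> \<subseteq> {\<theta> - 2 * \<rho> .. \<theta> + 2 * \<rho>} \<union> ({0..2 * \<rho>} \<union> {2 * pi - 2 * \<rho> .. 2 * pi})"
  proof
    fix t assume t: "t \<in> {0..2 * pi} \<inter> cis -` cball a \<rho>"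
    define u where "u = \<bar>\<theta> - t\<bar> / 2"
    have u: "0 \<le> u" "u \<le> pi" using t \<theta> by (auto simp: u_def)
    have "2 * \<bar>sin ((\<theta> - t)/2)\<bar> \<le> \<rho>" using t \<theta> by (simp add: dist_cis)
    moreover have "\<bar>sin ((\<theta> - t)/2)\<bar> = sin u"
    proof -
      have "\<bar>sin ((\<theta> - t)/2)\<bar> = \<bar>sin \<bar>(\<theta> - t)/2\<bar>\<bar>"
        using sin_minus[of "(\<theta> - t)/2"] by (cases "(\<theta> - t)/2 \<ge> 0") (simp_all only: abs_of_nonneg abs_of_neg abs_minus_cancel not_le)
      then show ?thesis using sin_ge_zero[OF u] by (simp add: u_def)
    qed
    ultimately have su: "2 * sin u \<le> \<rho>" by simp
    show "t \<in> {\<theta> - 2 * \<rho> .. \<theta> + 2 * \<rho>} \<union> ({0..2 * \<rho>} \<union> {2 * pi - 2 * \<rho> .. 2 * pi})"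
    proof (cases "u \<le> pi / 2")
      case T: True
      then have "u \<le> \<rho>" using small_sin[of u] u su True by auto
      then show ?thesis by (auto simp: u_def abs_if split: if_splits)
    next
      case False
      then have "pi - u \<le> \<rho>" using small_sin[of "pi - u"] u su True by auto
      then have "2 * pi - 2 * \<rho> \<le> \<bar>\<theta> - t\<bar>" by (simp add: u_def)
      then have "t \<le> 2 * \<rho> \<or> 2 * pi - 2 * \<rho> \<le> t" using t \<theta> by (cases "t \<le> \<theta>") simp_all
      then show ?thesis using t by auto
    qed
  qed
  have "emeasure lborel ({0..2 * pi} \<inter> cis -` cball a \<rho>) \<le>
     emeasure lborel ({\<theta> - 2 * \<rho> .. \<theta> + 2 * \<rho>} \<union> ({0..2 * \<rho>} \<union> {2 * pi - 2 * \<rho> .. 2 * pi}))"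
    using sub by (intro emeasure_mono) auto
  also have "\<dots> \<le> emeasure lborel {\<theta> - 2 * \<rho> .. \<theta> + 2 * \<rho>} + (emeasure lborel {0..2 * \<rho>} + emeasure lborel {2 * pi - 2 * \<rho> .. 2 * pi})"
    by (intro order_trans[OF emeasure_subadditive] add_left_mono) auto
  also have "\<dots> = ennreal (8 * \<rho>)" using assms by (simp flip: ennreal_plus)
  finally have "emeasure circ (cball a \<rho>) \<le> ennreal (1 / (2 * pi)) * ennreal (8 * \<rho>)"
    by (subst emeasure_circ) (auto intro: mult_left_mono)
  also have "\<dots> = ennreal (8 * \<rho> / (2 * pi))" using assms by (simp flip: ennreal_mult)
  also have "\<dots> \<le> ennreal (2 * \<rho>)"
  proof (rule ennreal_leI)
    have "8 * \<rho> \<le> 2 * \<rho> * (2 * pi)" using assms pi_gt3 mult_right_mono[of 2 pi \<rho>] by (simp add: mult.commute)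
    then show "8 * \<rho> / (2 * pi) \<le> 2 * \<rho>" by (simp add: divide_le_eq)
  qed
  finally show ?thesis .
qed

lemma arc_closed: "closed (cis ` {a..b})"
  by (intro compact_imp_closed compact_continuous_image continuous_intros) auto

lemma cis_eq_iff: "cis s = cis t \<longleftrightarrow> (\<exists>n::int. s = t + 2 * pi * of_int n)"
  using sin_cos_eq_iff[of s t] by (auto simp: complex_eq_iff)

text \<open>After a shift by a multiple of \<open>2 * pi\<close> the arc starts in the fundamental interval. Its preimage there is
  one interval if it ends there as well, and otherwise two intervals, one at each end.\<close>

lemma emeasure_circ_arc:
  assumes "a \<le> b" "b \<le> a + 2 * pi"
  shows "emeasure circ (cis ` {a..b}) = ennreal ((b - a) / (2 * pi))"
proof -
  have main: "emeasure circ (cis ` {a..b}) = ennreal ((b - a) / (2 * pi))"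
    if ab: "a \<le> b" "b \<le> a + 2 * pi" "0 \<le> a" "a < 2 * pi" for a b
  proof -
    let ?X = "{0..2 * pi} \<inter> cis -` cis ` {a..b}"
    have X: "?X \<in> sets lborel"
      using measurable_sets[OF cis_borel, of "cis ` {a..b}"] arc_closed[of a b] by auto
    have idx: "n = 0 \<or> n = 1 \<or> n = -1" if "s \<in> {a..b}" "t \<in> {0..2*pi}" "t = s + 2 * pi * of_int n" for s t n
    proof -
      have *: "0 \<le> s" "s < 4 * pi" "0 \<le> t" "t \<le> 2 * pi" using that ab by auto
      have p: "pi * real_of_int n \<le> pi * 1" "pi * (-2) < pi * real_of_int n"
        using * that(3) by linarith+
      have n1: "n \<le> 1" using p(1) pi_gt_zero by (simp only: mult_le_cancel_left_pos of_int_le_1_iff)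
      have "-2 < real_of_int n" using p(2) pi_gt_zero by (simp only: mult_less_cancel_left_pos)
      then have "n > -2" by linarith
      then show ?thesis using n1 by auto
    qed
    have "emeasure lborel ?X = ennreal (b - a)"
    proof (cases "b \<le> 2 * pi")
      case True
      have "?X \<subseteq> {a..b} \<union> {0, 2 * pi}"
      proof
        fix t assume t: "t \<in> ?X"
        then obtain s n where s: "s \<in> {a..b}" "t = s + 2 * pi * of_int n" by (auto simp: cis_eq_iff)
        have n: "n = 0 \<or> n = 1 \<or> n = -1" using idx[OF s(1) _ s(2)] t by blast
        have tt: "0 \<le> t" "t \<le> 2 * pi" "a \<le> s" "s \<le> b" using t s(1) by auto
        from n show "t \<in> {a..b} \<union> {0, 2 * pi}"
        proof (elim disjE)
          assume "n = 0"
          then show ?thesis using s by simp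
        next
          assume "n = 1"
          then have "t = 2 * pi" using s(2) tt ab by simp
          then show ?thesis by simp
        next
          assume "n = -1"
          then have "t = 0" using s(2) tt ab True by simp
          then show ?thesis by simp
        qed
      qed
      then have "emeasure lborel ?X \<le> emeasure lborel ({a..b} \<union> {0, 2 * pi})"
        by (intro emeasure_mono) auto
      also have "\<dots> \<le> emeasure lborel {a..b} + emeasure lborel {0, 2 * pi}"
        by (intro emeasure_subadditive) auto
      also have "\<dots> = ennreal (b - a)" using ab by (simp add: emeasure_lborel_countable)
      finally have le: "emeasure lborel ?X \<le> ennreal (b - a)" .
      have "emeasure lborel {a..b} \<le> emeasure lborel ?X"
        using X True ab by (intro emeasure_mono) auto
      then show ?thesis using le ab by (intro antisym) auto
    next
      case False
      have "?X \<subseteq> {a..2 * pi} \<union> {0..b - 2 * pi}"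
      proof
        fix t assume t: "t \<in> ?X"
        then obtain s n where s: "s \<in> {a..b}" "t = s + 2 * pi * of_int n" by (auto simp: cis_eq_iff)
        have n: "n = 0 \<or> n = 1 \<or> n = -1" using idx[OF s(1) _ s(2)] t by blast
        have tt: "0 \<le> t" "t \<le> 2 * pi" "a \<le> s" "s \<le> b" using t s(1) by auto
        from n show "t \<in> {a..2 * pi} \<union> {0..b - 2 * pi}"
          using s(2) tt ab by (elim disjE) simp_all
      qed
      then have "emeasure lborel ?X \<le> emeasure lborel ({a..2 * pi} \<union> {0..b - 2 * pi})"
        by (intro emeasure_mono) auto
      also have "\<dots> \<le> emeasure lborel {a..2 * pi} + emeasure lborel {0..b - 2 * pi}"
        by (intro emeasure_subadditive) auto
      also have "\<dots> = ennreal (b - a)" using ab False by (simp flip: ennreal_plus)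
      finally have le: "emeasure lborel ?X \<le> ennreal (b - a)" .
      have "{a..2 * pi} \<union> {0..<b - 2 * pi} \<subseteq> ?X"
      proof
        fix t assume "t \<in> {a..2 * pi} \<union> {0..<b - 2 * pi}"
        then consider "t \<in> {a..2*pi}" | "t \<in> {0..<b - 2 * pi}" by auto
        then show "t \<in> ?X"
        proof cases
          case 1 then show ?thesis using ab False by (auto intro!: imageI)
        next
          case 2
          then have "cis t = cis (t + 2 * pi)" by (auto simp: complex_eq_iff)
          then show ?thesis using 2 ab False by (auto intro!: image_eqI[of _ _ "t + 2 * pi"])
        qed
      qed
      then have "emeasure lborel ({a..2 * pi} \<union> {0..<b - 2 * pi}) \<le> emeasure lborel ?X"
        using X by (intro emeasure_mono) auto
      moreover have "emeasure lborel ({a..2 * pi} \<union> {0..<b - 2 * pi}) =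
          emeasure lborel {a..2 * pi} + emeasure lborel {0..<b - 2 * pi}"
        using ab by (intro plus_emeasure[symmetric]) auto
      moreover have "\<dots> = ennreal (b - a)" using ab False by (simp flip: ennreal_plus)
      ultimately show ?thesis using le by (intro antisym) auto
    qed
    then show ?thesis
      using ab by (subst emeasure_circ) (auto simp: arc_closed borel_closed simp flip: ennreal_mult)
  qed
  define n where "n = \<lfloor>a / (2 * pi)\<rfloor>"
  have n: "of_int n \<le> a / (2*pi)" "a / (2*pi) < of_int n + 1" unfolding n_def by linarith+
  have n': "0 \<le> a - 2 * pi * of_int n" "a - 2 * pi * of_int n < 2 * pi"
    using n by (simp_all add: field_simps)
  have "cis ` {a..b} = cis ` {a - 2 * pi * of_int n .. b - 2 * pi * of_int n}"
  proof -
    have "{a - 2 * pi * of_int n .. b - 2 * pi * of_int n} = (\<lambda>x. x - 2 * pi * of_int n) ` {a..b}"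
      by (rule image_minus_const_atLeastAtMost'[symmetric])
    moreover have "cis (x - 2 * pi * of_int n) = cis x" for x
      unfolding cis_eq_iff by (rule exI[of _ "-n"]) simp
    ultimately show ?thesis by (simp only: image_image)
  qed
  then have "emeasure circ (cis ` {a..b}) = emeasure circ (cis ` {a - 2 * pi * of_int n .. b - 2 * pi * of_int n})"
    by (rule arg_cong)
  also have "\<dots> = ennreal ((b - 2 * pi * of_int n - (a - 2 * pi * of_int n)) / (2 * pi))"
    using assms n' by (intro main) linarith+
  also have "b - 2 * pi * of_int n - (a - 2 * pi * of_int n) = b - a" by simp
  finally show ?thesis .
qed

section \<open>The centred maximal function\<close>

text \<open>The common summation step of covering arguments: a cover by sets which are controlled, one by one, by
  disjoint sets.\<close>

lemma outer_measure_circ_disjoint_cover: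
  assumes C: "countable C" and E: "E \<subseteq> (\<Union>i\<in>C. A i)"
    and A: "\<And>i. i \<in> C \<Longrightarrow> A i \<in> sets borel"
    and D: "\<And>i. i \<in> C \<Longrightarrow> D i \<in> sets borel" "disjoint_family_on D C"
    and \<mu>: "sets \<mu> = sets borel"
    and le: "\<And>i. i \<in> C \<Longrightarrow> emeasure circ (A i) \<le> c * emeasure \<mu> (D i)"
  shows "outer_measure_of circ E \<le> c * emeasure \<mu> UNIV"
proof -
  let ?I = "to_nat_on C ` C"
  define A' where "A' n = (if n \<in> ?I then A (from_nat_into C n) else {})" for n
  define D' where "D' n = (if n \<in> ?I then D (from_nat_into C n) else {})" for n
  have in_C: "from_nat_into C n \<in> C" if "n \<in> ?I" for n
    using that C by auto
  have A'm: "A' n \<in> sets circ" for n using A in_C by (auto simp: A'_def)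
  have D'm: "D' n \<in> sets \<mu>" for n using D in_C \<mu> by (auto simp: D'_def)
  have dis: "disjoint_family D'"
    unfolding disjoint_family_on_def
  proof (intro ballI impI)
    fix m n :: nat assume "m \<noteq> n"
    show "D' m \<inter> D' n = {}"
    proof (cases "m \<in> ?I \<and> n \<in> ?I")
      case True
      then have "from_nat_into C m \<noteq> from_nat_into C n"
        using \<open>m \<noteq> n\<close> C by auto
      then show ?thesis using D(2) in_C True by (auto simp: D'_def disjoint_family_on_def)
    qed (auto simp: D'_def)
  qed
  have "E \<subseteq> (\<Union>n. A' n)"
  proof
    fix x assume "x \<in> E"
    then obtain i where i: "i \<in> C" "x \<in> A i" using E by auto
    then have "x \<in> A' (to_nat_on C i)" using C by (auto simp: A'_def)
    then show "x \<in> (\<Union>n. A' n)" by blast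
  qed
  then have "outer_measure_of circ E \<le> emeasure circ (\<Union>n. A' n)"
    unfolding outer_measure_of_def using A'm by (intro INF_lower) auto
  also have "\<dots> \<le> (\<Sum>n. emeasure circ (A' n))"
    using A'm by (intro emeasure_subadditive_countably) auto
  also have "\<dots> \<le> (\<Sum>n. c * emeasure \<mu> (D' n))"
    using le in_C by (intro suminf_le) (auto simp: A'_def D'_def)
  also have "\<dots> = c * emeasure \<mu> (\<Union>n. D' n)"
  proof -
    have "(\<Sum>n. emeasure \<mu> (D' n)) = emeasure \<mu> (\<Union>n. D' n)"
      using D'm dis by (intro suminf_emeasure) auto
    then show ?thesis by simp
  qed
  also have "\<dots> \<le> c * emeasure \<mu> UNIV"
    using \<mu> by (intro mult_left_mono emeasure_mono) auto
  finally show ?thesis .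
qed

text \<open>A superlevel set of the centred maximal function. Discs of the plane take the place of arcs, and the
  radius that of the length of the arc.\<close>

definition high_density :: "complex measure \<Rightarrow> real \<Rightarrow> complex set" where
  "high_density \<mu> T = {\<zeta> \<in> sphere 0 1. \<exists>\<rho>>0. emeasure \<mu> (cball \<zeta> \<rho>) > ennreal (T * \<rho>)}"

text \<open>Vitali's lemma extracts from the discs of high density disjoint ones whose fivefold enlargements still
  cover; an enlarged disc of radius \<open>5 * \<rho>\<close> has measure at most \<open>10 * \<rho>\<close>.\<close>

lemma maximal_weak_type:
  assumes \<mu>: "sets \<mu> = sets borel" and m: "emeasure \<mu> UNIV \<le> ennreal m" "0 \<le> m" and T: "0 < T"
  shows "outer_measure_of circ (high_density \<mu> T) \<le> ennreal (10 * m / T)"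
proof -
  let ?E = "high_density \<mu> T"
  have "\<forall>\<zeta>\<in>?E. \<exists>\<rho>. \<rho> > 0 \<and> emeasure \<mu> (cball \<zeta> \<rho>) > ennreal (T * \<rho>)"
    by (auto simp: high_density_def)
  then obtain r where r: "\<And>\<zeta>. \<zeta> \<in> ?E \<Longrightarrow> r \<zeta> > 0"
      and rm: "\<And>\<zeta>. \<zeta> \<in> ?E \<Longrightarrow> emeasure \<mu> (cball \<zeta> (r \<zeta>)) > ennreal (T * r \<zeta>)"
    by metis
  have rB: "r \<zeta> \<le> m / T" if "\<zeta> \<in> ?E" for \<zeta>
  proof -
    have "ennreal (T * r \<zeta>) \<le> emeasure \<mu> (cball \<zeta> (r \<zeta>))" using rm[OF that] by simp
    also have "\<dots> \<le> emeasure \<mu> UNIV" using \<mu> by (intro emeasure_mono) auto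
    also have "\<dots> \<le> ennreal m" by fact
    finally have "T * r \<zeta> \<le> m" using m by (simp add: ennreal_le_iff)
    then show ?thesis using T by (simp add: field_simps)
  qed
  obtain C where C: "countable C" "C \<subseteq> ?E"
     "pairwise (\<lambda>i j. disjnt (cball i (r i)) (cball j (r j))) C"
     "?E \<subseteq> (\<Union>i\<in>C. cball i (5 * r i))"
    using r rB by (rule_tac Vitali_covering_lemma_cballs[where S = ?E and K = ?E and a = "\<lambda>i. i" and r = r and B = "m / T"]) (auto simp: less_imp_le)
  have "outer_measure_of circ ?E \<le> ennreal (10 / T) * emeasure \<mu> UNIV"
  proof (rule outer_measure_circ_disjoint_cover[OF C(1) C(4)])
    show "disjoint_family_on (\<lambda>i. cball i (r i)) C"
      using C(3) by (auto simp: disjoint_family_on_def pairwise_def disjnt_def)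
    fix i assume i: "i \<in> C"
    then have iE: "i \<in> ?E" using C by auto
    then have "i \<in> sphere 0 1" by (simp add: high_density_def)
    then have "emeasure circ (cball i (5 * r i)) \<le> ennreal (2 * (5 * r i))"
      using r[OF iE] by (intro emeasure_circ_cball) auto
    also have "\<dots> = ennreal (10 / T) * ennreal (T * r i)"
      using T r[OF iE] by (simp flip: ennreal_mult)
    also have "\<dots> \<le> ennreal (10 / T) * emeasure \<mu> (cball i (r i))"
      using rm[OF iE] by (intro mult_left_mono) auto
    finally show "emeasure circ (cball i (5 * r i)) \<le> ennreal (10 / T) * emeasure \<mu> (cball i (r i))" .
  qed (use \<mu> in auto)
  also have "\<dots> \<le> ennreal (10 / T) * ennreal m"
    using m by (intro mult_left_mono) auto
  also have "\<dots> = ennreal (10 * m / T)" using T m by (simp flip: ennreal_mult)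
  finally show ?thesis .
qed

text \<open>The term of the first shell that contains \<open>x\<close> already suffices.\<close>

lemma inverse_square_le_shells:
  fixes d x :: real assumes "0 < d" "d \<le> x"
  shows "ennreal (1 / x\<^sup>2) \<le> (\<Sum>k. ennreal (4 / (4 ^ k * d\<^sup>2)) * indicator {..2 ^ k * d} x)"
proof -
  define k where "k = (LEAST k::nat. x \<le> 2 ^ k * d)"
  obtain n :: nat where "x / d < 2 ^ n" using real_arch_pow[of 2 "x / d"] by auto
  then have "x \<le> 2 ^ n * d" using assms by (simp add: field_simps)
  then have k: "x \<le> 2 ^ k * d" unfolding k_def by (rule LeastI)
  have low: "2 ^ k * d \<le> 2 * x"
  proof (cases k)
    case 0 then show ?thesis using assms by simp
  next
    case (Suc j)
    then have "\<not> x \<le> 2 ^ j * d" using not_less_Least[of j "\<lambda>k. x \<le> 2 ^ k * d"] by (simp add: k_def)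
    then show ?thesis using Suc by simp
  qed
  have "(2 ^ k * d)\<^sup>2 \<le> (2 * x)\<^sup>2" using low assms by (intro power_mono) auto
  moreover have "(2 ^ k)\<^sup>2 = (4::real) ^ k" by (simp add: power2_eq_square flip: power_mult_distrib)
  ultimately have "4 ^ k * d\<^sup>2 \<le> 4 * x\<^sup>2" by (simp add: power_mult_distrib)
  then have "1 / x\<^sup>2 \<le> 4 / (4 ^ k * d\<^sup>2)" using assms by (simp add: field_simps)
  then have "ennreal (1 / x\<^sup>2) \<le> ennreal (4 / (4 ^ k * d\<^sup>2)) * indicator {..2 ^ k * d} x"
    using k by (simp add: ennreal_leI)
  also have "\<dots> = (\<Sum>j\<in>{k}. ennreal (4 / (4 ^ j * d\<^sup>2)) * indicator {..2 ^ j * d} x)"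
    by (simp only: sum.insert[OF finite.emptyI] empty_iff not_False_eq_True sum.empty add_0_right)
  also have "\<dots> \<le> (\<Sum>k. ennreal (4 / (4 ^ k * d\<^sup>2)) * indicator {..2 ^ k * d} x)"
    by (intro sum_le_suminf) auto
  finally show ?thesis .
qed

text \<open>The disc of radius \<open>2 ^ k * d\<close> about \<open>z\<close>, with \<open>d = 1 - |z|\<close>, lies in the disc of radius \<open>2 ^ k * d + |\<zeta> - z|\<close>
  about \<open>\<zeta>\<close>, so its mass is at most \<open>2 * 2 ^ k * T * |\<zeta> - z|\<close>. Against the weights \<open>4 / (4 ^ k * d\<^sup>2)\<close>
  of the shells this is a geometric series.\<close>

lemma kernel_le_maximal:
  assumes \<mu>: "sets \<mu> = sets borel" "AE \<xi> in \<mu>. \<xi> \<in> sphere 0 1"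
    and z: "z \<in> ball 0 1" and \<zeta>: "\<zeta> \<in> sphere 0 1" "\<zeta> \<notin> high_density \<mu> T" and T: "0 \<le> T"
  shows "(\<integral>\<^sup>+ \<xi>. ennreal (1 / (dist \<xi> z)\<^sup>2) \<partial>\<mu>) \<le> ennreal (16 * T * dist \<zeta> z / (1 - norm z)\<^sup>2)"
proof -
  define d where "d = 1 - norm z"
  define R where "R = dist \<zeta> z"
  have d: "0 < d" using z by (simp add: d_def)
  have dist_ge: "d \<le> dist \<xi> z" if "\<xi> \<in> sphere 0 1" for \<xi>
    using that norm_triangle_ineq2[of \<xi> z] by (simp add: d_def dist_norm)
  have dR: "d \<le> R" unfolding R_def using \<zeta> by (intro dist_ge)
  have [measurable_cong]: "sets \<mu> = sets borel" by fact
  have "(\<integral>\<^sup>+ \<xi>. ennreal (1 / (dist \<xi> z)\<^sup>2) \<partial>\<mu>)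
      \<le> (\<integral>\<^sup>+ \<xi>. (\<Sum>k. ennreal (4 / (4 ^ k * d\<^sup>2)) * indicator (cball z (2 ^ k * d)) \<xi>) \<partial>\<mu>)"
  proof (rule nn_integral_mono_AE)
    show "AE \<xi> in \<mu>. ennreal (1 / (dist \<xi> z)\<^sup>2) \<le> (\<Sum>k. ennreal (4 / (4 ^ k * d\<^sup>2)) * indicator (cball z (2 ^ k * d)) \<xi>)"
      using \<mu>(2)
    proof eventually_elim
      case (elim \<xi>)
      have "ennreal (1 / (dist \<xi> z)\<^sup>2) \<le> (\<Sum>k. ennreal (4 / (4 ^ k * d\<^sup>2)) * indicator {..2 ^ k * d} (dist \<xi> z))"
        using d dist_ge[OF elim] by (rule inverse_square_le_shells)
      also have "(\<lambda>k. indicator {..2 ^ k * d} (dist \<xi> z) :: ennreal) = (\<lambda>k. indicator (cball z (2 ^ k * d)) \<xi>)"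
        by (auto simp: indicator_def dist_commute)
      finally show ?case by (simp add: fun_eq_iff)
    qed
  qed
  also have "\<dots> = (\<Sum>k. \<integral>\<^sup>+ \<xi>. ennreal (4 / (4 ^ k * d\<^sup>2)) * indicator (cball z (2 ^ k * d)) \<xi> \<partial>\<mu>)"
    using \<mu> by (intro nn_integral_suminf borel_measurable_times_ennreal borel_measurable_indicator) auto
  also have "\<dots> = (\<Sum>k. ennreal (4 / (4 ^ k * d\<^sup>2)) * emeasure \<mu> (cball z (2 ^ k * d)))"
    by (simp add: nn_integral_cmult_indicator \<mu>)
  also have "\<dots> \<le> (\<Sum>k. ennreal (8 * T * R / d\<^sup>2 * (1/2) ^ k))"
  proof (intro suminf_le allI)
    fix k :: nat
    have kd: "1 \<le> (2::real) ^ k" by simp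
    have "emeasure \<mu> (cball z (2 ^ k * d)) \<le> emeasure \<mu> (cball \<zeta> (2 ^ k * d + R))"
    proof (intro emeasure_mono subsetI)
      fix w assume "w \<in> cball z (2 ^ k * d)"
      then show "w \<in> cball \<zeta> (2 ^ k * d + R)"
        using dist_triangle[of \<zeta> w z] by (simp add: R_def)
    qed (use \<mu> in auto)
    also have "\<dots> \<le> ennreal (T * (2 ^ k * d + R))"
    proof -
      have "2 ^ k * d + R > 0" using d dR kd by (intro add_pos_pos mult_pos_pos) auto
      moreover have "\<not> emeasure \<mu> (cball \<zeta> \<rho>) > ennreal (T * \<rho>)" if "\<rho> > 0" for \<rho>
        using \<zeta> that unfolding high_density_def by blast
      ultimately show ?thesis by (simp add: not_less)
    qed
    also have "\<dots> \<le> ennreal (T * (2 * 2 ^ k * R))"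
    proof (intro ennreal_leI mult_left_mono T)
      have "2 ^ k * d \<le> 2 ^ k * R" using dR by (intro mult_left_mono) auto
      moreover have "1 * R \<le> 2 ^ k * R" using d dR kd by (intro mult_right_mono) auto
      ultimately show "2 ^ k * d + R \<le> 2 * 2 ^ k * R" by linarith
    qed
    finally have "ennreal (4 / (4 ^ k * d\<^sup>2)) * emeasure \<mu> (cball z (2 ^ k * d)) \<le>
        ennreal (4 / (4 ^ k * d\<^sup>2)) * ennreal (T * (2 * 2 ^ k * R))"
      by (rule mult_left_mono) simp
    also have "\<dots> = ennreal (4 / (4 ^ k * d\<^sup>2) * (T * (2 * 2 ^ k * R)))"
      using T d dR by (intro ennreal_mult[symmetric]) auto
    also have "4 / (4 ^ k * d\<^sup>2) * (T * (2 * 2 ^ k * R)) = 8 * T * R / d\<^sup>2 * (1/2) ^ k"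
    proof -
      have "(4::real) ^ k = 2 ^ k * 2 ^ k" by (simp flip: power_mult_distrib)
      then show ?thesis using d by (simp add: field_simps power_divide)
    qed
    finally show "ennreal (4 / (4 ^ k * d\<^sup>2)) * emeasure \<mu> (cball z (2 ^ k * d)) \<le> ennreal (8 * T * R / d\<^sup>2 * (1/2) ^ k)" .
  qed auto
  also have "\<dots> = ennreal (16 * T * R / d\<^sup>2)"
  proof (rule suminf_ennreal_eq)
    show "(\<lambda>k. 8 * T * R / d\<^sup>2 * (1/2) ^ k) sums (16 * T * R / d\<^sup>2)"
      using sums_mult[OF geometric_sums[of "1/2::real"], of "8 * T * R / d\<^sup>2"] by (simp add: mult.assoc)
    show "0 \<le> 8 * T * R / d\<^sup>2 * (1/2) ^ k" for k using T d dR by simp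
  qed
  finally show ?thesis by (simp add: d_def R_def)
qed

section \<open>Shadows and the Hardy--Littlewood maximal function of arcs\<close>

lemma shadow_closed: "closed (shadow \<alpha> z)"
proof -
  have "shadow \<alpha> z = (if z \<in> ball 0 1 then sphere 0 1 \<inter> cball z (\<alpha> * (1 - (norm z)\<^sup>2)) else {})"
    by (auto simp: shadow_def stolz_def dist_norm norm_minus_commute)
  then show ?thesis by auto
qed

lemma shadow_borel [measurable]: "shadow \<alpha> z \<in> sets borel"
  by (rule borel_closed[OF shadow_closed])

lemma one_minus_norm_squared:
  assumes "z \<in> ball (0::complex) 1"
  shows "1 - norm z \<le> 1 - (norm z)\<^sup>2" "1 - (norm z)\<^sup>2 \<le> 2 * (1 - norm z)"
proof -
  have z: "norm z < 1" using assms by simp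
  have eq: "1 - (norm z)\<^sup>2 = (1 - norm z) * (1 + norm z)" by (simp add: power2_eq_square algebra_simps)
  show "1 - norm z \<le> 1 - (norm z)\<^sup>2" unfolding eq using z mult_left_mono[of 1 "1 + norm z" "1 - norm z"] by simp
  show "1 - (norm z)\<^sup>2 \<le> 2 * (1 - norm z)" unfolding eq using z mult_left_mono[of "1 + norm z" 2 "1 - norm z"] by simp
qed

lemma shadow_dist:
  assumes "\<xi> \<in> shadow \<alpha> z" "\<alpha> \<ge> 1"
  shows "dist \<xi> z \<le> 2 * \<alpha> * (1 - norm z)" "\<xi> \<in> sphere 0 1" "z \<in> ball 0 1"
proof -
  show z: "z \<in> ball 0 1" and "\<xi> \<in> sphere 0 1" using assms by (auto simp: shadow_def stolz_def)
  have "dist \<xi> z \<le> \<alpha> * (1 - (norm z)\<^sup>2)" using assms by (auto simp: shadow_def stolz_def dist_norm norm_minus_commute)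
  also have "\<dots> \<le> \<alpha> * (2 * (1 - norm z))" using one_minus_norm_squared(2)[OF z] assms by (intro mult_left_mono) auto
  finally show "dist \<xi> z \<le> 2 * \<alpha> * (1 - norm z)" by (simp add: algebra_simps)
qed

lemma emeasure_circ_shadow:
  assumes "\<alpha> \<ge> 1" "z \<in> ball 0 1"
  shows "emeasure circ (shadow \<alpha> z) \<le> ennreal (8 * \<alpha> * (1 - norm z))"
proof (cases "shadow \<alpha> z = {}")
  case False
  then obtain \<xi> where \<xi>: "\<xi> \<in> shadow \<alpha> z" by auto
  have "shadow \<alpha> z \<subseteq> cball \<xi> (4 * \<alpha> * (1 - norm z))"
  proof
    fix w assume w: "w \<in> shadow \<alpha> z"
    have "dist \<xi> w \<le> dist \<xi> z + dist w z" by (rule dist_triangle2)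
    then show "w \<in> cball \<xi> (4 * \<alpha> * (1 - norm z))"
      using shadow_dist[OF w] shadow_dist[OF \<xi>] assms by simp
  qed
  then have "emeasure circ (shadow \<alpha> z) \<le> emeasure circ (cball \<xi> (4 * \<alpha> * (1 - norm z)))"
    by (intro emeasure_mono) auto
  also have "\<dots> \<le> ennreal (2 * (4 * \<alpha> * (1 - norm z)))"
    using shadow_dist[OF \<xi>] assms by (intro emeasure_circ_cball) auto
  finally show ?thesis by (simp add: mult.assoc)
qed simp

lemma arc_cases:
  assumes "I \<in> circle_arcs"
  obtains a b where "I = cis ` {a..b}" "a < b" "b \<le> a + 2 * pi" "I \<in> sets borel" "I \<subseteq> sphere 0 1"
    "emeasure circle_measure I = ennreal ((b - a) / (2 * pi))" "emeasure circ I = ennreal ((b - a) / (2 * pi))"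
proof -
  obtain a b where ab: "I = cis ` {a..b}" "a < b" "b \<le> a + 2 * pi"
    using assms by (auto simp: circle_arcs_def)
  have b: "I \<in> sets borel" unfolding ab by (intro borel_closed arc_closed)
  have s: "I \<subseteq> sphere 0 1" unfolding ab by auto
  have e: "emeasure circ I = ennreal ((b - a) / (2 * pi))" unfolding ab(1) using ab by (intro emeasure_circ_arc) auto
  have "I \<inter> sphere 0 1 = I" using s by auto
  then have "emeasure circle_measure I = ennreal ((b - a) / (2 * pi))" using circle_measure_sets(2)[OF b] e by simp
  from that[OF ab b s this e] show ?thesis .
qed

lemma arc_integral_indicator:
  assumes "I \<in> circle_arcs" "A \<in> sets borel"
  shows "(\<integral>\<^sup>+ \<zeta> \<in> I. indicator A \<zeta> \<partial>circle_measure) = emeasure circ (A \<inter> I)"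
proof -
  from arc_cases[OF assms(1)] have I: "I \<in> sets borel" "I \<subseteq> sphere 0 1" by metis+
  have "(\<integral>\<^sup>+ \<zeta> \<in> I. indicator A \<zeta> \<partial>circle_measure) = (\<integral>\<^sup>+ \<zeta>. indicator (A \<inter> I \<inter> sphere 0 1) \<zeta> \<partial>circle_measure)"
    using I by (intro nn_integral_cong) (auto simp: indicator_def)
  also have "\<dots> = emeasure circ (A \<inter> I)"
    using circle_measure_sets[of "A \<inter> I"] I assms by simp
  finally show ?thesis .
qed

lemma hl_maximal_indicator_le_1:
  assumes "A \<in> sets borel"
  shows "hl_maximal (indicator A) \<zeta> \<le> 1"
  unfolding hl_maximal_def
proof (rule SUP_least)
  fix I assume "I \<in> {I \<in> circle_arcs. \<zeta> \<in> I}"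
  then have I: "I \<in> circle_arcs" by simp
  obtain a b where ab: "I \<in> sets borel" "I \<subseteq> sphere 0 1" "a < b"
    "emeasure circle_measure I = ennreal ((b - a) / (2 * pi))" "emeasure circ I = ennreal ((b - a) / (2 * pi))"
    by (rule arc_cases[OF I]) metis
  have "emeasure circ (A \<inter> I) \<le> emeasure circ I" using ab by (intro emeasure_mono) auto
  then have "emeasure circ (A \<inter> I) \<le> emeasure circle_measure I" using ab by simp
  then show "(\<integral>\<^sup>+ \<zeta> \<in> I. indicator A \<zeta> \<partial>circle_measure) / emeasure circle_measure I \<le> 1"
    unfolding arc_integral_indicator[OF I assms] using ab by (intro divide_le_posI_ennreal) auto
qed

text \<open>The shadow has diameter and measure at most of order \<open>1 - |z|\<close>. An arc through \<open>\<zeta>\<close> that meets it is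
  at least of length \<open>|\<zeta> - z| / 2\<close>, unless \<open>|\<zeta> - z|\<close> is itself of order \<open>1 - |z|\<close>; in that case the
  trivial bound 1 is good enough.\<close>

lemma hl_maximal_shadow_le:
  assumes \<alpha>: "\<alpha> \<ge> 1" and z: "z \<in> ball 0 1" and \<zeta>: "\<zeta> \<in> sphere 0 1"
  shows "hl_maximal (indicator (shadow \<alpha> z)) \<zeta> \<le> ennreal (32 * pi * \<alpha> * (1 - norm z) / dist \<zeta> z)"
proof (cases "dist \<zeta> z \<ge> 4 * \<alpha> * (1 - norm z)")
  case False
  have d: "0 < 1 - norm z" using z by simp
  have pos: "dist \<zeta> z > 0" using z \<zeta> by (auto simp: dist_pos_lt)
  have "hl_maximal (indicator (shadow \<alpha> z)) \<zeta> \<le> 1" by (intro hl_maximal_indicator_le_1) simp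
  also have "1 = ennreal 1" by simp
  also have "\<dots> \<le> ennreal (32 * pi * \<alpha> * (1 - norm z) / dist \<zeta> z)"
  proof (rule ennreal_leI)
    have "dist \<zeta> z \<le> 1 * (4 * \<alpha> * (1 - norm z))" using False by simp
    also have "\<dots> \<le> (8 * pi) * (4 * \<alpha> * (1 - norm z))" using d \<alpha> pi_gt3 by (intro mult_right_mono) auto
    finally show "1 \<le> 32 * pi * \<alpha> * (1 - norm z) / dist \<zeta> z" using pos by (simp add: field_simps)
  qed
  finally show ?thesis .
next
  case True
  have d: "0 < 1 - norm z" using z by simp
  have pos: "dist \<zeta> z > 0" using z \<zeta> by (auto simp: dist_pos_lt)
  show ?thesis
    unfolding hl_maximal_def
  proof (rule SUP_least)
    fix I assume "I \<in> {I \<in> circle_arcs. \<zeta> \<in> I}"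
    then have I: "I \<in> circle_arcs" "\<zeta> \<in> I" by auto
    obtain a b where ab: "I = cis ` {a..b}" "I \<in> sets borel" "I \<subseteq> sphere 0 1" "a < b" "b \<le> a + 2 * pi"
      "emeasure circle_measure I = ennreal ((b - a) / (2 * pi))"
      by (rule arc_cases[OF I(1)]) metis
    show "(\<integral>\<^sup>+ \<zeta> \<in> I. indicator (shadow \<alpha> z) \<zeta> \<partial>circle_measure) / emeasure circle_measure I
        \<le> ennreal (32 * pi * \<alpha> * (1 - norm z) / dist \<zeta> z)"
    proof (cases "shadow \<alpha> z \<inter> I = {}")
      case True
      then show ?thesis unfolding arc_integral_indicator[OF I(1) shadow_borel] by simp
    next
      case False
      then obtain \<xi> where \<xi>: "\<xi> \<in> shadow \<alpha> z" "\<xi> \<in> I" by auto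
      obtain s t where st: "\<zeta> = cis s" "\<xi> = cis t" "s \<in> {a..b}" "t \<in> {a..b}"
        using I \<xi> ab(1) by auto
      have "dist \<zeta> z \<le> dist \<zeta> \<xi> + dist \<xi> z" by (rule dist_triangle)
      also have "dist \<zeta> \<xi> \<le> b - a" using dist_cis_le[of s t] st by auto
      also have "dist \<xi> z \<le> dist \<zeta> z / 2" using shadow_dist[OF \<xi>(1) \<alpha>] True by simp
      finally have ba: "dist \<zeta> z \<le> 2 * (b - a)" by simp
      have "emeasure circ (shadow \<alpha> z \<inter> I) \<le> emeasure circ (shadow \<alpha> z)"
        using ab by (intro emeasure_mono) auto
      also have "\<dots> \<le> ennreal (8 * \<alpha> * (1 - norm z))" using \<alpha> z by (rule emeasure_circ_shadow)
      also have "\<dots> \<le> ennreal ((b - a) / (2 * pi) * (32 * pi * \<alpha> * (1 - norm z) / dist \<zeta> z))"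
      proof (rule ennreal_leI)
        have *: "8 * \<alpha> * (1 - norm z) * dist \<zeta> z \<le> 8 * \<alpha> * (1 - norm z) * (2 * (b - a))"
          using ba d \<alpha> by (intro mult_left_mono) auto
        show "8 * \<alpha> * (1 - norm z) \<le> (b - a) / (2 * pi) * (32 * pi * \<alpha> * (1 - norm z) / dist \<zeta> z)"
        proof -
          have "(b - a) / (2 * pi) * (32 * pi * \<alpha> * (1 - norm z) / dist \<zeta> z) = 8 * \<alpha> * (1 - norm z) * (2 * (b - a)) / dist \<zeta> z"
          proof -
            have "x / (2 * pi) * (32 * pi * y / D) = 8 * y * (2 * x) / D" for x y D :: real by simp
            from this[of "b - a" "\<alpha> * (1 - norm z)"] show ?thesis by (simp only: mult.assoc)
          qed
          then show ?thesis using pos * by (simp only: pos_le_divide_eq)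
        qed
      qed
      also have "\<dots> = ennreal (32 * pi * \<alpha> * (1 - norm z) / dist \<zeta> z) * emeasure circle_measure I"
        using ab pos d \<alpha> by (simp add: mult.commute ennreal_mult[symmetric])
      finally show ?thesis
        unfolding arc_integral_indicator[OF I(1) shadow_borel] using ab
        by (intro divide_le_posI_ennreal) (auto simp: mult.commute)
    qed
  qed
qed

text \<open>A slight enlargement of an arc hardly changes the average and makes every point of the given arc an
  interior point. The full circle cannot be enlarged but contains all points anyway.\<close>

lemma openin_hl_maximal:
  assumes A: "A \<in> sets borel"
  shows "openin (top_of_set (sphere 0 1)) {\<zeta> \<in> sphere 0 1. hl_maximal (indicator A) \<zeta> > c}"
  unfolding openin_contains_ball
proof (intro conjI ballI)
  let ?E = "{\<zeta> \<in> sphere 0 1. hl_maximal (indicator A) \<zeta> > c}"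
  show "?E \<subseteq> sphere 0 1" by auto
  fix \<zeta> assume "\<zeta> \<in> ?E"
  then have \<zeta>: "\<zeta> \<in> sphere 0 1" and c: "c < hl_maximal (indicator A) \<zeta>" by auto
  from c obtain I where I: "I \<in> circle_arcs" "\<zeta> \<in> I"
      and cI: "c < emeasure circ (A \<inter> I) / emeasure circle_measure I"
    unfolding hl_maximal_def less_SUP_iff using arc_integral_indicator[OF _ A] by force
  obtain a b where ab: "I = cis ` {a..b}" "I \<in> sets borel" "a < b" "b \<le> a + 2 * pi"
      "emeasure circle_measure I = ennreal ((b - a) / (2 * pi))"
    by (rule arc_cases[OF I(1)]) metis
  obtain s where s: "\<zeta> = cis s" "s \<in> {a..b}" using I ab by auto
  define x where "x = measure circ (A \<inter> I)"
  have x: "emeasure circ (A \<inter> I) = ennreal x" unfolding x_def by (rule circ.emeasure_eq_measure)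
  have x0: "0 \<le> x" by (simp add: x_def)
  have clt: "c < ennreal (x / ((b - a) / (2 * pi)))"
    using cI ab x0 unfolding x by (subst (asm) ab(5), subst (asm) divide_ennreal) auto
  then obtain c' where c': "c = ennreal c'" "0 \<le> c'" by (cases c) auto
  have "c' < x / ((b - a) / (2 * pi))" using clt c' ab x0 by (simp add: ennreal_less_iff)
  then have cx: "c' * ((b - a) / (2 * pi)) < x" using ab by (simp add: field_simps)
  \<comment> \<open>Any larger arc \<open>J\<close> that is not too long puts all of its points into the set.\<close>
  have nbh: "\<zeta>' \<in> ?E" if J: "J \<in> circle_arcs" "\<zeta>' \<in> J" "I \<subseteq> J" and Jm: "emeasure circle_measure J = ennreal j" "0 < j" "c' * j < x" for J j \<zeta>'
  proof -
    obtain a b where ab': "J \<in> sets borel" "J \<subseteq> sphere 0 1"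
      by (rule arc_cases[OF J(1)]) metis
    have "c < ennreal (x / j)" using c' Jm x0 by (simp add: ennreal_less_iff field_simps)
    also have "\<dots> = ennreal x / ennreal j" using x0 Jm by (simp add: divide_ennreal)
    also have "\<dots> \<le> emeasure circ (A \<inter> J) / emeasure circle_measure J"
      unfolding x[symmetric] Jm using J ab' A ab by (intro divide_right_mono_ennreal emeasure_mono) auto
    also have "\<dots> \<le> hl_maximal (indicator A) \<zeta>'"
      unfolding hl_maximal_def arc_integral_indicator[OF J(1) A, symmetric] using J by (intro SUP_upper) auto
    finally show ?thesis using J ab' by auto
  qed
  show "\<exists>e>0. ball \<zeta> e \<inter> sphere 0 1 \<subseteq> ?E"
  proof (cases "b = a + 2 * pi")
    case True
    have "\<zeta>' \<in> ?E" if S: "\<zeta>' \<in> sphere 0 1" for \<zeta>'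
    proof -
      obtain t where t: "\<zeta>' = cis t" using sphere_cis[OF S] by auto
      define n where "n = \<lfloor>(t - a) / (2 * pi)\<rfloor>"
      have n: "of_int n \<le> (t - a) / (2 * pi)" "(t - a) / (2 * pi) < of_int n + 1" unfolding n_def by linarith+
      have "0 \<le> t - a - 2 * pi * of_int n" "t - a - 2 * pi * of_int n < 2 * pi"
        using n by (simp_all add: field_simps)
      moreover have "cis t = cis (t - 2 * pi * of_int n)" unfolding cis_eq_iff by (rule exI[of _ n]) simp
      ultimately have "\<zeta>' \<in> I" unfolding ab(1) t True by (intro image_eqI[of _ _ "t - 2 * pi * of_int n"]) auto
      then show ?thesis using ab cx by (intro nbh[OF I(1) _ order_refl, of _ "(b - a) / (2 * pi)"]) auto
    qed
    then show ?thesis by (intro exI[of _ 1]) auto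
  next
    case False
    have "((\<lambda>h. c' * ((b - a + 2 * h) / (2 * pi))) \<longlongrightarrow> c' * ((b - a + 2 * 0) / (2 * pi))) (at_right 0)"
      by (intro tendsto_intros) auto
    then have "eventually (\<lambda>h. c' * ((b - a + 2 * h) / (2 * pi)) < x) (at_right 0)"
      using cx by (intro order_tendstoD(2)) auto
    moreover have "eventually (\<lambda>h. h \<in> {0<..<(a + 2 * pi - b) / 2}) (at_right 0)"
      using False ab by (intro eventually_at_right_real) auto
    ultimately have "eventually (\<lambda>h. c' * ((b - a + 2 * h) / (2 * pi)) < x \<and> h \<in> {0<..<(a + 2 * pi - b) / 2}) (at_right 0)"
      by eventually_elim auto
    then obtain h where h: "c' * ((b - a + 2 * h) / (2 * pi)) < x" "0 < h" "h < (a + 2 * pi - b) / 2"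
      using eventually_happens'[OF trivial_limit_at_right_real[of "0::real"]] by auto
    define J where "J = cis ` {a - h..b + h}"
    have "a - h < b + h \<and> b + h \<le> a - h + 2 * pi" using h ab(3) by simp
    then have J: "J \<in> circle_arcs" unfolding J_def circle_arcs_def by blast
    have J': "I \<subseteq> J" unfolding J_def ab(1) using h(2) by (intro image_mono) auto
    have Jm: "emeasure circle_measure J = ennreal ((b - a + 2 * h) / (2 * pi))"
    proof -
      have "J \<inter> sphere 0 1 = J" by (auto simp: J_def)
      then have "emeasure circle_measure J = emeasure circ J"
        using circle_measure_sets(2)[of J] by (simp add: J_def arc_closed borel_closed)
      also have "\<dots> = ennreal ((b + h - (a - h)) / (2 * pi))"
        unfolding J_def using h ab by (intro emeasure_circ_arc) auto
      finally show ?thesis by (simp add: algebra_simps)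
    qed
    have z0: "\<zeta> \<noteq> 0" using \<zeta> by auto
    have "isCont (\<lambda>w. Arg (w / \<zeta>)) \<zeta>"
    proof (rule isCont_o2[where g=Arg])
      show "isCont (\<lambda>w. w / \<zeta>) \<zeta>" using z0 by (intro continuous_intros) auto
      show "isCont Arg (\<zeta> / \<zeta>)" using z0 by (intro continuous_at_Arg) auto
    qed
    then have "((\<lambda>w. Arg (w / \<zeta>)) \<longlongrightarrow> Arg (\<zeta> / \<zeta>)) (nhds \<zeta>)"
      using tendsto_at_iff_tendsto_nhds[of "\<lambda>w. Arg (w / \<zeta>)" \<zeta>] unfolding isCont_def by blast
    then have "((\<lambda>w. Arg (w / \<zeta>)) \<longlongrightarrow> 0) (nhds \<zeta>)" using z0 by simp
    then have "eventually (\<lambda>w. \<bar>Arg (w / \<zeta>)\<bar> < h) (nhds \<zeta>)"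
      using h(2) by (auto simp: tendsto_iff dist_real_def)
    then obtain e where e: "e > 0" "\<And>w. dist w \<zeta> < e \<Longrightarrow> \<bar>Arg (w / \<zeta>)\<bar> < h"
      unfolding eventually_nhds_metric by auto
    have "w \<in> ?E" if w: "w \<in> ball \<zeta> e \<inter> sphere 0 1" for w
    proof -
      define u where "u = Arg (w / \<zeta>)"
      have u: "\<bar>u\<bar> < h" unfolding u_def using e(2)[of w] w by (simp add: dist_commute)
      have "w / \<zeta> = cis u"
        unfolding u_def using w \<zeta> z0 by (subst cis_Arg) (auto simp: sgn_div_norm norm_divide)
      then have "w = cis (s + u)" using z0 s by (simp add: field_simps cis_mult[symmetric])
      then have "w \<in> J" unfolding J_def using u s by (intro image_eqI[of _ _ "s + u"]) auto
      then show ?thesis using h ab Jm by (intro nbh[OF J _ J' Jm]) auto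
    qed
    then show ?thesis using e(1) by blast
  qed
qed

lemma hl_maximal_measurable:
  assumes A: "A \<in> sets borel"
  shows "hl_maximal (indicator A) \<in> borel_measurable circle_measure"
proof (rule borel_measurableI_greater)
  fix c :: ennreal
  obtain U where U: "open U" "{\<zeta> \<in> sphere 0 1. hl_maximal (indicator A) \<zeta> > c} = sphere 0 1 \<inter> U"
    using openin_hl_maximal[OF A, of c] unfolding openin_open by auto
  then show "{x \<in> space circle_measure. c < hl_maximal (indicator A) x} \<in> sets circle_measure"
    using circle_measure_sets(1)[of U] by (simp add: Int_commute)
qed

lemma H_maximal_eq:
  assumes "\<Lambda> \<subseteq> ball 0 1"
  shows "H_maximal \<alpha> (phi \<Lambda>) \<zeta> = (SUP z \<in> \<Lambda>. ennreal (phi \<Lambda> z) * hl_maximal (indicator (shadow \<alpha> z)) \<zeta>)"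
  unfolding H_maximal_def
proof (rule antisym)
  show "(SUP z\<in>ball 0 1. ennreal (phi \<Lambda> z) * hl_maximal (indicator (shadow \<alpha> z)) \<zeta>)
      \<le> (SUP z\<in>\<Lambda>. ennreal (phi \<Lambda> z) * hl_maximal (indicator (shadow \<alpha> z)) \<zeta>)"
  proof (rule SUP_least)
    fix z :: complex
    show "ennreal (phi \<Lambda> z) * hl_maximal (indicator (shadow \<alpha> z)) \<zeta>
        \<le> (SUP z\<in>\<Lambda>. ennreal (phi \<Lambda> z) * hl_maximal (indicator (shadow \<alpha> z)) \<zeta>)"
      by (cases "z \<in> \<Lambda>") (auto intro: SUP_upper simp: phi_def)
  qed
qed (use assms in \<open>auto intro!: SUP_subset_mono\<close>)

lemma H_maximal_measurable:
  assumes "\<Lambda> \<subseteq> ball 0 1" "countable \<Lambda>"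
  shows "H_maximal \<alpha> (phi \<Lambda>) \<in> borel_measurable circle_measure"
proof -
  have [measurable]: "hl_maximal (indicator (shadow \<alpha> z)) \<in> borel_measurable circle_measure" for z
    by (rule hl_maximal_measurable) simp
  have "(\<lambda>\<zeta>. SUP z \<in> \<Lambda>. ennreal (phi \<Lambda> z) * hl_maximal (indicator (shadow \<alpha> z)) \<zeta>) \<in> borel_measurable circle_measure"
    using assms by (intro borel_measurable_SUP borel_measurable_times_ennreal) auto
  moreover have "H_maximal \<alpha> (phi \<Lambda>) = (\<lambda>\<zeta>. SUP z \<in> \<Lambda>. ennreal (phi \<Lambda> z) * hl_maximal (indicator (shadow \<alpha> z)) \<zeta>)"
    using H_maximal_eq[OF assms(1)] by auto
  ultimately show ?thesis by simp
qed

section \<open>The Poisson kernel\<close>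

definition poisson :: "complex \<Rightarrow> real \<Rightarrow> real" where
  "poisson z t = (1 - (norm z)\<^sup>2) / (dist (cis t) z)\<^sup>2"

lemma dist_cis_ge: "1 - norm z \<le> dist (cis t) z"
  using norm_triangle_ineq2[of "cis t" z] by (simp add: dist_norm)

lemma dist_cis_pos: "z \<in> ball 0 1 \<Longrightarrow> 0 < dist (cis t) z"
  using dist_cis_ge[of z t] unfolding mem_ball_0 by linarith

lemma cis_neq_ball: "z \<in> ball 0 1 \<Longrightarrow> cis t \<noteq> z"
  using dist_cis_pos[of z t] by auto

lemma poisson_nonneg: "z \<in> ball 0 1 \<Longrightarrow> 0 \<le> poisson z t"
  unfolding poisson_def using one_minus_norm_squared(1)[of z] by simp

lemma poisson_le:
  assumes "z \<in> ball 0 1" shows "poisson z t \<le> 2 * (1 - norm z) * (1 / (dist (cis t) z)\<^sup>2)"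
  using divide_right_mono[OF one_minus_norm_squared(2)[OF assms], of "(dist (cis t) z)\<^sup>2"]
  by (simp add: poisson_def)

lemma poisson_le_const:
  assumes "z \<in> ball 0 1" shows "poisson z t \<le> 2 / (1 - norm z)"
proof -
  have d: "0 < 1 - norm z" using assms by simp
  have "(1 - norm z)\<^sup>2 \<le> (dist (cis t) z)\<^sup>2" using d dist_cis_ge[of z t] by (intro power_mono) auto
  moreover have "0 < (dist (cis t) z)\<^sup>2 * (1 - norm z)\<^sup>2"
    using d dist_cis_pos[OF assms, of t] by (intro mult_pos_pos zero_less_power)
  ultimately have "1 / (dist (cis t) z)\<^sup>2 \<le> 1 / (1 - norm z)\<^sup>2" by (intro divide_left_mono) auto
  then have "2 * (1 - norm z) * (1 / (dist (cis t) z)\<^sup>2) \<le> 2 * (1 - norm z) * (1 / (1 - norm z)\<^sup>2)"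
    using d by (intro mult_left_mono) auto
  also have "\<dots> = 2 / (1 - norm z)"
  proof -
    have "2 * x * (1 / x\<^sup>2) = 2 / x" if "0 < x" for x :: real using that by (simp add: power2_eq_square)
    then show ?thesis using d by blast
  qed
  finally show ?thesis using poisson_le[OF assms, of t] by linarith
qed

lemma continuous_poisson [continuous_intros]: "z \<in> ball 0 1 \<Longrightarrow> continuous_on A (poisson z)"
  unfolding poisson_def using cis_neq_ball[of z] by (intro continuous_intros) auto

lemma poisson_measurable [measurable]: "z \<in> ball 0 1 \<Longrightarrow> poisson z \<in> borel_measurable borel"
  by (intro borel_measurable_continuous_onI continuous_poisson)

lemma dist_cis_radial_squared: "(dist (cis s) (of_real x * cis u))\<^sup>2 = 1 + x\<^sup>2 - 2 * x * cos (s - u)"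
proof -
  have "(dist (cis s) (of_real x * cis u))\<^sup>2 = (cos s - x * cos u)\<^sup>2 + (sin s - x * sin u)\<^sup>2"
    by (simp add: dist_norm cmod_power2)
  also have "\<dots> = ((cos s)\<^sup>2 + (sin s)\<^sup>2) + x\<^sup>2 * ((cos u)\<^sup>2 + (sin u)\<^sup>2) - 2 * x * (cos s * cos u + sin s * sin u)"
    by algebra
  also have "\<dots> = 1 + x\<^sup>2 - 2 * x * cos (s - u)" by (simp add: cos_diff)
  finally show ?thesis .
qed

lemma poisson_symmetric:
  assumes "0 \<le> r"
  shows "poisson (of_real r * cis s) t = poisson (of_real r * cis t) s"
proof -
  have "dist (cis t) (of_real r * cis s) = dist (cis s) (of_real r * cis t)"
  proof -
    have "cos (t - s) = cos (s - t)" using cos_minus[of "t - s"] by simp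
    then have "(dist (cis t) (of_real r * cis s))\<^sup>2 = (dist (cis s) (of_real r * cis t))\<^sup>2" unfolding dist_cis_radial_squared by simp
    then show ?thesis by (rule power2_eq_imp_eq) auto
  qed
  then show ?thesis using assms by (simp add: poisson_def norm_mult)
qed

text \<open>Cauchy's formula at \<open>z\<close> for \<open>h w * (1 - |z|\<^sup>2) / (1 - cnj z * w)\<close>, a function which agrees with \<open>h\<close> at \<open>z\<close>;
  on the circle the additional factor turns the Cauchy kernel into the Poisson kernel.\<close>

lemma Poisson_formula:
  assumes cont: "continuous_on (cball 0 1) h" and holo: "h holomorphic_on ball 0 1" and z: "z \<in> ball 0 1"
  shows "(\<integral>t. of_real (poisson z t) * h (cis t) \<partial>ang) = h z"
proof -
  define f where "f = (\<lambda>w. h w * ((1 - of_real ((norm z)\<^sup>2)) / (1 - cnj z * w)))"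
  have z1: "norm z < 1" using z by simp
  have nz: "1 - cnj z * w \<noteq> 0" if "norm w \<le> 1" for w
  proof
    assume "1 - cnj z * w = 0"
    then have "norm (cnj z * w) = 1" by (metis eq_iff_diff_eq_0 norm_one)
    moreover have "norm z * norm w \<le> norm z * 1" using that by (intro mult_left_mono) auto
    ultimately show False using z1 by (simp add: norm_mult)
  qed
  have cf: "continuous_on (cball 0 1) f" unfolding f_def using nz by (intro continuous_intros cont) auto
  have hf: "f holomorphic_on ball 0 1" unfolding f_def using nz by (intro holomorphic_intros holo) auto
  have z2: "(norm z)\<^sup>2 < 1" using one_minus_norm_squared(1)[OF z] z1 by simp
  then have "complex_of_real ((norm z)\<^sup>2) \<noteq> 1" by (metis less_irrefl of_real_eq_1_iff)
  moreover have "cnj z * z = of_real ((norm z)\<^sup>2)" by (simp only: complex_norm_square mult.commute)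
  ultimately have fz: "f z = h z" unfolding f_def by simp
  have "((\<lambda>u. f u / (u - z)) has_contour_integral (2 * of_real pi * \<i> * f z)) (circlepath 0 1)"
    using z1 by (intro Cauchy_integral_circlepath cf hf) auto
  then have A: "((\<lambda>t. f (cis t) / (cis t - z) * \<i> * cis t) has_integral (2 * of_real pi * \<i> * h z)) {0..2*pi}"
    unfolding circlepath_def by (subst (asm) has_contour_integral_part_circlepath_iff) (auto simp: fz)
  have eq: "f (cis t) / (cis t - z) * \<i> * cis t = \<i> * (of_real (poisson z t) * h (cis t))" for t
  proof -
    have n: "cis t - z \<noteq> 0" using cis_neq_ball[OF z] by simp
    have "cis t * cnj (cis t) = 1" using complex_norm_square[of "cis t"] by simp
    then have c: "(1 - cnj z * cis t) = cis t * cnj (cis t - z)" by (simp add: right_diff_distrib mult.commute)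
    have d: "(cis t - z) * cnj (cis t - z) = of_real ((dist (cis t) z)\<^sup>2)"
      by (simp only: dist_norm complex_norm_square)
    have c0: "cis t \<noteq> 0" by simp
    have "f (cis t) / (cis t - z) * \<i> * cis t = \<i> * (h (cis t) * (1 - of_real ((norm z)\<^sup>2)) / ((cis t - z) * cnj (cis t - z)))"
    proof -
      have "(H * (A / (C * D))) / E * \<i> * C = \<i> * (H * A / (E * D))" if "C \<noteq> 0" for H A C D E :: complex
        using that by (simp add: mult_ac)
      from this[OF c0] show ?thesis unfolding f_def c .
    qed
    also have "\<dots> = \<i> * (of_real (poisson z t) * h (cis t))" unfolding d poisson_def by simp
    finally show ?thesis .
  qed
  have cg: "continuous_on UNIV (\<lambda>t. of_real (poisson z t) * h (cis t))"
    using z by (intro continuous_intros continuous_on_compose2[OF cont]) auto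
  have "((\<lambda>t. \<i> * (of_real (poisson z t) * h (cis t))) has_integral
      \<i> * (of_real (2 * pi) * (\<integral>t. of_real (poisson z t) * h (cis t) \<partial>ang))) {0..2*pi}"
    by (intro has_integral_mult_right ang_has_integral cg)
  from has_integral_unique[OF A[unfolded eq] this] show ?thesis by simp
qed

lemma integral_poisson:
  assumes "z \<in> ball 0 1" shows "(\<integral>t. poisson z t \<partial>ang) = 1" "integrable ang (poisson z)"
proof -
  show "integrable ang (poisson z)" using assms by (intro integrable_ang_cont continuous_intros)
  have "(\<integral>t. complex_of_real (poisson z t) \<partial>ang) = 1"
    using Poisson_formula[of "\<lambda>_. 1" z] assms by simp
  then show "(\<integral>t. poisson z t \<partial>ang) = 1" by simp
qed

lemma integrable_poisson_mult:
  fixes w :: "real \<Rightarrow> real"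
  assumes "z \<in> ball 0 1" "integrable ang w"
  shows "integrable ang (\<lambda>t. poisson z t * w t)"
proof (rule Bochner_Integration.integrable_bound[OF integrable_mult_right[OF integrable_norm[OF assms(2)], of "2 / (1 - norm z)"]])
  show "(\<lambda>t. poisson z t * w t) \<in> borel_measurable ang"
    using assms by (intro borel_measurable_times) auto
  show "AE t in ang. norm (poisson z t * w t) \<le> norm (2 / (1 - norm z) * norm (w t))"
  proof (rule AE_I2)
    fix t
    have "\<bar>poisson z t\<bar> * \<bar>w t\<bar> \<le> 2 / (1 - norm z) * \<bar>w t\<bar>"
      using poisson_le_const[OF assms(1), of t] poisson_nonneg[OF assms(1), of t] by (intro mult_right_mono) auto
    then show "norm (poisson z t * w t) \<le> norm (2 / (1 - norm z) * norm (w t))"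
      using assms(1) by (simp add: abs_mult)
  qed
qed

section \<open>Herglotz integrals\<close>

definition herglotz :: "(real \<Rightarrow> real) \<Rightarrow> complex \<Rightarrow> complex" where
  "herglotz w z = (\<integral>t. ((cis t + z) / (cis t - z)) * of_real (w t) \<partial>ang)"

lemma herglotz_kernel_le:
  assumes "z \<in> ball 0 1" shows "norm ((cis t + z) / (cis t - z)) \<le> 2 / (1 - norm z)"
proof -
  have "norm (cis t + z) \<le> 2" using norm_triangle_ineq[of "cis t" z] assms by simp
  then show ?thesis using dist_cis_ge[of z t] assms unfolding norm_divide dist_norm by (intro frac_le) auto
qed

lemma continuous_herglotz_kernel: "z \<in> ball 0 1 \<Longrightarrow> continuous_on UNIV (\<lambda>t. (cis t + z) / (cis t - z))"
  using cis_neq_ball[of z] by (intro continuous_intros) auto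

lemma integrable_herglotz:
  assumes "z \<in> ball 0 1" "integrable ang w"
  shows "integrable ang (\<lambda>t. ((cis t + z) / (cis t - z)) * of_real (w t))"
proof (rule Bochner_Integration.integrable_bound[OF integrable_mult_right[OF integrable_norm[OF assms(2)], of "2 / (1 - norm z)"]])
  show "(\<lambda>t. ((cis t + z) / (cis t - z)) * complex_of_real (w t)) \<in> borel_measurable ang"
    using assms continuous_herglotz_kernel[OF assms(1)] by (intro borel_measurable_times) auto
  show "AE t in ang. norm (((cis t + z) / (cis t - z)) * complex_of_real (w t)) \<le> norm (2 / (1 - norm z) * norm (w t))"
  proof (rule AE_I2)
    fix t
    have "norm ((cis t + z) / (cis t - z)) * \<bar>w t\<bar> \<le> 2 / (1 - norm z) * \<bar>w t\<bar>"
      by (intro mult_right_mono herglotz_kernel_le assms) auto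
    then show "norm (((cis t + z) / (cis t - z)) * complex_of_real (w t)) \<le> norm (2 / (1 - norm z) * norm (w t))"
      using assms(1) unfolding norm_mult norm_of_real by simp
  qed
qed

lemma herglotz_bound:
  assumes "z \<in> ball 0 1" "integrable ang w"
  shows "norm (herglotz w z) \<le> 2 / (1 - norm z) * (\<integral>t. \<bar>w t\<bar> \<partial>ang)"
proof -
  have "norm (herglotz w z) \<le> (\<integral>t. norm (((cis t + z) / (cis t - z)) * complex_of_real (w t)) \<partial>ang)"
    unfolding herglotz_def by (rule integral_norm_bound)
  also have "\<dots> \<le> (\<integral>t. 2 / (1 - norm z) * \<bar>w t\<bar> \<partial>ang)"
  proof (rule integral_mono)
    show "integrable ang (\<lambda>t. norm (((cis t + z) / (cis t - z)) * complex_of_real (w t)))"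
      by (intro integrable_norm integrable_herglotz assms)
    show "integrable ang (\<lambda>t. 2 / (1 - norm z) * \<bar>w t\<bar>)"
      by (intro integrable_mult_right integrable_abs assms)
    show "norm (((cis t + z) / (cis t - z)) * complex_of_real (w t)) \<le> 2 / (1 - norm z) * \<bar>w t\<bar>" for t
      unfolding norm_mult norm_of_real by (intro mult_right_mono herglotz_kernel_le assms) auto
  qed
  finally show ?thesis by simp
qed

lemma Re_herglotz:
  assumes "z \<in> ball 0 1" "integrable ang w"
  shows "Re (herglotz w z) = (\<integral>t. poisson z t * w t \<partial>ang)"
proof -
  have "Re (herglotz w z) = (\<integral>t. Re (((cis t + z) / (cis t - z)) * of_real (w t)) \<partial>ang)"
    unfolding herglotz_def by (rule integral_Re[symmetric, OF integrable_herglotz[OF assms]])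
  also have "\<dots> = (\<integral>t. poisson z t * w t \<partial>ang)"
  proof (rule Bochner_Integration.integral_cong[OF refl])
    fix t
    have "Re ((cis t + z) / (cis t - z)) = poisson z t"
    proof -
      have "Re ((cis t + z) / (cis t - z)) = Re ((cis t + z) * cnj (cis t - z)) / (norm (cis t - z))\<^sup>2"
        by (subst complex_div_cnj) (simp add: Re_divide_of_real)
      also have "Re ((cis t + z) * cnj (cis t - z)) = (norm (cis t))\<^sup>2 - (norm z)\<^sup>2"
        unfolding cmod_power2 by (simp add: power2_eq_square algebra_simps)
      finally show ?thesis by (simp add: poisson_def dist_norm)
    qed
    moreover have "Re (K * of_real (w t)) = Re K * w t" for K by simp
    ultimately show "Re (((cis t + z) / (cis t - z)) * of_real (w t)) = poisson z t * w t" by metis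
  qed
  finally show ?thesis .
qed

text \<open>The kernel is \<open>1 + 2 * (\<Sum>n\<ge>1. (z / \<xi>) ^ n)\<close>; integration term by term yields a power series.\<close>

lemma holomorphic_herglotz:
  assumes w: "integrable ang w"
  shows "herglotz w holomorphic_on ball 0 1"
proof (rule power_series_holomorphic)
  define c :: "nat \<Rightarrow> complex" where "c n = (if n = 0 then 1 else 2)" for n
  define a where "a n = (\<integral>t. c n * cis (- t) ^ n * of_real (w t) \<partial>ang)" for n
  have c2: "norm (c n) \<le> 2" for n by (simp add: c_def)
  fix z :: complex assume z: "z \<in> ball 0 1"
  let ?f = "\<lambda>n t. c n * cis (- t) ^ n * of_real (w t) * z ^ n"
  have fn: "norm (?f n t) \<le> 2 * norm z ^ n * \<bar>w t\<bar>" for n t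
  proof -
    have "norm (?f n t) = norm (c n) * (norm z ^ n * \<bar>w t\<bar>)" by (simp add: norm_mult norm_power)
    also have "\<dots> \<le> 2 * (norm z ^ n * \<bar>w t\<bar>)" by (intro mult_right_mono c2) auto
    finally show ?thesis by (simp add: mult.assoc)
  qed
  have int: "integrable ang (?f n)" for n
  proof (rule Bochner_Integration.integrable_bound[OF integrable_mult_right[OF integrable_norm[OF w], of "2 * norm z ^ n"]])
    have "continuous_on UNIV (\<lambda>t. c n * cis (- t) ^ n)" by (intro continuous_intros)
    then show "?f n \<in> borel_measurable ang" using w by (intro borel_measurable_times) auto
    show "AE t in ang. norm (?f n t) \<le> norm (2 * norm z ^ n * norm (w t))" using fn[of n] by (intro AE_I2) simp
  qed
  have sm: "summable (\<lambda>n. 2 * norm z ^ n * x)" for x :: real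
    using z by (intro summable_mult2 summable_mult summable_geometric) auto
  have "(\<lambda>n. integral\<^sup>L ang (?f n)) sums (\<integral>t. (\<Sum>n. ?f n t) \<partial>ang)"
  proof (rule sums_integral[OF int])
    show "AE t in ang. summable (\<lambda>n. norm (?f n t))"
    proof (rule AE_I2)
      fix t show "summable (\<lambda>n. norm (?f n t))"
        by (rule summable_comparison_test'[OF sm[of "\<bar>w t\<bar>"], of 0]) (unfold real_norm_def abs_norm_cancel, rule fn)
    qed
    show "summable (\<lambda>n. \<integral>t. norm (?f n t) \<partial>ang)"
    proof (rule summable_comparison_test'[OF sm[of "\<integral>t. \<bar>w t\<bar> \<partial>ang"], of 0])
      fix n
      have "(\<integral>t. norm (?f n t) \<partial>ang) \<le> (\<integral>t. 2 * norm z ^ n * \<bar>w t\<bar> \<partial>ang)"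
        using w by (intro integral_mono integrable_norm int integrable_mult_right integrable_abs fn)
      then show "norm (\<integral>t. norm (?f n t) \<partial>ang) \<le> 2 * norm z ^ n * (\<integral>t. \<bar>w t\<bar> \<partial>ang)" by simp
    qed
  qed
  also have "(\<lambda>n. integral\<^sup>L ang (?f n)) = (\<lambda>n. a n * z ^ n)"
    unfolding a_def by simp
  also have "(\<integral>t. (\<Sum>n. ?f n t) \<partial>ang) = herglotz w z"
    unfolding herglotz_def
  proof (rule Bochner_Integration.integral_cong[OF refl])
    fix t
    define q where "q = cis (- t) * z"
    have q: "norm q < 1" using z by (simp add: q_def norm_mult)
    have q1: "1 - q \<noteq> 0" using q by auto
    have "(\<lambda>n. c n * q ^ n) sums ((1 + q) / (1 - q))"
    proof -
      have "(\<lambda>n. 2 * q ^ n) sums (2 * (1 / (1 - q)))" using geometric_sums[OF q] by (rule sums_mult)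
      moreover have "(\<lambda>n. if n = 0 then - 1 else 0) sums (- 1 :: complex)" using sums_single[of 0 "\<lambda>_. - 1 :: complex"] by simp
      ultimately have "(\<lambda>n. 2 * q ^ n + (if n = 0 then - 1 else 0)) sums (2 * (1 / (1 - q)) + - 1)" by (rule sums_add)
      moreover have "(\<lambda>n. 2 * q ^ n + (if n = 0 then - 1 else 0)) = (\<lambda>n. c n * q ^ n)" by (auto simp: c_def)
      moreover have "2 * (1 / (1 - q)) + - 1 = (1 + q) / (1 - q)" using q1 by (simp add: field_simps)
      ultimately show ?thesis by simp
    qed
    then have "(\<lambda>n. c n * q ^ n * of_real (w t)) sums ((1 + q) / (1 - q) * of_real (w t))" by (rule sums_mult2)
    moreover have "(\<lambda>n. c n * q ^ n * of_real (w t)) = (\<lambda>n. ?f n t)" by (simp add: q_def power_mult_distrib mult_ac)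
    moreover have "(1 + q) / (1 - q) = (cis t + z) / (cis t - z)"
    proof -
      have e: "cis t * q = z" unfolding q_def by (simp add: cis_mult flip: mult.assoc)
      have "cis t * (1 + q) = cis t + z" "cis t * (1 - q) = cis t - z"
        by (simp_all only: distrib_left right_diff_distrib e mult_1_right)
      moreover have "(cis t * (1 + q)) / (cis t * (1 - q)) = (1 + q) / (1 - q)" by simp
      ultimately show ?thesis by (simp only:)
    qed
    ultimately have "(\<lambda>n. ?f n t) sums ((cis t + z) / (cis t - z) * of_real (w t))" by simp
    then show "(\<Sum>n. ?f n t) = (cis t + z) / (cis t - z) * of_real (w t)" by (rule sums_unique[symmetric])
  qed
  finally show "(\<lambda>n. a n * (z - 0) ^ n) sums herglotz w z" by simp
qed

lemma dist_radial: "dist (of_real r * cis s) (cis s) = \<bar>r - 1\<bar>"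
proof -
  have "of_real r * cis s - cis s = of_real (r - 1) * cis s" by (simp add: algebra_simps)
  then show ?thesis by (simp only: dist_norm norm_mult norm_of_real norm_cis mult_1_right)
qed

text \<open>With a modulus \<open>\<delta>\<close> of uniform continuity and a bound \<open>B\<close> for \<open>V\<close>, the oscillation \<open>|V \<xi> - V \<zeta>|\<close> is at most
  \<open>e / 2 + 2 * B * |\<xi> - \<zeta>|\<^sup>2 / \<delta>\<^sup>2\<close>, and the Poisson kernel at \<open>r * \<zeta>\<close> times \<open>|\<xi> - \<zeta>|\<^sup>2\<close> is at most
  \<open>4 * (1 - r\<^sup>2)\<close>.\<close>

lemma Poisson_integral_uniform:
  fixes V :: "complex \<Rightarrow> real"
  assumes V: "continuous_on (sphere 0 1) V" and e: "0 < e"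
  shows "eventually (\<lambda>r. \<forall>s. \<bar>(\<integral>t. poisson (of_real r * cis s) t * V (cis t) \<partial>ang) - V (cis s)\<bar> \<le> e) (at_left 1)"
proof -
  obtain B where B: "\<And>\<xi>. \<xi> \<in> sphere 0 1 \<Longrightarrow> \<bar>V \<xi>\<bar> \<le> B" and B0: "B > 0"
  proof -
    have "bounded (V ` sphere 0 1)" by (intro compact_imp_bounded compact_continuous_image V) auto
    then obtain B where "\<forall>x\<in>V ` sphere 0 1. norm x \<le> B" unfolding bounded_iff by blast
    then have "\<bar>V \<xi>\<bar> \<le> max B 1" if "\<xi> \<in> sphere 0 1" for \<xi> using that by force
    then show ?thesis by (intro that[of "max B 1"]) auto
  qed
  have "uniformly_continuous_on (sphere 0 1) V" by (intro compact_uniformly_continuous V) auto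
  then obtain \<delta> where \<delta>: "\<delta> > 0" "\<And>x y. x \<in> sphere 0 1 \<Longrightarrow> y \<in> sphere 0 1 \<Longrightarrow> dist x y < \<delta> \<Longrightarrow> dist (V x) (V y) < e / 2"
    using e unfolding uniformly_continuous_on_def by (metis half_gt_zero)
  have "((\<lambda>r::real. 8 * B * (1 - r\<^sup>2) / \<delta>\<^sup>2) \<longlongrightarrow> 8 * B * (1 - 1\<^sup>2) / \<delta>\<^sup>2) (at_left 1)"
    using \<delta> by (intro tendsto_intros) auto
  then have "eventually (\<lambda>r::real. 8 * B * (1 - r\<^sup>2) / \<delta>\<^sup>2 < e / 2) (at_left 1)"
    using e by (intro order_tendstoD(2)) auto
  moreover have "eventually (\<lambda>r::real. r \<in> {0<..<1}) (at_left 1)" by (intro eventually_at_left_real) auto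
  ultimately show ?thesis
  proof eventually_elim
    case (elim r)
    then have r: "0 < r" "r < 1" by auto
    show ?case
    proof
      fix s
      let ?z = "of_real r * cis s"
      have z: "?z \<in> ball 0 1" using r by (simp add: norm_mult)
      have cV: "continuous_on UNIV (\<lambda>t. V (cis t))" by (intro continuous_on_compose2[OF V] continuous_intros) auto
      have iV: "integrable ang (\<lambda>t. poisson ?z t * V (cis t))"
        using z by (intro integrable_ang_cont continuous_intros cV)
      have iV': "integrable ang (\<lambda>t. poisson ?z t * (V (cis t) - V (cis s)))"
        using z by (intro integrable_ang_cont continuous_intros cV)
      have pt: "\<bar>poisson ?z t * (V (cis t) - V (cis s))\<bar> \<le> e / 2 * poisson ?z t + 8 * B * (1 - r\<^sup>2) / \<delta>\<^sup>2" for t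
      proof -
        let ?D = "dist (cis t) (cis s)"
        have p0: "0 \<le> poisson ?z t" using z by (rule poisson_nonneg)
        have r2: "r\<^sup>2 \<le> 1" using r by (simp add: power_le_one)
        have "\<bar>V (cis t) - V (cis s)\<bar> \<le> e / 2 + 2 * B * ?D\<^sup>2 / \<delta>\<^sup>2"
        proof (cases "?D < \<delta>")
          case True
          then have "\<bar>V (cis t) - V (cis s)\<bar> < e / 2" using \<delta>(2)[of "cis t" "cis s"] by (simp add: dist_real_def)
          moreover have "0 \<le> 2 * B * ?D\<^sup>2 / \<delta>\<^sup>2" using B0 by simp
          ultimately show ?thesis by linarith
        next
          case False
          then have "\<delta>\<^sup>2 \<le> ?D\<^sup>2" using \<delta> by (intro power_mono) auto
          then have "1 \<le> ?D\<^sup>2 / \<delta>\<^sup>2" using \<delta> by simp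
          then have "2 * B * 1 \<le> 2 * B * (?D\<^sup>2 / \<delta>\<^sup>2)" using B0 by (intro mult_left_mono) auto
          moreover have "\<bar>V (cis t) - V (cis s)\<bar> \<le> 2 * B" using B[of "cis t"] B[of "cis s"] by simp
          ultimately show ?thesis using e by simp
        qed
        then have "poisson ?z t * \<bar>V (cis t) - V (cis s)\<bar> \<le> poisson ?z t * (e / 2 + 2 * B * ?D\<^sup>2 / \<delta>\<^sup>2)"
          using p0 by (rule mult_left_mono)
        also have "\<dots> = e / 2 * poisson ?z t + 2 * B / \<delta>\<^sup>2 * (poisson ?z t * ?D\<^sup>2)" by (simp add: algebra_simps)
        finally have up: "poisson ?z t * \<bar>V (cis t) - V (cis s)\<bar> \<le> e / 2 * poisson ?z t + 2 * B / \<delta>\<^sup>2 * (poisson ?z t * ?D\<^sup>2)" .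
        have "poisson ?z t * ?D\<^sup>2 \<le> 4 * (1 - r\<^sup>2)"
        proof -
          have ds: "dist (cis s) ?z = 1 - r" using r by (simp add: dist_radial dist_commute[of "cis s"])
          have "?D \<le> dist (cis t) ?z + dist (cis s) ?z" by (rule dist_triangle2)
          also have "\<dots> \<le> 2 * dist (cis t) ?z" using ds dist_cis_ge[of ?z t] r by (simp add: norm_mult)
          finally have "?D\<^sup>2 \<le> (2 * dist (cis t) ?z)\<^sup>2" by (intro power_mono) auto
          then have "?D\<^sup>2 / (dist (cis t) ?z)\<^sup>2 \<le> 4" using dist_cis_pos[OF z, of t] by (simp add: power_mult_distrib field_simps)
          then have "(1 - r\<^sup>2) * (?D\<^sup>2 / (dist (cis t) ?z)\<^sup>2) \<le> (1 - r\<^sup>2) * 4" using r2 by (intro mult_left_mono) auto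
          then show ?thesis unfolding poisson_def using r by (simp add: norm_mult)
        qed
        then have "2 * B / \<delta>\<^sup>2 * (poisson ?z t * ?D\<^sup>2) \<le> 2 * B / \<delta>\<^sup>2 * (4 * (1 - r\<^sup>2))"
          using B0 by (intro mult_left_mono) auto
        also have "\<dots> = 8 * B * (1 - r\<^sup>2) / \<delta>\<^sup>2" by simp
        finally show ?thesis using up p0 by (simp only: abs_mult abs_of_nonneg)
      qed
      have "(\<integral>t. poisson ?z t * V (cis t) \<partial>ang) - V (cis s) = (\<integral>t. poisson ?z t * (V (cis t) - V (cis s)) \<partial>ang)"
        using integral_poisson[OF z] iV by (simp add: right_diff_distrib)
      also have "\<bar>\<dots>\<bar> \<le> (\<integral>t. \<bar>poisson ?z t * (V (cis t) - V (cis s))\<bar> \<partial>ang)"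
        using integral_norm_bound[of ang "\<lambda>t. poisson ?z t * (V (cis t) - V (cis s))"] by simp
      also have "\<dots> \<le> (\<integral>t. e / 2 * poisson ?z t + 8 * B * (1 - r\<^sup>2) / \<delta>\<^sup>2 \<partial>ang)"
        using integral_poisson[OF z] iV' pt by (intro integral_mono integrable_abs) auto
      also have "\<dots> = e / 2 + 8 * B * (1 - r\<^sup>2) / \<delta>\<^sup>2"
        using integral_poisson[OF z] by simp
      also have "\<dots> \<le> e" using elim by linarith
      finally show "\<bar>(\<integral>t. poisson ?z t * V (cis t) \<partial>ang) - V (cis s)\<bar> \<le> e" .
    qed
  qed
qed

section \<open>Subharmonicity of the positive logarithm\<close>

lemma log_plus_nonneg [simp]: "0 \<le> log_plus x" by (simp add: log_plus_def)

lemma ln_le_log_plus: "0 < x \<Longrightarrow> ln x \<le> log_plus x"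
  unfolding log_plus_def by (subst ln_le_cancel_iff) auto

lemma log_plus_le_iff: "0 \<le> c \<Longrightarrow> log_plus x \<le> c \<longleftrightarrow> x \<le> exp c"
proof -
  assume c: "0 \<le> c"
  have "log_plus x \<le> c \<longleftrightarrow> max 1 x \<le> exp c"
    unfolding log_plus_def exp_le_cancel_iff[of "ln (max 1 x)" c, symmetric] by (subst exp_ln) auto
  then show ?thesis using c by simp
qed

lemma le_exp_log_plus: "x \<le> exp (log_plus x)"
  using log_plus_le_iff[of "log_plus x" x] by simp

lemma log_plus_mult: "0 \<le> x \<Longrightarrow> 0 \<le> y \<Longrightarrow> log_plus (x * y) \<le> log_plus x + log_plus y"
  using mult_mono[OF le_exp_log_plus le_exp_log_plus, of x y] by (subst log_plus_le_iff) (auto simp: exp_add)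

lemma continuous_log_plus [continuous_intros]:
  "continuous_on A f \<Longrightarrow> continuous_on A (\<lambda>x. log_plus (f x))"
  unfolding log_plus_def by (intro continuous_intros) auto

lemma isCont_log_plus: "isCont log_plus x"
  using continuous_log_plus[OF continuous_on_id, of UNIV] by (simp add: continuous_on_eq_continuous_at)

text \<open>Let \<open>F\<close> be the Herglotz integral of \<open>log\<^sup>+|g|\<close>. Near the circle \<open>|g * exp (- F)|\<close> is at most
  \<open>exp (2 * e)\<close>, by the boundary behaviour of Poisson integrals of continuous functions; the maximum
  principle carries this bound to \<open>z\<close>.\<close>

lemma log_plus_le_Poisson:
  fixes g :: "complex \<Rightarrow> complex"
  assumes cont: "continuous_on (cball 0 1) g" and holo: "g holomorphic_on ball 0 1" and z: "z \<in> ball 0 1"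
  shows "log_plus (norm (g z)) \<le> (\<integral>t. poisson z t * log_plus (norm (g (cis t))) \<partial>ang)"
proof -
  define V where "V = (\<lambda>\<xi>. log_plus (norm (g \<xi>)))"
  define w where "w = (\<lambda>t. V (cis t))"
  have cV: "continuous_on (cball 0 1) V" unfolding V_def by (intro continuous_intros cont)
  have cw: "continuous_on UNIV w" unfolding w_def by (intro continuous_on_compose2[OF cV] continuous_intros) auto
  have iw: "integrable ang w" using cw by (rule integrable_ang_cont)
  define F where "F = herglotz w"
  have hF: "F holomorphic_on ball 0 1" unfolding F_def by (rule holomorphic_herglotz[OF iw])
  have ReF: "Re (F u) = (\<integral>t. poisson u t * w t \<partial>ang)" if "u \<in> ball 0 1" for u
    unfolding F_def by (rule Re_herglotz[OF that iw])
  have ReF0: "Re (F u) \<ge> 0" if "u \<in> ball 0 1" for u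
    unfolding ReF[OF that] w_def V_def using poisson_nonneg[OF that] by (intro integral_nonneg_AE AE_I2) simp
  define G where "G = (\<lambda>u. g u * exp (- F u))"
  have key: "norm (G z) \<le> exp (2 * e)" if e: "0 < e" for e
  proof -
    have "uniformly_continuous_on (cball 0 1) V" by (intro compact_uniformly_continuous cV) auto
    then obtain \<delta> where \<delta>: "\<delta> > 0" "\<And>x y. x \<in> cball 0 1 \<Longrightarrow> y \<in> cball 0 1 \<Longrightarrow> dist x y < \<delta> \<Longrightarrow> dist (V x) (V y) < e"
      using e unfolding uniformly_continuous_on_def by metis
    have "eventually (\<lambda>r::real. r \<in> {max (norm z) (1 - \<delta>)<..<1}) (at_left 1)"
      using z \<delta> by (intro eventually_at_left_real) auto
    moreover have "eventually (\<lambda>r. \<forall>s. \<bar>(\<integral>t. poisson (of_real r * cis s) t * V (cis t) \<partial>ang) - V (cis s)\<bar> \<le> e) (at_left 1)"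
      using e by (intro Poisson_integral_uniform continuous_on_subset[OF cV]) auto
    ultimately have "eventually (\<lambda>r. r \<in> {max (norm z) (1 - \<delta>)<..<1} \<and>
        (\<forall>s. \<bar>(\<integral>t. poisson (of_real r * cis s) t * V (cis t) \<partial>ang) - V (cis s)\<bar> \<le> e)) (at_left 1)"
      by (rule eventually_conj)
    then obtain r where r: "norm z < r" "1 - \<delta> < r" "r < 1"
      and P: "\<And>s. \<bar>(\<integral>t. poisson (of_real r * cis s) t * V (cis t) \<partial>ang) - V (cis s)\<bar> \<le> e"
      using eventually_happens'[OF trivial_limit_at_left_real[of "1::real"]] by auto
    have r0: "0 < r" using r(1) norm_ge_zero[of z] by linarith
    have hG: "G holomorphic_on ball 0 1" unfolding G_def by (intro holomorphic_intros holo hF)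
    show ?thesis
    proof (rule maximum_modulus_frontier[of G "cball 0 r"])
      show "G holomorphic_on interior (cball 0 r)" using r by (intro holomorphic_on_subset[OF hG]) auto
      show "continuous_on (closure (cball 0 r)) G"
        using r by (intro continuous_on_subset[OF holomorphic_on_imp_continuous_on[OF hG]]) auto
      show "z \<in> cball 0 r" using r by simp
      fix u :: complex assume "u \<in> frontier (cball 0 r)"
      then have u: "norm u = r" using r0 by (simp add: frontier_cball)
      define s where "s = Arg u"
      have us: "u = of_real r * cis s" using rcis_cmod_Arg[of u] u by (simp add: rcis_def s_def)
      have "dist u (cis s) < \<delta>" unfolding us using r by (simp add: dist_radial)
      then have "dist (V u) (V (cis s)) < e" using \<delta>(2)[of u "cis s"] u r by simp
      moreover have "u \<in> ball 0 1" using u r by simp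
      then have "Re (F u) = (\<integral>t. poisson (of_real r * cis s) t * V (cis t) \<partial>ang)" unfolding us[symmetric] by (simp add: ReF w_def)
      ultimately have "V u - Re (F u) \<le> 2 * e" using P[of s] by (simp add: dist_real_def)
      moreover have "norm (G u) \<le> exp (V u) * exp (- Re (F u))"
        unfolding G_def V_def norm_mult norm_exp_eq_Re using le_exp_log_plus[of "norm (g u)"] by (simp add: mult_right_mono)
      moreover have "exp (V u) * exp (- Re (F u)) = exp (V u - Re (F u))" by (simp flip: exp_add)
      moreover have "exp (V u - Re (F u)) \<le> exp (2 * e)" if "V u - Re (F u) \<le> 2 * e" using that by simp
      ultimately show "norm (G u) \<le> exp (2 * e)" by linarith
    qed auto
  qed
  have half: "log_plus (norm (g z)) \<le> Re (F z) + 2 * e" if e: "0 < e" for e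
  proof -
    have "norm (g z) = norm (G z) * exp (Re (F z))"
      unfolding G_def norm_mult norm_exp_eq_Re by (simp flip: exp_add)
    also have "\<dots> \<le> exp (2 * e) * exp (Re (F z))" using key[OF e] by (intro mult_right_mono) auto
    also have "\<dots> = exp (Re (F z) + 2 * e)" by (simp add: exp_add)
    finally show ?thesis using ReF0[OF z] e by (subst log_plus_le_iff) auto
  qed
  have "log_plus (norm (g z)) \<le> Re (F z) + e" if e: "0 < e" for e
    using half[of "e / 2"] e by simp
  then have "log_plus (norm (g z)) \<le> Re (F z)" by (rule field_le_epsilon)
  then show ?thesis unfolding ReF[OF z] by (simp add: w_def V_def)
qed

section \<open>Poisson integrals and the maximal function\<close>

text \<open>The measure \<open>v dt / (2 * pi)\<close>, transported to the circle.\<close>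

definition circle_density :: "(real \<Rightarrow> real) \<Rightarrow> complex measure" where
  "circle_density v = distr (density ang (\<lambda>t. ennreal (v t))) borel cis"

lemma sets_circle_density [simp, measurable_cong]: "sets (circle_density v) = sets borel"
  by (simp add: circle_density_def)

lemma nn_integral_circle_density:
  assumes [measurable]: "v \<in> borel_measurable borel" "h \<in> borel_measurable borel"
  shows "(\<integral>\<^sup>+\<xi>. h \<xi> \<partial>circle_density v) = (\<integral>\<^sup>+t. ennreal (v t) * h (cis t) \<partial>ang)"
proof -
  have "(\<integral>\<^sup>+\<xi>. h \<xi> \<partial>circle_density v) = (\<integral>\<^sup>+t. h (cis t) \<partial>density ang (\<lambda>t. ennreal (v t)))"
    unfolding circle_density_def by (rule nn_integral_distr) measurable
  also have "\<dots> = (\<integral>\<^sup>+t. ennreal (v t) * h (cis t) \<partial>ang)"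
    by (rule nn_integral_density) measurable
  finally show ?thesis .
qed

lemma emeasure_circle_density:
  assumes "integrable ang v" "\<And>t. 0 \<le> v t"
  shows "emeasure (circle_density v) UNIV = ennreal (\<integral>t. v t \<partial>ang)"
proof -
  have v: "v \<in> borel_measurable borel" using assms(1) by auto
  have "emeasure (circle_density v) UNIV = (\<integral>\<^sup>+\<xi>. 1 \<partial>circle_density v)"
    by (simp add: circle_density_def)
  also have "\<dots> = (\<integral>\<^sup>+t. ennreal (v t) \<partial>ang)" using v by (subst nn_integral_circle_density) auto
  also have "\<dots> = ennreal (\<integral>t. v t \<partial>ang)" using assms by (intro nn_integral_eq_integral) auto
  finally show ?thesis .
qed

lemma AE_circle_density:
  assumes [measurable]: "v \<in> borel_measurable borel"
  shows "AE \<xi> in circle_density v. \<xi> \<in> sphere 0 1"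
  unfolding circle_density_def by (subst AE_distr_iff) auto

lemma outer_measure_high_density:
  assumes "integrable ang v" "\<And>t. 0 \<le> v t" "0 < T"
  shows "outer_measure_of circ (high_density (circle_density v) T) \<le> ennreal (10 * (\<integral>t. v t \<partial>ang) / T)"
  using assms by (intro maximal_weak_type) (auto simp: emeasure_circle_density intro!: integral_nonneg_AE)

lemma poisson_le_maximal:
  assumes v: "integrable ang v" "\<And>t. 0 \<le> v t" and T: "0 \<le> T" and z: "z \<in> ball 0 1"
    and \<zeta>: "\<zeta> \<in> sphere 0 1" "\<zeta> \<notin> high_density (circle_density v) T"
  shows "(\<integral>t. poisson z t * v t \<partial>ang) \<le> 32 * T * dist \<zeta> z / (1 - norm z)"
proof -
  have [measurable]: "v \<in> borel_measurable borel" using v(1) by auto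
  define d where "d = 1 - norm z"
  have d: "0 < d" using z by (simp add: d_def)
  have p0: "0 \<le> poisson z t * v t" for t using poisson_nonneg[OF z] v by simp
  have "ennreal (\<integral>t. poisson z t * v t \<partial>ang) = (\<integral>\<^sup>+t. ennreal (poisson z t * v t) \<partial>ang)"
    using p0 by (intro nn_integral_eq_integral[symmetric] integrable_poisson_mult z v) auto
  also have "\<dots> \<le> (\<integral>\<^sup>+t. ennreal (2 * d) * (ennreal (v t) * ennreal (1 / (dist (cis t) z)\<^sup>2)) \<partial>ang)"
  proof (rule nn_integral_mono)
    fix t
    have "poisson z t * v t \<le> 2 * d * (1 / (dist (cis t) z)\<^sup>2) * v t"
      unfolding d_def using v(2)[of t] by (intro mult_right_mono poisson_le z)
    also have "\<dots> = 2 * d * (v t * (1 / (dist (cis t) z)\<^sup>2))" by simp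
    finally have "ennreal (poisson z t * v t) \<le> ennreal (2 * d * (v t * (1 / (dist (cis t) z)\<^sup>2)))" by (rule ennreal_leI)
    also have "\<dots> = ennreal (2 * d) * (ennreal (v t) * ennreal (1 / (dist (cis t) z)\<^sup>2))"
    proof -
      have "ennreal (x * (y * k)) = ennreal x * (ennreal y * ennreal k)" if "0 \<le> x" "0 \<le> y" "0 \<le> k" for x y k
        using that by (simp add: ennreal_mult)
      then show ?thesis using d v(2)[of t] by (meson less_imp_le mult_nonneg_nonneg zero_le_numeral zero_le_divide_1_iff zero_le_power2)
    qed
    finally show "ennreal (poisson z t * v t) \<le> ennreal (2 * d) * (ennreal (v t) * ennreal (1 / (dist (cis t) z)\<^sup>2))" .
  qed
  also have "\<dots> = ennreal (2 * d) * (\<integral>\<^sup>+\<xi>. ennreal (1 / (dist \<xi> z)\<^sup>2) \<partial>circle_density v)"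
    by (subst nn_integral_circle_density) (auto simp: nn_integral_cmult)
  also have "\<dots> \<le> ennreal (2 * d) * ennreal (16 * T * dist \<zeta> z / d\<^sup>2)"
    unfolding d_def by (intro mult_left_mono kernel_le_maximal \<zeta> z T AE_circle_density) auto
  also have "\<dots> = ennreal (32 * T * dist \<zeta> z / d)"
    using d T by (simp add: ennreal_mult[symmetric] power2_eq_square)
  finally have "ennreal (\<integral>t. poisson z t * v t \<partial>ang) \<le> ennreal (32 * T * dist \<zeta> z / d)" .
  then show ?thesis using T d by (simp add: ennreal_le_iff d_def)
qed

text \<open>Fatou's lemma for sets. It transfers estimates on circles of radius less than 1 to the boundary.\<close>

lemma outer_measure_liminf:
  assumes E: "\<And>\<zeta>. \<zeta> \<in> E \<Longrightarrow> eventually (\<lambda>n. \<zeta> \<in> G n) sequentially"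
    and c: "\<And>n. outer_measure_of circ (G n) \<le> c"
  shows "outer_measure_of circ E \<le> c"
proof -
  define A where "A n = {\<zeta> \<in> E. \<forall>m\<ge>n. \<zeta> \<in> G m}" for n
  have "E = (\<Union>n. A n)" using E unfolding A_def eventually_sequentially by blast
  moreover have "incseq A" unfolding A_def incseq_def by auto
  ultimately have "outer_measure_of circ E = (SUP n. outer_measure_of circ (A n))"
    by (simp add: SUP_outer_measure_of_incseq)
  also have "\<dots> \<le> c"
  proof (rule SUP_least)
    fix n
    have "outer_measure_of circ (A n) \<le> outer_measure_of circ (G n)"
      by (intro outer_measure_of_mono) (auto simp: A_def)
    then show "outer_measure_of circ (A n) \<le> c" using c[of n] by simp
  qed
  finally show ?thesis .
qed

lemma AE_circ_outer_null:
  assumes "\<And>c::real. c > 0 \<Longrightarrow> outer_measure_of circ E \<le> ennreal c"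
  shows "AE \<zeta> in circ. \<zeta> \<notin> E"
proof -
  have "outer_measure_of circ E \<le> 0"
    by (rule ennreal_le_epsilon) (use assms in auto)
  then have 0: "outer_measure_of circ E = 0" by simp
  obtain B where B: "B \<in> sets circ" "E \<subseteq> B" "outer_measure_of circ E = emeasure circ B"
    using outer_measure_of_attain[of E circ] by auto
  then have "B \<in> null_sets circ" using 0 by auto
  then have "AE \<zeta> in circ. \<zeta> \<notin> B" by (rule AE_not_in)
  then show ?thesis using B(2) by (auto elim: eventually_mono)
qed

definition radii :: "nat \<Rightarrow> real" where "radii n = 1 - 1 / (real n + 2)"

lemma radii: "0 < radii n" "radii n < 1"
  by (auto simp: radii_def field_simps)

lemma radii_tendsto: "radii \<longlonglongrightarrow> 1"
proof -
  have "(\<lambda>n. 1 - 1 / (real n + 2)) \<longlonglongrightarrow> 1 - 0"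
    by (intro tendsto_diff tendsto_const) real_asymp
  then show ?thesis by (simp add: radii_def[abs_def])
qed

lemma radii_at_left: "filterlim radii (at_left 1) sequentially"
  unfolding filterlim_at using radii radii_tendsto by (auto intro!: always_eventually simp: less_imp_neq)

lemma stolz_dist:
  assumes "z \<in> stolz \<alpha> \<zeta>" "\<alpha> \<ge> 1"
  shows "dist \<zeta> z \<le> 2 * \<alpha> * (1 - norm z)" "z \<in> ball 0 1"
proof -
  show z: "z \<in> ball 0 1" using assms by (simp add: stolz_def)
  have "dist \<zeta> z \<le> \<alpha> * (1 - (norm z)\<^sup>2)" using assms by (auto simp: stolz_def dist_norm norm_minus_commute)
  also have "\<dots> \<le> \<alpha> * (2 * (1 - norm z))" using one_minus_norm_squared(2)[OF z] assms by (intro mult_left_mono) auto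
  finally show "dist \<zeta> z \<le> 2 * \<alpha> * (1 - norm z)" by (simp add: algebra_simps)
qed

lemma continuous_on_circle:
  assumes "continuous_on (ball 0 1) f" "0 \<le> r" "r < 1"
  shows "continuous_on UNIV (\<lambda>t. f (of_real r * cis t))"
  using assms by (intro continuous_on_compose2[OF assms(1)] continuous_intros) (auto simp: norm_mult)

lemma dilation:
  fixes q :: "complex \<Rightarrow> complex"
  assumes "q holomorphic_on ball 0 1" "0 \<le> r" "r < 1"
  shows "continuous_on (cball 0 1) (\<lambda>z. q (of_real r * z))" "(\<lambda>z. q (of_real r * z)) holomorphic_on ball 0 1"
proof -
  have sub: "of_real r * z \<in> ball 0 1" if "norm z \<le> 1" for z :: complex
  proof -
    have "r * norm z \<le> r * 1" using that assms by (intro mult_left_mono) auto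
    then show ?thesis using assms by (simp add: norm_mult)
  qed
  show "continuous_on (cball 0 1) (\<lambda>z. q (of_real r * z))"
    using sub by (intro continuous_on_compose2[OF holomorphic_on_imp_continuous_on[OF assms(1)]] continuous_intros) auto
  have "(q \<circ> (\<lambda>z. of_real r * z)) holomorphic_on ball 0 1"
    using sub by (intro holomorphic_on_compose_gen[OF _ assms(1)] holomorphic_intros) auto
  then show "(\<lambda>z. q (of_real r * z)) holomorphic_on ball 0 1" by (simp add: o_def)
qed

lemma holomorphic_le_Poisson:
  assumes "q holomorphic_on ball 0 1" "0 \<le> r" "r < 1" "z \<in> ball 0 1"
  shows "norm (q (of_real r * z)) \<le> (\<integral>t. poisson z t * norm (q (of_real r * cis t)) \<partial>ang)"
proof -
  have "q (of_real r * z) = (\<integral>t. of_real (poisson z t) * q (of_real r * cis t) \<partial>ang)"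
    using Poisson_formula[OF dilation[OF assms(1-3)] assms(4)] by simp
  also have "norm \<dots> \<le> (\<integral>t. norm (of_real (poisson z t) * q (of_real r * cis t)) \<partial>ang)"
    by (rule integral_norm_bound)
  also have "\<dots> = (\<integral>t. poisson z t * norm (q (of_real r * cis t)) \<partial>ang)"
    using poisson_nonneg[OF assms(4)] by (simp add: norm_mult)
  finally show ?thesis .
qed

text \<open>For \<open>z\<close> in a Stolz angle at \<open>\<zeta>\<close> the ratio of \<open>|\<zeta> - z|\<close> and \<open>1 - |z|\<close> is bounded, so the Poisson integral at
  \<open>z\<close> is dominated by the maximal function at \<open>\<zeta>\<close>. The argument is applied to the dilates of \<open>q\<close>,
  which are continuous up to the boundary.\<close>

lemma nontangential_weak_type:
  assumes q: "q holomorphic_on ball 0 1"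
    and \<epsilon>: "\<And>r. 0 \<le> r \<Longrightarrow> r < 1 \<Longrightarrow> (\<integral>t. norm (q (of_real r * cis t)) \<partial>ang) \<le> \<epsilon>"
    and \<alpha>: "\<alpha> \<ge> 1" and s: "0 < s"
  shows "outer_measure_of circ {\<zeta> \<in> sphere 0 1. \<exists>z\<in>stolz \<alpha> \<zeta>. s < norm (q z)} \<le> ennreal (640 * \<alpha> * \<epsilon> / s)"
proof (rule outer_measure_liminf)
  define v where "v n t = norm (q (of_real (radii n) * cis t))" for n t
  define T where "T = s / (64 * \<alpha>)"
  have T: "0 < T" using s \<alpha> by (simp add: T_def)
  have cq: "continuous_on (ball 0 1) q" using q by (rule holomorphic_on_imp_continuous_on)
  have v: "integrable ang (v n)" "0 \<le> v n t" for n t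
    unfolding v_def using radii[of n]
    by (auto intro!: integrable_ang_cont continuous_on_norm continuous_on_circle cq)
  show "outer_measure_of circ (high_density (circle_density (v n)) T) \<le> ennreal (640 * \<alpha> * \<epsilon> / s)" for n
  proof -
    have "outer_measure_of circ (high_density (circle_density (v n)) T) \<le> ennreal (10 * (\<integral>t. v n t \<partial>ang) / T)"
      by (intro outer_measure_high_density v T)
    also have "\<dots> \<le> ennreal (10 * \<epsilon> / T)"
      using \<epsilon>[of "radii n"] radii[of n] T unfolding v_def by (intro ennreal_leI divide_right_mono mult_left_mono) auto
    also have "10 * \<epsilon> / T = 640 * \<alpha> * \<epsilon> / s" by (simp add: T_def)
    finally show ?thesis .
  qed
  fix \<zeta> assume "\<zeta> \<in> {\<zeta> \<in> sphere 0 1. \<exists>z\<in>stolz \<alpha> \<zeta>. s < norm (q z)}"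
  then obtain z where \<zeta>: "\<zeta> \<in> sphere 0 1" and z: "z \<in> stolz \<alpha> \<zeta>" "s < norm (q z)" by auto
  have zb: "z \<in> ball 0 1" and zd: "dist \<zeta> z \<le> 2 * \<alpha> * (1 - norm z)" using stolz_dist[OF z(1) \<alpha>] by auto
  have "isCont q z" using cq zb continuous_on_interior[of "ball 0 1" q z] by simp
  moreover have "(\<lambda>n. of_real (radii n) * z) \<longlonglongrightarrow> of_real 1 * z"
    by (intro tendsto_intros radii_tendsto)
  ultimately have "(\<lambda>n. norm (q (of_real (radii n) * z))) \<longlonglongrightarrow> norm (q z)"
    by (intro tendsto_norm isCont_tendsto_compose[of z q]) auto
  then have "eventually (\<lambda>n. s < norm (q (of_real (radii n) * z))) sequentially"
    using z(2) by (rule order_tendstoD)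
  then show "eventually (\<lambda>n. \<zeta> \<in> high_density (circle_density (v n)) T) sequentially"
  proof eventually_elim
    case (elim n)
    show ?case
    proof (rule ccontr)
      assume "\<zeta> \<notin> high_density (circle_density (v n)) T"
      then have "(\<integral>t. poisson z t * v n t \<partial>ang) \<le> 32 * T * dist \<zeta> z / (1 - norm z)"
        using T by (intro poisson_le_maximal v zb \<zeta>) auto
      also have "\<dots> \<le> 32 * T * (2 * \<alpha> * (1 - norm z)) / (1 - norm z)"
        using zd zb T by (intro divide_right_mono mult_left_mono) auto
      also have "\<dots> = s" using zb \<alpha> by (simp add: T_def)
      finally have "norm (q (of_real (radii n) * z)) \<le> s"
        using holomorphic_le_Poisson[OF q _ _ zb, of "radii n"] radii[of n] unfolding v_def by linarith
      then show False using elim by simp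
    qed
  qed
qed

section \<open>Approximation by Taylor polynomials in the mean\<close>

lemma integral_cis_powers:
  "(\<integral>t. cis t ^ n * cnj (cis t ^ m) \<partial>ang) = (if n = m then 1 else 0)"
proof -
  have base: "(\<integral>t. cis t ^ k \<partial>ang) = (if k = 0 then 1 else 0)" for k
    using Poisson_formula[of "\<lambda>z. z ^ k" 0] by (simp add: poisson_def power_0_left holomorphic_intros continuous_intros)
  have unit: "cis t ^ k * cnj (cis t ^ k) = 1" for t k
    using complex_norm_square[of "cis t ^ k"] by (simp add: norm_power)
  have ge: "(\<integral>t. cis t ^ n * cnj (cis t ^ m) \<partial>ang) = (if n = m then 1 else 0)" if "m \<le> n" for m n
  proof -
    have "cis t ^ n * cnj (cis t ^ m) = cis t ^ (n - m)" for t
    proof -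
      have "cis t ^ n * cnj (cis t ^ m) = cis t ^ (n - m) * (cis t ^ m * cnj (cis t ^ m))"
        using that by (simp only: mult.assoc[symmetric] power_add[symmetric] le_add_diff_inverse2)
      then show ?thesis by (simp only: unit mult_1_right)
    qed
    then show ?thesis using base[of "n - m"] that by auto
  qed
  show ?thesis
  proof (cases "m \<le> n")
    case False
    have "(\<integral>t. cis t ^ n * cnj (cis t ^ m) \<partial>ang) = (\<integral>t. cnj (cis t ^ m * cnj (cis t ^ n)) \<partial>ang)"
      by (simp add: mult.commute)
    also have "\<dots> = cnj (\<integral>t. cis t ^ m * cnj (cis t ^ n) \<partial>ang)" by (rule Bochner_Integration.integral_cnj)
    also have "\<dots> = 0" using ge[of n m] False by simp
    finally show ?thesis using False by simp
  qed (rule ge)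
qed

lemma Parseval_polynomial:
  fixes b :: "nat \<Rightarrow> complex"
  assumes "finite A"
  shows "(\<integral>t. (norm (\<Sum>n\<in>A. b n * cis t ^ n))\<^sup>2 \<partial>ang) = (\<Sum>n\<in>A. (norm (b n))\<^sup>2)"
proof -
  have c: "continuous_on UNIV (\<lambda>t. b n * cnj (b m) * (cis t ^ n * cnj (cis t ^ m)))" for n m
    by (intro continuous_intros)
  have "complex_of_real (\<integral>t. (norm (\<Sum>n\<in>A. b n * cis t ^ n))\<^sup>2 \<partial>ang)
      = (\<integral>t. complex_of_real ((norm (\<Sum>n\<in>A. b n * cis t ^ n))\<^sup>2) \<partial>ang)"
    by (rule integral_complex_of_real[symmetric])
  also have "\<dots> = (\<integral>t. (\<Sum>n\<in>A. \<Sum>m\<in>A. b n * cnj (b m) * (cis t ^ n * cnj (cis t ^ m))) \<partial>ang)"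
    by (rule Bochner_Integration.integral_cong[OF refl], subst complex_norm_square)
       (simp only: cnj_sum sum_product complex_cnj_mult mult_ac)
  also have "\<dots> = (\<Sum>n\<in>A. \<Sum>m\<in>A. (\<integral>t. b n * cnj (b m) * (cis t ^ n * cnj (cis t ^ m)) \<partial>ang))"
    by (simp add: Bochner_Integration.integral_sum integrable_ang_cont[OF c] del: integral_mult_right_zero complex_cnj_power)
  also have "\<dots> = (\<Sum>n\<in>A. \<Sum>m\<in>A. if m = n then b n * cnj (b n) else 0)"
    by (intro sum.cong refl) (simp add: integral_cis_powers del: complex_cnj_power)
  also have "\<dots> = (\<Sum>n\<in>A. complex_of_real ((norm (b n))\<^sup>2))"
    using assms by (intro sum.cong refl) (simp only: sum.delta if_True complex_norm_square)
  finally show ?thesis by (simp only: of_real_sum[symmetric] of_real_eq_iff)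
qed

text \<open>Orthogonality of the monomials, for the Taylor series of \<open>g\<close> from index \<open>N\<close> on.\<close>

lemma L2_tail:
  fixes g :: "complex \<Rightarrow> complex"
  assumes a: "\<And>z. z \<in> ball 0 1 \<Longrightarrow> (\<lambda>n. a n * z ^ n) sums g z" and r: "0 \<le> r" "r < 1"
  shows "(\<lambda>M. \<Sum>n\<in>{N..<M}. (norm (a n) * r ^ n)\<^sup>2) \<longlonglongrightarrow>
    (\<integral>t. (norm (g (of_real r * cis t) - (\<Sum>n<N. a n * (of_real r * cis t) ^ n)))\<^sup>2 \<partial>ang)"
proof -
  let ?q = "\<lambda>M t. \<Sum>n\<in>{N..<M}. a n * (of_real r * cis t) ^ n"
  have rb: "of_real r * cis t \<in> ball 0 1" for t using r by (simp add: norm_mult)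
  have sm: "summable (\<lambda>n. norm (a n) * r ^ n)"
  proof -
    define \<rho> where "\<rho> = (1 + r) / 2"
    have "0 \<le> \<rho>" "\<rho> < 1" using r by (simp_all add: \<rho>_def)
    then have "of_real \<rho> \<in> ball (0::complex) 1" by simp
    then have "summable (\<lambda>n. a n * (of_real \<rho>::complex) ^ n)" using a sums_summable by blast
    then have "summable (\<lambda>n. norm (a n * (of_real r::complex) ^ n))"
    proof (rule powser_insidea)
      have "r < \<rho>" using r by (simp add: \<rho>_def)
      then show "norm (of_real r :: complex) < norm (of_real \<rho> :: complex)" using r by simp
    qed
    then show ?thesis using r by (simp add: norm_mult norm_power)
  qed
  have lim: "(\<lambda>M. \<integral>t. (norm (?q M t))\<^sup>2 \<partial>ang) \<longlonglongrightarrow>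
     (\<integral>t. (norm (g (of_real r * cis t) - (\<Sum>n<N. a n * (of_real r * cis t) ^ n)))\<^sup>2 \<partial>ang)"
  proof (rule integral_dominated_convergence[where w = "\<lambda>_. (\<Sum>n. norm (a n) * r ^ n)\<^sup>2"])
    have qlim: "(\<lambda>M. ?q M t) \<longlonglongrightarrow> g (of_real r * cis t) - (\<Sum>n<N. a n * (of_real r * cis t) ^ n)" for t
    proof -
      have "(\<lambda>M. (\<Sum>n<M. a n * (of_real r * cis t) ^ n) - (\<Sum>n<N. a n * (of_real r * cis t) ^ n))
         \<longlonglongrightarrow> g (of_real r * cis t) - (\<Sum>n<N. a n * (of_real r * cis t) ^ n)"
        using a[OF rb] by (intro tendsto_diff tendsto_const) (simp add: sums_def)
      moreover have "eventually (\<lambda>M. (\<Sum>n<M. a n * (of_real r * cis t) ^ n) - (\<Sum>n<N. a n * (of_real r * cis t) ^ n) = ?q M t) sequentially"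
        using eventually_ge_at_top[of N]
      proof eventually_elim
        case (elim M)
        have "{..<M} = {..<N} \<union> {N..<M}" using elim by auto
        then have "(\<Sum>n<M. a n * (of_real r * cis t) ^ n) = (\<Sum>n<N. a n * (of_real r * cis t) ^ n) + ?q M t"
          by (simp add: sum.union_disjoint ivl_disj_int)
        then show ?case by simp
      qed
      ultimately show ?thesis by (rule Lim_transform_eventually)
    qed
    then show "AE t in ang. (\<lambda>M. (norm (?q M t))\<^sup>2) \<longlonglongrightarrow> (norm (g (of_real r * cis t) - (\<Sum>n<N. a n * (of_real r * cis t) ^ n)))\<^sup>2"
      by (intro AE_I2 tendsto_power tendsto_norm)
    show qm: "(\<lambda>t. (norm (?q M t))\<^sup>2) \<in> borel_measurable ang" for M
      by (intro borel_measurable_ang_cont continuous_intros)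
    show "(\<lambda>t. (norm (g (of_real r * cis t) - (\<Sum>n<N. a n * (of_real r * cis t) ^ n)))\<^sup>2) \<in> borel_measurable ang"
      by (rule borel_measurable_LIMSEQ_real[where u = "\<lambda>M t. (norm (?q M t))\<^sup>2", OF _ qm])
         (intro tendsto_power tendsto_norm qlim)
    show "integrable ang (\<lambda>_. (\<Sum>n. norm (a n) * r ^ n)\<^sup>2)" by simp
    show "AE t in ang. norm ((norm (?q M t))\<^sup>2) \<le> (\<Sum>n. norm (a n) * r ^ n)\<^sup>2" for M
    proof (rule AE_I2)
      fix t
      have "norm (?q M t) \<le> (\<Sum>n\<in>{N..<M}. norm (a n) * r ^ n)"
        using r by (intro order_trans[OF norm_sum] sum_mono) (simp add: norm_mult norm_power)
      also have "\<dots> \<le> (\<Sum>n. norm (a n) * r ^ n)" using r by (intro sum_le_suminf sm) auto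
      finally show "norm ((norm (?q M t))\<^sup>2) \<le> (\<Sum>n. norm (a n) * r ^ n)\<^sup>2" by (simp add: power_mono)
    qed
  qed
  have "(\<integral>t. (norm (?q M t))\<^sup>2 \<partial>ang) = (\<Sum>n\<in>{N..<M}. (norm (a n) * r ^ n)\<^sup>2)" for M
    using Parseval_polynomial[of "{N..<M}" "\<lambda>n. a n * of_real r ^ n"] r
    by (simp add: power_mult_distrib mult.assoc norm_mult norm_power)
  with lim show ?thesis by simp
qed

lemma bounded_holomorphic_coeffs:
  fixes g :: "complex \<Rightarrow> complex"
  assumes a: "\<And>z. z \<in> ball 0 1 \<Longrightarrow> (\<lambda>n. a n * z ^ n) sums g z"
    and g1: "\<And>z. z \<in> ball 0 1 \<Longrightarrow> norm (g z) \<le> 1"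
  shows "(\<Sum>n<M. (norm (a n))\<^sup>2) \<le> 1"
proof -
  have le: "(\<Sum>n<M. (norm (a n) * r ^ n)\<^sup>2) \<le> 1" if r: "0 \<le> r" "r < 1" for r
  proof -
    let ?S = "\<lambda>M. \<Sum>n\<in>{0..<M}. (norm (a n) * r ^ n)\<^sup>2"
    let ?J = "\<integral>t. (norm (g (of_real r * cis t)))\<^sup>2 \<partial>ang"
    have "?S \<longlonglongrightarrow> ?J" using L2_tail[OF a r, of 0] by simp
    moreover have "incseq ?S" by (intro monoI sum_mono2) auto
    ultimately have "?S M \<le> ?J" by (rule incseq_le[rotated])
    also have "?J \<le> 1"
    proof (rule order_trans[OF integral_mono_AE'[of _ "\<lambda>_. 1"]])
      show "AE t in ang. (norm (g (of_real r * cis t)))\<^sup>2 \<le> 1"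
        using g1 r by (intro AE_I2 power_le_one) (auto simp: norm_mult)
    qed auto
    finally show ?thesis by (simp add: lessThan_atLeast0)
  qed
  have "((\<lambda>r. \<Sum>n<M. (norm (a n) * r ^ n)\<^sup>2) \<longlongrightarrow> (\<Sum>n<M. (norm (a n) * 1 ^ n)\<^sup>2)) (at_left 1)"
    by (intro tendsto_intros)
  moreover have "eventually (\<lambda>r. (\<Sum>n<M. (norm (a n) * r ^ n)\<^sup>2) \<le> 1) (at_left 1)"
  proof -
    have "eventually (\<lambda>r::real. r \<in> {0<..<1}) (at_left 1)" by (intro eventually_at_left_real) auto
    then show ?thesis by eventually_elim (auto intro: le)
  qed
  ultimately have "(\<Sum>n<M. (norm (a n) * 1 ^ n)\<^sup>2) \<le> 1"
    by (intro tendsto_upperbound) auto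
  then show ?thesis by simp
qed

text \<open>The Taylor coefficients are square summable by Bessel's inequality, and the square mean of the remainder is
  at most the tail of their sum, for every radius. The mean of \<open>|q|\<close> is then estimated through
  \<open>|q| \<le> \<epsilon> / 2 + |q|\<^sup>2 / (2 * \<epsilon>)\<close>.\<close>

lemma bounded_holomorphic_approx:
  fixes g :: "complex \<Rightarrow> complex"
  assumes holo: "g holomorphic_on ball 0 1" and g1: "\<And>z. z \<in> ball 0 1 \<Longrightarrow> norm (g z) \<le> 1" and \<epsilon>: "0 < \<epsilon>"
  obtains p where "p holomorphic_on UNIV"
    "\<And>r. 0 \<le> r \<Longrightarrow> r < 1 \<Longrightarrow> (\<integral>t. norm (g (of_real r * cis t) - p (of_real r * cis t)) \<partial>ang) \<le> \<epsilon>"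
proof -
  define a where "a n = (deriv ^^ n) g 0 / fact n" for n
  have a: "(\<lambda>n. a n * z ^ n) sums g z" if "z \<in> ball 0 1" for z
    using holomorphic_power_series[OF holo that] by (simp add: a_def)
  have S: "summable (\<lambda>n. (norm (a n))\<^sup>2)"
    using bounded_holomorphic_coeffs[OF a g1] by (intro summableI_nonneg_bounded[of _ 1]) (rule zero_le_power2)
  have "(\<lambda>N. \<Sum>n. (norm (a (n + N)))\<^sup>2) \<longlonglongrightarrow> 0" by (rule suminf_exist_split2[OF S])
  then have "eventually (\<lambda>N. (\<Sum>n. (norm (a (n + N)))\<^sup>2) < \<epsilon>\<^sup>2) sequentially"
    using \<epsilon> by (intro order_tendstoD(2)) auto
  then obtain N where N: "(\<Sum>n. (norm (a (n + N)))\<^sup>2) < \<epsilon>\<^sup>2" by (auto simp: eventually_sequentially)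
  define p where "p z = (\<Sum>n<N. a n * z ^ n)" for z
  have hp: "p holomorphic_on UNIV" unfolding p_def by (intro holomorphic_intros)
  have "(\<integral>t. norm (g (of_real r * cis t) - p (of_real r * cis t)) \<partial>ang) \<le> \<epsilon>" if r: "0 \<le> r" "r < 1" for r
  proof -
    define q where "q t = g (of_real r * cis t) - p (of_real r * cis t)" for t
    have cq: "continuous_on UNIV q" unfolding q_def
      by (intro continuous_intros continuous_on_circle r holomorphic_on_imp_continuous_on holo
            holomorphic_on_imp_continuous_on[OF holomorphic_on_subset[OF hp]]) auto
    have "(\<integral>t. (norm (q t))\<^sup>2 \<partial>ang) \<le> \<epsilon>\<^sup>2"
    proof (rule LIMSEQ_le_const2)
      show "(\<lambda>M. \<Sum>n\<in>{N..<M}. (norm (a n) * r ^ n)\<^sup>2) \<longlonglongrightarrow> (\<integral>t. (norm (q t))\<^sup>2 \<partial>ang)"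
        unfolding q_def p_def by (rule L2_tail[OF a r])
      have "(\<Sum>n\<in>{N..<M}. (norm (a n) * r ^ n)\<^sup>2) \<le> \<epsilon>\<^sup>2" for M
      proof -
        have "(\<Sum>n\<in>{N..<M}. (norm (a n) * r ^ n)\<^sup>2) \<le> (\<Sum>n\<in>{N..<M}. (norm (a n))\<^sup>2)"
          using r by (intro sum_mono power_mono mult_left_le power_le_one) auto
        also have "\<dots> \<le> (\<Sum>n\<in>{0 + N..<M + N}. (norm (a n))\<^sup>2)" by (intro sum_mono2) auto
        also have "\<dots> = (\<Sum>n\<in>{0..<M}. (norm (a (n + N)))\<^sup>2)" by (rule sum.shift_bounds_nat_ivl)
        also have "\<dots> \<le> (\<Sum>n. (norm (a (n + N)))\<^sup>2)"
          using summable_iff_shift[of "\<lambda>n. (norm (a n))\<^sup>2" N] S by (intro sum_le_suminf) auto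
        finally show ?thesis using N by simp
      qed
      then show "\<exists>K. \<forall>M\<ge>K. (\<Sum>n\<in>{N..<M}. (norm (a n) * r ^ n)\<^sup>2) \<le> \<epsilon>\<^sup>2" by blast
    qed
    moreover have "(\<integral>t. norm (q t) \<partial>ang) \<le> (\<integral>t. \<epsilon> / 2 + (norm (q t))\<^sup>2 / (2 * \<epsilon>) \<partial>ang)"
    proof (rule integral_mono)
      show "integrable ang (\<lambda>t. norm (q t))" "integrable ang (\<lambda>t. \<epsilon> / 2 + (norm (q t))\<^sup>2 / (2 * \<epsilon>))"
        using \<epsilon> by (auto intro!: integrable_ang_cont continuous_intros cq)
      fix t
      have "0 \<le> (\<epsilon> - norm (q t))\<^sup>2 / (2 * \<epsilon>)" using \<epsilon> by simp
      also have "\<dots> = \<epsilon> / 2 + (norm (q t))\<^sup>2 / (2 * \<epsilon>) - norm (q t)"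
        using \<epsilon> by (simp add: power2_eq_square field_simps)
      finally show "norm (q t) \<le> \<epsilon> / 2 + (norm (q t))\<^sup>2 / (2 * \<epsilon>)" by simp
    qed
    moreover have "(\<integral>t. \<epsilon> / 2 + (norm (q t))\<^sup>2 / (2 * \<epsilon>) \<partial>ang) = \<epsilon> / 2 + (\<integral>t. (norm (q t))\<^sup>2 \<partial>ang) / (2 * \<epsilon>)"
    proof -
      have "integrable ang (\<lambda>t. (norm (q t))\<^sup>2 / (2 * \<epsilon>))"
        using \<epsilon> by (auto intro!: integrable_ang_cont continuous_intros cq)
      then show ?thesis by simp
    qed
    ultimately have "(\<integral>t. norm (q t) \<partial>ang) \<le> \<epsilon> / 2 + \<epsilon>\<^sup>2 / (2 * \<epsilon>)"
      using \<epsilon> divide_right_mono[of "\<integral>t. (norm (q t))\<^sup>2 \<partial>ang" "\<epsilon>\<^sup>2" "2 * \<epsilon>"] by linarith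
    also have "\<dots> = \<epsilon>" using \<epsilon> by (simp add: power2_eq_square)
    finally show ?thesis by (simp add: q_def)
  qed
  from that[OF hp this] show ?thesis .
qed

section \<open>Nontangential limits of bounded functions\<close>

lemma radial_in_stolz:
  assumes "\<zeta> \<in> sphere 0 1" "0 < r" "r < 1" "\<alpha> \<ge> 1"
  shows "of_real r * \<zeta> \<in> stolz \<alpha> \<zeta>"
proof -
  have n: "norm \<zeta> = 1" using assms by simp
  have "of_real r * \<zeta> - \<zeta> = of_real (r - 1) * \<zeta>" by (simp add: algebra_simps)
  then have "norm (of_real r * \<zeta> - \<zeta>) = 1 - r" using n assms by (simp only: norm_mult norm_of_real) simp
  also have "\<dots> \<le> 1 - r\<^sup>2" using assms by (simp add: power2_eq_square)
  also have "\<dots> \<le> \<alpha> * (1 - r\<^sup>2)" using assms mult_right_mono[of 1 \<alpha> "1 - r\<^sup>2"] by (simp add: power_le_one)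
  finally show ?thesis using n assms by (simp add: stolz_def norm_mult)
qed

lemma radial_limit:
  assumes "(f \<longlongrightarrow> l) (at \<zeta> within stolz \<alpha> \<zeta>)" "\<zeta> \<in> sphere 0 1" "\<alpha> \<ge> 1"
  shows "((\<lambda>r. f (of_real r * \<zeta>)) \<longlongrightarrow> l) (at_left 1)"
proof (rule filterlim_compose[OF assms(1)])
  have "((\<lambda>r::real. of_real r * \<zeta>) \<longlongrightarrow> of_real 1 * \<zeta>) (at_left 1)" by (intro tendsto_intros)
  moreover have "eventually (\<lambda>r::real. r \<in> {0<..<1}) (at_left 1)" by (intro eventually_at_left_real) auto
  then have "eventually (\<lambda>r::real. of_real r * \<zeta> \<in> stolz \<alpha> \<zeta> \<and> of_real r * \<zeta> \<noteq> \<zeta>) (at_left 1)"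
    by eventually_elim (use assms in \<open>auto intro!: radial_in_stolz\<close>)
  ultimately show "filterlim (\<lambda>r. of_real r * \<zeta>) (at \<zeta> within stolz \<alpha> \<zeta>) (at_left 1)"
    unfolding filterlim_at by simp
qed

lemma has_nt_limit_radial:
  assumes "has_nt_limit f l \<zeta>" "\<zeta> \<in> sphere 0 1"
  shows "((\<lambda>r. f (of_real r * \<zeta>)) \<longlongrightarrow> l) (at_left 1)"
  using assms radial_limit[of f l \<zeta> 1] by (auto simp: has_nt_limit_def)

lemma nt_boundary_eq:
  assumes "has_nt_limit f l \<zeta>" "\<zeta> \<in> sphere 0 1"
  shows "nt_boundary f \<zeta> = l"
  unfolding nt_boundary_def
proof (rule the_equality[where P = "\<lambda>l. has_nt_limit f l \<zeta>", OF assms(1)])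
  fix l' assume "has_nt_limit f l' \<zeta>"
  from tendsto_unique[OF _ has_nt_limit_radial[OF this assms(2)] has_nt_limit_radial[OF assms]]
  show "l' = l" by simp
qed

text \<open>Off a set of small measure, \<open>g\<close> differs little from a polynomial on the whole Stolz angle. Since polynomials
  are continuous, \<open>g\<close> satisfies Cauchy's criterion at almost every point.\<close>

lemma bounded_stolz_limit:
  assumes g: "g holomorphic_on ball 0 1" and g1: "\<And>z. z \<in> ball 0 1 \<Longrightarrow> norm (g z) \<le> 1" and \<alpha>: "\<alpha> \<ge> 1"
  shows "AE \<zeta> in circ. \<exists>l. (g \<longlongrightarrow> l) (at \<zeta> within stolz \<alpha> \<zeta>)"
proof -
  define E where "E k = {\<zeta> \<in> sphere 0 1. \<forall>p. p holomorphic_on UNIV \<longrightarrow> (\<exists>z\<in>stolz \<alpha> \<zeta>. 1 / Suc k < norm (g z - p z))}" for k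
  have "AE \<zeta> in circ. \<zeta> \<notin> E k" for k
  proof (rule AE_circ_outer_null)
    fix c :: real assume c: "0 < c"
    define \<epsilon> where "\<epsilon> = c / (640 * \<alpha> * Suc k)"
    have \<epsilon>: "0 < \<epsilon>" using c \<alpha> by (simp add: \<epsilon>_def)
    obtain p where p: "p holomorphic_on UNIV"
      "\<And>r. 0 \<le> r \<Longrightarrow> r < 1 \<Longrightarrow> (\<integral>t. norm (g (of_real r * cis t) - p (of_real r * cis t)) \<partial>ang) \<le> \<epsilon>"
      using bounded_holomorphic_approx[OF g g1 \<epsilon>] by metis
    have "outer_measure_of circ (E k) \<le> outer_measure_of circ {\<zeta> \<in> sphere 0 1. \<exists>z\<in>stolz \<alpha> \<zeta>. 1 / Suc k < norm (g z - p z)}"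
      using p(1) by (intro outer_measure_of_mono) (auto simp: E_def)
    also have "\<dots> \<le> ennreal (640 * \<alpha> * \<epsilon> / (1 / Suc k))"
      using p g \<alpha> by (intro nontangential_weak_type holomorphic_intros) (auto intro: holomorphic_on_subset)
    also have "640 * \<alpha> * \<epsilon> / (1 / Suc k) = c" using \<alpha> by (simp add: \<epsilon>_def)
    finally show "outer_measure_of circ (E k) \<le> ennreal c" .
  qed
  then have "AE \<zeta> in circ. \<forall>k. \<zeta> \<notin> E k" by (simp add: AE_all_countable)
  with AE_circ_sphere show ?thesis
  proof eventually_elim
    case (elim \<zeta>)
    have cauchy: "\<exists>\<delta>>0. \<forall>z\<in>stolz \<alpha> \<zeta>. \<forall>w\<in>stolz \<alpha> \<zeta>. dist z \<zeta> < \<delta> \<longrightarrow> dist w \<zeta> < \<delta> \<longrightarrow> dist (g z) (g w) < s" if s: "0 < s" for s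
    proof -
      obtain k where k: "1 / Suc k < s / 4" using s by (metis divide_pos_pos nat_approx_posE zero_less_numeral)
      obtain p where p: "p holomorphic_on UNIV" "\<And>z. z \<in> stolz \<alpha> \<zeta> \<Longrightarrow> norm (g z - p z) \<le> 1 / Suc k"
        using elim by (force simp: E_def not_less)
      have "isCont p \<zeta>" using holomorphic_on_imp_continuous_on[OF p(1)] by (simp add: continuous_on_eq_continuous_at)
      then obtain \<delta> where \<delta>: "\<delta> > 0" "\<And>z. dist z \<zeta> < \<delta> \<Longrightarrow> dist (p z) (p \<zeta>) < s / 4"
        using s unfolding continuous_at_eps_delta by (metis divide_pos_pos zero_less_numeral)
      have "dist (g z) (g w) < s" if zw: "z \<in> stolz \<alpha> \<zeta>" "w \<in> stolz \<alpha> \<zeta>" "dist z \<zeta> < \<delta>" "dist w \<zeta> < \<delta>" for z w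
      proof -
        have "dist (g z) (p z) \<le> 1 / Suc k" "dist (g w) (p w) \<le> 1 / Suc k" using p(2) zw by (auto simp: dist_norm)
        moreover have "dist (g z) (g w) \<le> dist (g z) (p z) + (dist (p z) (p \<zeta>) + dist (p w) (p \<zeta>)) + dist (g w) (p w)"
          using dist_triangle[of "g z" "g w" "p z"] dist_triangle[of "p z" "g w" "p \<zeta>"] dist_triangle[of "p \<zeta>" "g w" "p w"]
          by (simp add: dist_commute)
        ultimately show ?thesis using k \<delta>(2)[OF zw(3)] \<delta>(2)[OF zw(4)] by linarith
      qed
      then show ?thesis using \<delta>(1) by blast
    qed
    have rad: "of_real (radii n) * \<zeta> \<in> stolz \<alpha> \<zeta>" for n using radii[of n] elim \<alpha> by (intro radial_in_stolz) auto
    have rlim: "(\<lambda>n. of_real (radii n) * \<zeta>) \<longlonglongrightarrow> \<zeta>"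
      using tendsto_mult[OF tendsto_of_real[OF radii_tendsto, where 'a=complex] tendsto_const[of \<zeta>]] by simp
    have "Cauchy (\<lambda>n. g (of_real (radii n) * \<zeta>))"
    proof (rule metric_CauchyI)
      fix s :: real assume "0 < s"
      from cauchy[OF this] obtain \<delta> where \<delta>: "\<delta> > 0"
        "\<And>z w. z \<in> stolz \<alpha> \<zeta> \<Longrightarrow> w \<in> stolz \<alpha> \<zeta> \<Longrightarrow> dist z \<zeta> < \<delta> \<Longrightarrow> dist w \<zeta> < \<delta> \<Longrightarrow> dist (g z) (g w) < s" by blast
      obtain M where "\<And>n. n \<ge> M \<Longrightarrow> dist (of_real (radii n) * \<zeta>) \<zeta> < \<delta>"
        using rlim \<delta>(1) unfolding lim_sequentially by blast
      then show "\<exists>M. \<forall>m\<ge>M. \<forall>n\<ge>M. dist (g (of_real (radii m) * \<zeta>)) (g (of_real (radii n) * \<zeta>)) < s"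
        using \<delta>(2) rad by blast
    qed
    then obtain l where l: "(\<lambda>n. g (of_real (radii n) * \<zeta>)) \<longlonglongrightarrow> l" using Cauchy_convergent_iff convergent_def by blast
    have "(g \<longlongrightarrow> l) (at \<zeta> within stolz \<alpha> \<zeta>)"
    proof (rule tendstoI)
      fix s :: real assume s: "0 < s"
      from cauchy[of "s / 2"] s obtain \<delta> where \<delta>: "\<delta> > 0"
        "\<And>z w. z \<in> stolz \<alpha> \<zeta> \<Longrightarrow> w \<in> stolz \<alpha> \<zeta> \<Longrightarrow> dist z \<zeta> < \<delta> \<Longrightarrow> dist w \<zeta> < \<delta> \<Longrightarrow> dist (g z) (g w) < s / 2"
        by (metis half_gt_zero)
      have "eventually (\<lambda>n. dist (of_real (radii n) * \<zeta>) \<zeta> < \<delta>) sequentially" using rlim \<delta>(1) by (rule tendstoD)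
      moreover have "eventually (\<lambda>n. dist (g (of_real (radii n) * \<zeta>)) l < s / 2) sequentially" using l s by (intro tendstoD) auto
      ultimately have "eventually (\<lambda>n. dist (of_real (radii n) * \<zeta>) \<zeta> < \<delta> \<and> dist (g (of_real (radii n) * \<zeta>)) l < s / 2) sequentially"
        by (rule eventually_conj)
      then obtain n where n: "dist (of_real (radii n) * \<zeta>) \<zeta> < \<delta>" "dist (g (of_real (radii n) * \<zeta>)) l < s / 2"
        by (auto simp: eventually_sequentially)
      have "dist (g z) l < s" if z: "z \<in> stolz \<alpha> \<zeta>" "dist z \<zeta> < \<delta>" for z
        using \<delta>(2)[OF z(1) rad z(2) n(1)] n(2) dist_triangle[of "g z" l "g (of_real (radii n) * \<zeta>)"] by linarith
      then show "\<forall>\<^sub>F x in at \<zeta> within stolz \<alpha> \<zeta>. dist (g x) l < s"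
        unfolding eventually_at using \<delta>(1) by blast
    qed
    then show ?case by blast
  qed
qed

text \<open>Limits along Stolz angles of different aperture agree, because all of them contain the radius.\<close>

lemma bounded_nt_limit:
  assumes g: "g holomorphic_on ball 0 1" and g1: "\<And>z. z \<in> ball 0 1 \<Longrightarrow> norm (g z) \<le> 1"
  shows "AE \<zeta> in circ. \<exists>l. has_nt_limit g l \<zeta>"
proof -
  have "AE \<zeta> in circ. \<forall>m. \<exists>l. (g \<longlongrightarrow> l) (at \<zeta> within stolz (real (Suc m)) \<zeta>)"
    unfolding AE_all_countable by (intro allI bounded_stolz_limit g g1) auto
  with AE_circ_sphere show ?thesis
  proof eventually_elim
    case (elim \<zeta>)
    then obtain l where l: "\<And>m. (g \<longlongrightarrow> l m) (at \<zeta> within stolz (real (Suc m)) \<zeta>)" by metis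
    have eq: "l m = l 0" for m
    proof (rule tendsto_unique)
      show "((\<lambda>r. g (of_real r * \<zeta>)) \<longlongrightarrow> l m) (at_left 1)" by (rule radial_limit[OF l elim(1)]) simp
      show "((\<lambda>r. g (of_real r * \<zeta>)) \<longlongrightarrow> l 0) (at_left 1)" by (rule radial_limit[OF l elim(1)]) simp
    qed simp
    have "has_nt_limit g (l 0) \<zeta>"
      unfolding has_nt_limit_def
    proof (intro allI impI)
      fix \<alpha> :: real assume \<alpha>: "1 \<le> \<alpha>"
      obtain m where m: "\<alpha> \<le> real m" using real_arch_simple by blast
      have "stolz \<alpha> \<zeta> \<subseteq> stolz (real (Suc m)) \<zeta>"
      proof
        fix z assume z: "z \<in> stolz \<alpha> \<zeta>"
        then have "\<alpha> * (1 - (norm z)\<^sup>2) \<le> real (Suc m) * (1 - (norm z)\<^sup>2)"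
          using m one_minus_norm_squared(1)[of z] by (intro mult_right_mono) (auto simp: stolz_def)
        then show "z \<in> stolz (real (Suc m)) \<zeta>" using z by (auto simp: stolz_def)
      qed
      then show "(g \<longlongrightarrow> l 0) (at \<zeta> within stolz \<alpha> \<zeta>)" using l[of m] tendsto_within_subset by (metis eq)
    qed
    then show ?case by blast
  qed
qed

section \<open>Logarithmic means\<close>

definition log_circle :: "(complex \<Rightarrow> complex) \<Rightarrow> real \<Rightarrow> real \<Rightarrow> real" where
  "log_circle f r t = log_plus (norm (f (of_real r * cis t)))"

definition log_mean :: "(complex \<Rightarrow> complex) \<Rightarrow> real \<Rightarrow> real" where
  "log_mean f r = (\<integral>t. log_circle f r t \<partial>ang)"

lemma log_circle_nonneg [simp]: "0 \<le> log_circle f r t"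
  by (simp add: log_circle_def)

lemma continuous_log_circle:
  assumes "f holomorphic_on ball 0 1" "0 \<le> r" "r < 1"
  shows "continuous_on UNIV (log_circle f r)"
  unfolding log_circle_def
  by (intro continuous_log_plus continuous_on_norm continuous_on_circle holomorphic_on_imp_continuous_on assms)

lemma integrable_log_circle:
  assumes "f holomorphic_on ball 0 1" "0 \<le> r" "r < 1"
  shows "integrable ang (log_circle f r)"
  by (intro integrable_ang_cont continuous_log_circle assms)

lemma log_plus_mean_eq:
  assumes "f holomorphic_on ball 0 1" "0 \<le> r" "r < 1"
  shows "log_plus_mean f r = ennreal (log_mean f r)"
proof -
  have m: "log_circle f r \<in> borel_measurable borel"
    by (intro borel_measurable_continuous_onI continuous_log_circle assms)
  have "ennreal (log_mean f r) = (\<integral>\<^sup>+t. ennreal (log_circle f r t) \<partial>ang)"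
    unfolding log_mean_def by (intro nn_integral_eq_integral[symmetric] integrable_log_circle assms) auto
  also have "\<dots> = log_plus_mean f r"
    using m by (subst nn_integral_ang) (auto simp: log_plus_mean_def log_circle_def[symmetric] nn_integral_completion)
  finally show ?thesis by simp
qed

lemma log_circle_le_Poisson:
  assumes "f holomorphic_on ball 0 1" "0 \<le> r" "r < 1" "z \<in> ball 0 1"
  shows "log_plus (norm (f (of_real r * z))) \<le> (\<integral>t. poisson z t * log_circle f r t \<partial>ang)"
  using log_plus_le_Poisson[OF dilation[OF assms(1-3)] assms(4)] by (simp add: log_circle_def)

lemma integral_poisson_rotate:
  assumes "0 \<le> \<rho>" "\<rho> < 1"
  shows "(\<integral>\<^sup>+u. ennreal (poisson (of_real \<rho> * cis u) t) \<partial>ang) = 1"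
proof -
  have z: "of_real \<rho> * cis t \<in> ball 0 1" using assms by (simp add: norm_mult)
  have "(\<integral>\<^sup>+u. ennreal (poisson (of_real \<rho> * cis u) t) \<partial>ang) = (\<integral>\<^sup>+u. ennreal (poisson (of_real \<rho> * cis t) u) \<partial>ang)"
    using poisson_symmetric[OF assms(1)] by simp
  also have "\<dots> = ennreal (\<integral>u. poisson (of_real \<rho> * cis t) u \<partial>ang)"
    using integral_poisson[OF z] poisson_nonneg[OF z] by (intro nn_integral_eq_integral) auto
  finally show ?thesis using integral_poisson[OF z] by simp
qed

text \<open>Integrate the Poisson inequality over the smaller circle; the kernel integrates to 1 in either variable.\<close>

lemma log_mean_mono:
  assumes f: "f holomorphic_on ball 0 1" and rs: "0 \<le> r" "r \<le> s" "s < 1"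
  shows "log_mean f r \<le> log_mean f s"
proof (cases "r = s")
  case False
  \<comment> \<open>The Poisson inequality for the dilate by \<open>s\<close>, at points of modulus \<open>\<rho>\<close>.\<close>
  define \<rho> where "\<rho> = r / s"
  have s: "0 < s" "r < s" using rs False by auto
  have \<rho>: "0 \<le> \<rho>" "\<rho> < 1" "r = s * \<rho>" using rs s by (auto simp: \<rho>_def field_simps)
  have zb: "of_real \<rho> * cis u \<in> ball 0 1" for u using \<rho> by (simp add: norm_mult)
  have vm [measurable]: "log_circle f s \<in> borel_measurable borel"
    using s rs by (intro borel_measurable_continuous_onI continuous_log_circle f) auto
  have int_s: "integrable ang (log_circle f s)" using s rs by (intro integrable_log_circle f) auto
  interpret pair_sigma_finite ang ang ..
  have "ennreal (log_mean f r) = (\<integral>\<^sup>+u. ennreal (log_circle f r u) \<partial>ang)"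
    unfolding log_mean_def using rs by (intro nn_integral_eq_integral[symmetric] integrable_log_circle f) auto
  also have "\<dots> \<le> (\<integral>\<^sup>+u. (\<integral>\<^sup>+t. ennreal (poisson (of_real \<rho> * cis u) t * log_circle f s t) \<partial>ang) \<partial>ang)"
  proof (rule nn_integral_mono)
    fix u
    have "log_circle f r u \<le> (\<integral>t. poisson (of_real \<rho> * cis u) t * log_circle f s t \<partial>ang)"
      using log_circle_le_Poisson[OF f _ _ zb[of u], of s] s rs by (simp add: log_circle_def \<rho>(3) mult.assoc)
    then show "ennreal (log_circle f r u) \<le> (\<integral>\<^sup>+t. ennreal (poisson (of_real \<rho> * cis u) t * log_circle f s t) \<partial>ang)"
      using poisson_nonneg[OF zb[of u]]
      by (subst nn_integral_eq_integral[OF integrable_poisson_mult[OF zb int_s]]) (auto intro: ennreal_leI)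
  qed
  also have "\<dots> = (\<integral>\<^sup>+t. (\<integral>\<^sup>+u. ennreal (poisson (of_real \<rho> * cis u) t * log_circle f s t) \<partial>ang) \<partial>ang)"
  proof (rule Fubini'[symmetric])
    show "(\<lambda>(u, t). ennreal (poisson (of_real \<rho> * cis u) t * log_circle f s t)) \<in> borel_measurable (ang \<Otimes>\<^sub>M ang)"
      unfolding poisson_def by measurable
  qed
  also have "\<dots> = (\<integral>\<^sup>+t. ennreal (log_circle f s t) \<partial>ang)"
  proof (rule nn_integral_cong)
    fix t
    have pm: "(\<lambda>u. ennreal (poisson (of_real \<rho> * cis u) t)) \<in> borel_measurable ang"
      unfolding poisson_def by measurable
    have "(\<integral>\<^sup>+u. ennreal (poisson (of_real \<rho> * cis u) t * log_circle f s t) \<partial>ang)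
        = (\<integral>\<^sup>+u. ennreal (poisson (of_real \<rho> * cis u) t) * ennreal (log_circle f s t) \<partial>ang)"
      using poisson_nonneg[OF zb] by (intro nn_integral_cong ennreal_mult) auto
    also have "\<dots> = ennreal (log_circle f s t)"
      by (subst nn_integral_multc[OF pm]) (simp add: integral_poisson_rotate[OF \<rho>(1,2)])
    finally show "(\<integral>\<^sup>+u. ennreal (poisson (of_real \<rho> * cis u) t * log_circle f s t) \<partial>ang) = ennreal (log_circle f s t)" .
  qed
  also have "\<dots> = ennreal (log_mean f s)"
    unfolding log_mean_def by (intro nn_integral_eq_integral int_s) auto
  finally have "ennreal (log_mean f r) \<le> ennreal (log_mean f s)" .
  moreover have "0 \<le> log_mean f s" unfolding log_mean_def by (intro integral_nonneg_AE) auto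
  ultimately show ?thesis by (simp add: ennreal_le_iff)
qed simp

lemma log_mean_nonneg: "0 \<le> log_mean f r"
  unfolding log_mean_def by (intro integral_nonneg_AE) auto

lemma eventually_left_1: "eventually (\<lambda>r::real. 0 < r \<and> r < 1) (at_left 1)"
proof -
  have "eventually (\<lambda>r::real. r \<in> {0<..<1}) (at_left 1)" by (intro eventually_at_left_real) auto
  then show ?thesis by eventually_elim auto
qed

lemma log_mean_bounded_eventually:
  assumes f: "f holomorphic_on ball 0 1" and ev: "eventually (\<lambda>r. log_mean f r \<le> L) (at_left 1)"
    and r: "0 \<le> r" "r < 1"
  shows "log_mean f r \<le> L"
proof -
  have "eventually (\<lambda>s::real. s \<in> {r<..<1}) (at_left 1)" using r by (intro eventually_at_left_real) auto
  with ev have "eventually (\<lambda>s. log_mean f s \<le> L \<and> s \<in> {r<..<1}) (at_left 1)" by (rule eventually_conj)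
  then obtain s where "log_mean f s \<le> L" "r < s" "s < 1"
    using eventually_happens'[OF trivial_limit_at_left_real[of "1::real"]] by auto
  then show ?thesis using log_mean_mono[OF f r(1), of s] by simp
qed

text \<open>The logarithmic means increase with the radius, so their limit exists as soon as they are bounded.\<close>

lemma nevanlinna_iff:
  "f \<in> nevanlinna \<longleftrightarrow> f holomorphic_on ball 0 1 \<and> (\<exists>L. \<forall>r. 0 \<le> r \<longrightarrow> r < 1 \<longrightarrow> log_mean f r \<le> L)"
proof
  assume "f \<in> nevanlinna"
  then obtain L where f: "f holomorphic_on ball 0 1" and L: "L < \<infinity>" "(log_plus_mean f \<longlongrightarrow> L) (at_left 1)"
    by (auto simp: nevanlinna_def)
  obtain l where l: "L = ennreal l" "0 \<le> l" using L(1) by (cases L) auto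
  have "eventually (\<lambda>r. log_plus_mean f r < ennreal (l + 1)) (at_left 1)"
    using L(2) l by (intro order_tendstoD(2)) (auto simp: ennreal_less_iff)
  with eventually_left_1 have "eventually (\<lambda>r. log_mean f r \<le> l + 1) (at_left 1)"
  proof eventually_elim
    case (elim r)
    then have "ennreal (log_mean f r) < ennreal (l + 1)" by (simp add: log_plus_mean_eq[OF f])
    then have "log_mean f r < l + 1" using l by (simp only: ennreal_less_iff[OF log_mean_nonneg])
    then show ?case by simp
  qed
  then show "f holomorphic_on ball 0 1 \<and> (\<exists>L. \<forall>r. 0 \<le> r \<longrightarrow> r < 1 \<longrightarrow> log_mean f r \<le> L)"
    using f log_mean_bounded_eventually[OF f] by blast
next
  assume "f holomorphic_on ball 0 1 \<and> (\<exists>L. \<forall>r. 0 \<le> r \<longrightarrow> r < 1 \<longrightarrow> log_mean f r \<le> L)"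
  then obtain L where f: "f holomorphic_on ball 0 1" and L: "\<And>r. 0 \<le> r \<Longrightarrow> r < 1 \<Longrightarrow> log_mean f r \<le> L" by auto
  define M where "M = (SUP r\<in>{0..<1}. log_mean f r)"
  have bdd: "bdd_above (log_mean f ` {0..<1})" using L by (intro bdd_aboveI2[of _ _ L]) auto
  have "(log_mean f \<longlongrightarrow> M) (at_left 1)"
  proof (rule order_tendstoI)
    fix a assume "a < M"
    then obtain r where r: "r \<in> {0..<1}" "a < log_mean f r"
      unfolding M_def using less_cSUP_iff[OF _ bdd] by auto
    have "eventually (\<lambda>s::real. s \<in> {r<..<1}) (at_left 1)" using r by (intro eventually_at_left_real) auto
    then show "eventually (\<lambda>s. a < log_mean f s) (at_left 1)"
      by eventually_elim (use r log_mean_mono[OF f] in \<open>force intro: less_le_trans\<close>)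
  next
    fix a assume a: "M < a"
    show "eventually (\<lambda>s. log_mean f s < a) (at_left 1)"
      using eventually_left_1
    proof eventually_elim
      case (elim s)
      have "log_mean f s \<le> M" unfolding M_def using elim by (intro cSUP_upper bdd) auto
      then show ?case using a by simp
    qed
  qed
  then have "((\<lambda>r. ennreal (log_mean f r)) \<longlongrightarrow> ennreal M) (at_left 1)" by (rule tendsto_ennrealI)
  moreover have "eventually (\<lambda>r. ennreal (log_mean f r) = log_plus_mean f r) (at_left 1)"
    using eventually_left_1 by eventually_elim (simp add: log_plus_mean_eq[OF f])
  ultimately have "(log_plus_mean f \<longlongrightarrow> ennreal M) (at_left 1)" by (rule Lim_transform_eventually)
  then show "f \<in> nevanlinna" using f by (auto simp: nevanlinna_def intro!: exI[of _ "ennreal M"])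
qed

section \<open>Fatou's theorem in the Nevanlinna class\<close>

text \<open>Bounds that grow with the modulus only are bounds on compact sets.\<close>

lemma Montel_radial_bound:
  fixes k :: "nat \<Rightarrow> complex \<Rightarrow> complex" and b :: "real \<Rightarrow> real"
  assumes k: "\<And>n. k n holomorphic_on ball 0 1"
    and b: "\<And>n z. z \<in> ball 0 1 \<Longrightarrow> norm (k n z) \<le> b (norm z)"
    and mono: "\<And>x y. 0 \<le> x \<Longrightarrow> x \<le> y \<Longrightarrow> y < 1 \<Longrightarrow> b x \<le> b y"
  obtains g \<kappa> where "g holomorphic_on ball 0 1" "strict_mono (\<kappa> :: nat \<Rightarrow> nat)"
    "\<And>z. z \<in> ball 0 1 \<Longrightarrow> (\<lambda>n. k (\<kappa> n) z) \<longlonglongrightarrow> g z"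
proof (rule Montel[of "ball 0 1" "range k" k])
  show "h holomorphic_on ball 0 1" if "h \<in> range k" for h using that k by auto
  fix K :: "complex set" assume K: "compact K" "K \<subseteq> ball 0 1"
  show "\<exists>B. \<forall>h\<in>range k. \<forall>z\<in>K. norm (h z) \<le> B"
  proof (cases "K = {}")
    case False
    obtain x where x: "x \<in> K" "\<And>y. y \<in> K \<Longrightarrow> norm y \<le> norm x"
      using continuous_attains_sup[OF K(1) False, of norm] by (auto intro: continuous_intros)
    have "norm x < 1" using x K by auto
    then have "norm (k n z) \<le> b (norm x)" if "z \<in> K" for n z
      using b[of z n] mono[of "norm z" "norm x"] x(2)[OF that] that K by force
    then show ?thesis by blast
  qed auto
qed (use that in auto)

text \<open>The Herglotz integrals of \<open>log\<^sup>+|f|\<close> over circles of increasing radius form a normal family, as the means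
  are bounded; \<open>F\<close> is a limit function.\<close>

lemma log_plus_harmonic_majorant:
  assumes f: "f holomorphic_on ball 0 1" and L: "\<And>r. 0 \<le> r \<Longrightarrow> r < 1 \<Longrightarrow> log_mean f r \<le> L"
  obtains F where "F holomorphic_on ball 0 1" "\<And>z. z \<in> ball 0 1 \<Longrightarrow> log_plus (norm (f z)) \<le> Re (F z)"
proof -
  define \<F> where "\<F> n = herglotz (log_circle f (radii n))" for n
  have int: "integrable ang (log_circle f (radii n))" for n
    using radii[of n] by (intro integrable_log_circle f) auto
  have bd: "norm (\<F> n z) \<le> 2 / (1 - norm z) * L" if z: "z \<in> ball 0 1" for n z
  proof -
    have "norm (\<F> n z) \<le> 2 / (1 - norm z) * (\<integral>t. \<bar>log_circle f (radii n) t\<bar> \<partial>ang)"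
      unfolding \<F>_def by (rule herglotz_bound[OF z int])
    also have "(\<integral>t. \<bar>log_circle f (radii n) t\<bar> \<partial>ang) = log_mean f (radii n)" by (simp add: log_mean_def)
    also have "2 / (1 - norm z) * log_mean f (radii n) \<le> 2 / (1 - norm z) * L"
      using z L[of "radii n"] radii[of n] by (intro mult_left_mono) auto
    finally show ?thesis .
  qed
  have L0: "0 \<le> L" using L[of 0] log_mean_nonneg[of f 0] by simp
  obtain g k where g: "g holomorphic_on ball 0 1" and k: "strict_mono (k :: nat \<Rightarrow> nat)"
    and lim: "\<And>x. x \<in> ball 0 1 \<Longrightarrow> (\<lambda>n. \<F> (k n) x) \<longlonglongrightarrow> g x"
  proof (rule Montel_radial_bound[of \<F> "\<lambda>x. 2 / (1 - x) * L"])
    show "\<F> n holomorphic_on ball 0 1" for n unfolding \<F>_def by (rule holomorphic_herglotz[OF int])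
    show "2 / (1 - x) * L \<le> 2 / (1 - y) * L" if "0 \<le> x" "x \<le> y" "y < 1" for x y :: real
      using that L0 by (intro mult_right_mono divide_left_mono) auto
  qed (use bd that in auto)
  have "log_plus (norm (f z)) \<le> Re (g z)" if z: "z \<in> ball 0 1" for z
  proof (rule LIMSEQ_le)
    show "(\<lambda>n. Re (\<F> (k n) z)) \<longlonglongrightarrow> Re (g z)" by (intro tendsto_Re lim z)
    have "isCont f z" using holomorphic_on_imp_continuous_on[OF f] z continuous_on_interior[of "ball 0 1" f z] by simp
    moreover have "(\<lambda>n. of_real (radii (k n)) * z) \<longlonglongrightarrow> of_real 1 * z"
      using LIMSEQ_subseq_LIMSEQ[OF radii_tendsto k] by (intro tendsto_intros) (simp add: o_def)
    ultimately have "(\<lambda>n. f (of_real (radii (k n)) * z)) \<longlonglongrightarrow> f z" by (intro isCont_tendsto_compose[of z f]) auto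
    then show "(\<lambda>n. log_plus (norm (f (of_real (radii (k n)) * z)))) \<longlonglongrightarrow> log_plus (norm (f z))"
      by (intro isCont_tendsto_compose[OF isCont_log_plus] tendsto_norm)
    have "log_plus (norm (f (of_real (radii (k n)) * z))) \<le> Re (\<F> (k n) z)" for n
      unfolding \<F>_def Re_herglotz[OF z int] using radii[of "k n"] by (intro log_circle_le_Poisson f z) auto
    then show "\<exists>N. \<forall>n\<ge>N. log_plus (norm (f (of_real (radii (k n)) * z))) \<le> Re (\<F> (k n) z)" by blast
  qed
  from that[OF g this] show ?thesis .
qed

lemma mean_value_Re:
  assumes "F holomorphic_on ball 0 1" "0 \<le> r" "r < 1"
  shows "(\<integral>t. Re (F (of_real r * cis t)) \<partial>ang) = Re (F 0)" "integrable ang (\<lambda>t. Re (F (of_real r * cis t)))"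
proof -
  have c: "continuous_on UNIV (\<lambda>t. F (of_real r * cis t))"
    by (intro continuous_on_circle assms holomorphic_on_imp_continuous_on)
  have "(\<integral>t. F (of_real r * cis t) \<partial>ang) = F 0"
    using Poisson_formula[OF dilation[OF assms], of 0] by (simp add: poisson_def)
  then show "(\<integral>t. Re (F (of_real r * cis t)) \<partial>ang) = Re (F 0)"
    using integral_Re[OF integrable_ang_cont[OF c]] by simp
  show "integrable ang (\<lambda>t. Re (F (of_real r * cis t)))" by (intro integrable_ang_cont continuous_intros c)
qed

text \<open>Fatou's lemma and the mean value property show that the lower limit of \<open>Re F\<close> is integrable, hence finite
  almost everywhere, whereas it would be infinite where \<open>exp (- F)\<close> tends to 0.\<close>

lemma radial_limit_exp_nonzero:
  assumes F: "F holomorphic_on ball 0 1" and F0: "\<And>z. z \<in> ball 0 1 \<Longrightarrow> 0 \<le> Re (F z)"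
  shows "AE t in ang. \<not> (\<lambda>n. exp (- F (of_real (radii n) * cis t))) \<longlonglongrightarrow> 0"
proof -
  define u where "u n t = ennreal (Re (F (of_real (radii n) * cis t)))" for n t
  have pos: "0 \<le> Re (F (of_real (radii n) * cis t))" for n t
    using radii[of n] by (intro F0) (simp add: norm_mult)
  have um: "u n \<in> borel_measurable ang" for n
    unfolding u_def using radii[of n] mean_value_Re(2)[OF F, of "radii n"] by (intro measurable_compose[OF _ measurable_ennreal]) auto
  have "(\<integral>\<^sup>+t. liminf (\<lambda>n. u n t) \<partial>ang) \<le> liminf (\<lambda>n. \<integral>\<^sup>+t. u n t \<partial>ang)"
    by (rule nn_integral_liminf) (rule um)
  also have "(\<lambda>n. \<integral>\<^sup>+t. u n t \<partial>ang) = (\<lambda>n. ennreal (Re (F 0)))"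
  proof
    fix n
    have "(\<integral>\<^sup>+t. u n t \<partial>ang) = ennreal (\<integral>t. Re (F (of_real (radii n) * cis t)) \<partial>ang)"
      unfolding u_def using radii[of n] pos by (intro nn_integral_eq_integral mean_value_Re F) auto
    then show "(\<integral>\<^sup>+t. u n t \<partial>ang) = ennreal (Re (F 0))" using mean_value_Re(1)[OF F, of "radii n"] radii[of n] by simp
  qed
  also have "liminf (\<lambda>n. ennreal (Re (F 0))) = ennreal (Re (F 0))" by (simp add: Liminf_const)
  finally have "(\<integral>\<^sup>+t. liminf (\<lambda>n. u n t) \<partial>ang) \<noteq> \<infinity>" by (auto simp: top_unique)
  moreover have "(\<lambda>t. liminf (\<lambda>n. u n t)) \<in> borel_measurable ang" using um by measurable
  ultimately have "AE t in ang. liminf (\<lambda>n. u n t) \<noteq> \<infinity>" by (intro nn_integral_noteq_infinite)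
  then show ?thesis
  proof eventually_elim
    case (elim t)
    show ?case
    proof
      assume lim: "(\<lambda>n. exp (- F (of_real (radii n) * cis t))) \<longlonglongrightarrow> 0"
      have "ennreal (real c) \<le> liminf (\<lambda>n. u n t)" for c
      proof (rule Liminf_bounded)
        have "eventually (\<lambda>n. dist (exp (- F (of_real (radii n) * cis t))) 0 < exp (- real c)) sequentially"
          using lim by (rule tendstoD) simp
        then show "eventually (\<lambda>n. ennreal (real c) \<le> u n t) sequentially"
          by eventually_elim (auto simp: u_def norm_exp_eq_Re intro!: ennreal_leI)
      qed
      then have le: "of_nat c \<le> liminf (\<lambda>n. u n t)" for c by (simp add: ennreal_of_nat_eq_real_of_nat)
      obtain c where "liminf (\<lambda>n. u n t) < of_nat c"
        using elim ennreal_Ex_less_of_nat[of "liminf (\<lambda>n. u n t)"] by (auto simp: less_top[symmetric])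
      with le[of c] show False by simp
    qed
  qed
qed

text \<open>With \<open>F\<close> as in the lemma on harmonic majorants, \<open>f\<close> is the quotient of the bounded functions \<open>f * exp (- F)\<close>
  and \<open>exp (- F)\<close>, and the boundary values of the denominator vanish almost nowhere.\<close>

lemma Fatou_nevanlinna:
  assumes f: "f holomorphic_on ball 0 1" and L: "\<And>r. 0 \<le> r \<Longrightarrow> r < 1 \<Longrightarrow> log_mean f r \<le> L"
  shows "AE t in ang. \<exists>l. has_nt_limit f l (cis t)"
proof -
  obtain F where F: "F holomorphic_on ball 0 1" and FR: "\<And>z. z \<in> ball 0 1 \<Longrightarrow> log_plus (norm (f z)) \<le> Re (F z)"
    using log_plus_harmonic_majorant[OF f L] by metis
  have F0: "0 \<le> Re (F z)" if "z \<in> ball 0 1" for z using order_trans[OF log_plus_nonneg FR[OF that]] .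
  define h where "h z = exp (- F z)" for z
  define g where "g z = f z * h z" for z
  have hh: "h holomorphic_on ball 0 1" unfolding h_def by (intro holomorphic_intros F)
  have gh: "g holomorphic_on ball 0 1" unfolding g_def by (intro holomorphic_intros f hh)
  have h1: "norm (h z) \<le> 1" if "z \<in> ball 0 1" for z using F0[OF that] by (simp add: h_def norm_exp_eq_Re)
  have g1: "norm (g z) \<le> 1" if z: "z \<in> ball 0 1" for z
  proof -
    have "norm (f z) \<le> exp (Re (F z))" using FR[OF z] F0[OF z] by (simp add: log_plus_le_iff)
    then have "norm (g z) \<le> exp (Re (F z)) * exp (- Re (F z))"
      unfolding g_def h_def norm_mult norm_exp_eq_Re by (intro mult_mono) auto
    then show ?thesis by (simp flip: exp_add)
  qed
  have circ_ang: "AE t in ang. P (cis t)" if "AE \<zeta> in circ. P \<zeta>" for P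
    using that unfolding circ_def by (rule AE_distrD[rotated]) simp
  have "AE t in ang. \<exists>l. has_nt_limit h l (cis t)" by (intro circ_ang bounded_nt_limit hh h1)
  moreover have "AE t in ang. \<exists>l. has_nt_limit g l (cis t)" by (intro circ_ang bounded_nt_limit gh g1)
  moreover have "AE t in ang. \<not> (\<lambda>n. exp (- F (of_real (radii n) * cis t))) \<longlonglongrightarrow> 0"
    by (intro radial_limit_exp_nonzero F F0)
  ultimately show ?thesis
  proof eventually_elim
    case (elim t)
    then obtain lh lg where lh: "has_nt_limit h lh (cis t)" and lg: "has_nt_limit g lg (cis t)" by blast
    have "(\<lambda>n. h (of_real (radii n) * cis t)) \<longlonglongrightarrow> lh"
      using filterlim_compose[OF has_nt_limit_radial[OF lh] radii_at_left] by simp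
    then have lh0: "lh \<noteq> 0" using elim(3) by (auto simp: h_def)
    have "has_nt_limit f (lg / lh) (cis t)"
      unfolding has_nt_limit_def
    proof (intro allI impI)
      fix \<alpha> :: real assume "1 \<le> \<alpha>"
      then have "((\<lambda>z. g z / h z) \<longlongrightarrow> lg / lh) (at (cis t) within stolz \<alpha> (cis t))"
        using lh lg lh0 by (intro tendsto_divide) (auto simp: has_nt_limit_def)
      moreover have "(\<lambda>z. g z / h z) = f" by (auto simp: g_def h_def)
      ultimately show "(f \<longlongrightarrow> lg / lh) (at (cis t) within stolz \<alpha> (cis t))" by simp
    qed
    then show ?case by blast
  qed
qed

text \<open>The boundary function in the definition of the Smirnov class is given by a description operator; \<open>W\<close> is a
  measurable version of the positive logarithm of its modulus.\<close>

lemma boundary_log_plus: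
  assumes f: "f holomorphic_on ball 0 1" and L: "\<And>r. 0 \<le> r \<Longrightarrow> r < 1 \<Longrightarrow> log_mean f r \<le> L"
  obtains W where "integrable ang W" "\<And>t. 0 \<le> W t"
    "AE t in ang. ((\<lambda>r. log_circle f r t) \<longlongrightarrow> W t) (at_left 1)"
    "ennreal (1 / (2 * pi)) * (\<integral>\<^sup>+ t \<in> {0..2 * pi}. ennreal (log_plus (norm (nt_boundary f (cis t)))) \<partial>lebesgue)
      = ennreal (\<integral>t. W t \<partial>ang)"
proof -
  define W where "W t = max 0 (lim (\<lambda>n. log_circle f (radii n) t))" for t
  have vm [measurable]: "log_circle f (radii n) \<in> borel_measurable borel" for n
    using radii[of n] by (intro borel_measurable_continuous_onI continuous_log_circle f) auto
  have Wm [measurable]: "W \<in> borel_measurable borel" unfolding W_def by measurable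
  have "AE t in ang. \<exists>l. has_nt_limit f l (cis t)" by (rule Fatou_nevanlinna[OF f L])
  then have lim: "AE t in ang. ((\<lambda>r. log_circle f r t) \<longlongrightarrow> log_plus (norm (nt_boundary f (cis t)))) (at_left 1)"
  proof eventually_elim
    case (elim t)
    then obtain l where l: "has_nt_limit f l (cis t)" by blast
    have "nt_boundary f (cis t) = l" by (rule nt_boundary_eq[OF l]) simp
    then show ?case unfolding log_circle_def
      using has_nt_limit_radial[OF l] by (auto intro!: isCont_tendsto_compose[OF isCont_log_plus] tendsto_norm)
  qed
  then have Weq: "AE t in ang. W t = log_plus (norm (nt_boundary f (cis t)))"
  proof eventually_elim
    case (elim t)
    have "(\<lambda>n. log_circle f (radii n) t) \<longlonglongrightarrow> log_plus (norm (nt_boundary f (cis t)))"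
      by (rule filterlim_compose[OF elim radii_at_left])
    then have "lim (\<lambda>n. log_circle f (radii n) t) = log_plus (norm (nt_boundary f (cis t)))" by (rule limI)
    then show ?case by (simp add: W_def)
  qed
  have 2: "AE t in ang. ((\<lambda>r. log_circle f r t) \<longlongrightarrow> W t) (at_left 1)"
    using lim Weq by eventually_elim simp
  have "(\<integral>\<^sup>+t. ennreal (W t) \<partial>ang) \<le> ennreal L"
  proof -
    have "(\<integral>\<^sup>+t. ennreal (W t) \<partial>ang) = (\<integral>\<^sup>+t. liminf (\<lambda>n. ennreal (log_circle f (radii n) t)) \<partial>ang)"
    proof (rule nn_integral_cong_AE)
      show "AE t in ang. ennreal (W t) = liminf (\<lambda>n. ennreal (log_circle f (radii n) t))"
        using 2
      proof eventually_elim
        case (elim t)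
        have "(\<lambda>n. ennreal (log_circle f (radii n) t)) \<longlonglongrightarrow> ennreal (W t)"
          by (intro tendsto_ennrealI filterlim_compose[OF elim radii_at_left])
        then show ?case by (simp add: lim_imp_Liminf)
      qed
    qed
    also have "\<dots> \<le> liminf (\<lambda>n. \<integral>\<^sup>+t. ennreal (log_circle f (radii n) t) \<partial>ang)"
      by (rule nn_integral_liminf) measurable
    also have "\<dots> \<le> liminf (\<lambda>n. ennreal L)"
    proof (intro Liminf_mono always_eventually allI)
      fix n
      have "(\<integral>\<^sup>+t. ennreal (log_circle f (radii n) t) \<partial>ang) = ennreal (log_mean f (radii n))"
        unfolding log_mean_def using radii[of n] by (intro nn_integral_eq_integral integrable_log_circle f) auto
      also have "\<dots> \<le> ennreal L" using L[of "radii n"] radii[of n] by (intro ennreal_leI) auto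
      finally show "(\<integral>\<^sup>+t. ennreal (log_circle f (radii n) t) \<partial>ang) \<le> ennreal L" .
    qed
    finally show ?thesis by (simp add: Liminf_const)
  qed
  then have fin: "(\<integral>\<^sup>+t. ennreal (W t) \<partial>ang) < \<infinity>" by (auto simp: top_unique less_top[symmetric])
  have W0: "0 \<le> W t" for t by (simp add: W_def)
  have int: "integrable ang W"
    using fin W0 by (intro integrableI_nonneg) auto
  have 3: "ennreal (1 / (2 * pi)) * (\<integral>\<^sup>+ t \<in> {0..2 * pi}. ennreal (log_plus (norm (nt_boundary f (cis t)))) \<partial>lebesgue)
      = ennreal (\<integral>t. W t \<partial>ang)"
  proof -
    have "AE t in lborel. t \<in> {0..2*pi} \<longrightarrow> W t = log_plus (norm (nt_boundary f (cis t)))"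
      using Weq unfolding ang_def by (subst (asm) AE_uniform_measure) auto
    then have "AE t in lebesgue. t \<in> {0..2*pi} \<longrightarrow> W t = log_plus (norm (nt_boundary f (cis t)))"
      by (rule AE_completion)
    then have "(\<integral>\<^sup>+ t \<in> {0..2 * pi}. ennreal (log_plus (norm (nt_boundary f (cis t)))) \<partial>lebesgue)
        = (\<integral>\<^sup>+ t \<in> {0..2 * pi}. ennreal (W t) \<partial>lebesgue)"
      by (intro nn_integral_cong_AE) (auto simp: indicator_def elim: eventually_mono)
    also have "\<dots> = (\<integral>\<^sup>+ t \<in> {0..2 * pi}. ennreal (W t) \<partial>lborel)" by (simp add: nn_integral_completion)
    finally have "ennreal (1 / (2 * pi)) * (\<integral>\<^sup>+ t \<in> {0..2 * pi}. ennreal (log_plus (norm (nt_boundary f (cis t)))) \<partial>lebesgue)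
        = (\<integral>\<^sup>+t. ennreal (W t) \<partial>ang)" by (simp add: nn_integral_ang)
    also have "\<dots> = ennreal (\<integral>t. W t \<partial>ang)" using W0 by (intro nn_integral_eq_integral int) auto
    finally show ?thesis .
  qed
  from that[OF int W0 2 3] show ?thesis .
qed

section \<open>The Smirnov class and uniform integrability\<close>

text \<open>Uniform integrability of \<open>log\<^sup>+|f|\<close> over circles, in terms of the excess over a constant. The positive part
  of \<open>x + y - (K + L)\<close> is at most the sum of those of \<open>x - K\<close> and \<open>y - L\<close>, so the condition passes to
  products at once.\<close>

definition log_uniformly_integrable :: "(complex \<Rightarrow> complex) \<Rightarrow> bool" where
  "log_uniformly_integrable f \<longleftrightarrow>
     (\<forall>e>0. \<exists>K\<ge>0. eventually (\<lambda>r. (\<integral>t. max 0 (log_circle f r t - K) \<partial>ang) \<le> e) (at_left 1))"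

lemma integrable_truncations:
  fixes v :: "real \<Rightarrow> real"
  assumes "integrable ang v"
  shows "integrable ang (\<lambda>t. max 0 (v t - K))" "integrable ang (\<lambda>t. min (v t) K)"
    "(\<integral>t. v t \<partial>ang) = (\<integral>t. min (v t) K \<partial>ang) + (\<integral>t. max 0 (v t - K) \<partial>ang)"
proof -
  show a: "integrable ang (\<lambda>t. max 0 (v t - K))" "integrable ang (\<lambda>t. min (v t) K)"
    using assms by auto
  have "(\<integral>t. v t \<partial>ang) = (\<integral>t. min (v t) K + max 0 (v t - K) \<partial>ang)"
    by (intro Bochner_Integration.integral_cong) auto
  also have "\<dots> = (\<integral>t. min (v t) K \<partial>ang) + (\<integral>t. max 0 (v t - K) \<partial>ang)"
    by (rule Bochner_Integration.integral_add[OF a(2,1)])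
  finally show "(\<integral>t. v t \<partial>ang) = (\<integral>t. min (v t) K \<partial>ang) + (\<integral>t. max 0 (v t - K) \<partial>ang)" .
qed

lemma truncation_tail:
  fixes W :: "real \<Rightarrow> real"
  assumes W: "integrable ang W" and e: "0 < e"
  obtains K where "K \<ge> K0" "0 \<le> K" "(\<integral>t. max 0 (W t - K) \<partial>ang) \<le> e"
proof -
  have "(\<lambda>n. \<integral>t. max 0 (W t - real n) \<partial>ang) \<longlonglongrightarrow> (\<integral>t. 0 \<partial>ang)"
  proof (rule integral_dominated_convergence[where w = "\<lambda>t. \<bar>W t\<bar>"])
    show "AE t in ang. (\<lambda>n. max 0 (W t - real n)) \<longlonglongrightarrow> 0"
    proof (rule AE_I2)
      fix t
      obtain N where N: "W t \<le> real N" using real_arch_simple by blast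
      have "eventually (\<lambda>n. 0 = max 0 (W t - real n)) sequentially"
        using eventually_ge_at_top[of N] by eventually_elim (use N in auto)
      then show "(\<lambda>n. max 0 (W t - real n)) \<longlonglongrightarrow> 0" by (rule Lim_transform_eventually[OF tendsto_const])
    qed
  qed (use W in auto)
  then have "eventually (\<lambda>n. (\<integral>t. max 0 (W t - real n) \<partial>ang) < e) sequentially"
    using e by (intro order_tendstoD(2)) auto
  moreover have "eventually (\<lambda>n. real n \<ge> K0) sequentially"
    using filterlim_real_sequentially by (simp add: filterlim_at_top)
  ultimately have "eventually (\<lambda>n. (\<integral>t. max 0 (W t - real n) \<partial>ang) < e \<and> real n \<ge> K0) sequentially"
    by (rule eventually_conj)
  then obtain n where "(\<integral>t. max 0 (W t - real n) \<partial>ang) < e" "real n \<ge> K0" by (auto simp: eventually_sequentially)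
  then show ?thesis by (intro that[of "real n"]) auto
qed

lemma tendsto_truncated_mean:
  assumes f: "f holomorphic_on ball 0 1" and W: "integrable ang W"
    and lim: "AE t in ang. ((\<lambda>r. log_circle f r t) \<longlongrightarrow> W t) (at_left 1)" and K: "0 \<le> K"
  shows "((\<lambda>r. \<integral>t. min (log_circle f r t) K \<partial>ang) \<longlongrightarrow> (\<integral>t. min (W t) K \<partial>ang)) (at_left 1)"
proof (rule tendsto_at_left_sequentially[where b = 0])
  fix S :: "nat \<Rightarrow> real"
  assume S: "\<And>n. S n < 1" "\<And>n. 0 < S n" "S \<longlonglongrightarrow> 1"
  have SL: "filterlim S (at_left 1) sequentially"
    unfolding filterlim_at using S by (auto intro!: always_eventually simp: less_imp_neq)
  show "(\<lambda>n. \<integral>t. min (log_circle f (S n) t) K \<partial>ang) \<longlonglongrightarrow> (\<integral>t. min (W t) K \<partial>ang)"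
  proof (rule integral_dominated_convergence[where w = "\<lambda>_. K"])
    show "(\<lambda>t. min (W t) K) \<in> borel_measurable ang" using integrable_truncations(2)[OF W] by (rule borel_measurable_integrable)
    show "(\<lambda>t. min (log_circle f (S n) t) K) \<in> borel_measurable ang" for n
      using S(1,2)[of n] by (intro borel_measurable_integrable integrable_truncations integrable_log_circle f) (auto simp: less_imp_le)
    show "AE t in ang. (\<lambda>n. min (log_circle f (S n) t) K) \<longlonglongrightarrow> min (W t) K"
      using lim by eventually_elim (intro tendsto_min tendsto_const filterlim_compose[OF _ SL])
    show "AE t in ang. norm (min (log_circle f (S n) t) K) \<le> K" for n
      using K by (intro AE_I2) auto
  qed simp
qed simp

lemma smirnov_iff_mean:
  assumes f: "f holomorphic_on ball 0 1" and L: "\<And>r. 0 \<le> r \<Longrightarrow> r < 1 \<Longrightarrow> log_mean f r \<le> L"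
    and W: "\<And>t. 0 \<le> W t"
      "ennreal (1 / (2 * pi)) * (\<integral>\<^sup>+ t \<in> {0..2 * pi}. ennreal (log_plus (norm (nt_boundary f (cis t)))) \<partial>lebesgue)
        = ennreal (\<integral>t. W t \<partial>ang)"
  shows "f \<in> smirnov \<longleftrightarrow> (log_mean f \<longlongrightarrow> (\<integral>t. W t \<partial>ang)) (at_left 1)"
proof -
  have "f \<in> nevanlinna" using f L unfolding nevanlinna_iff by blast
  then have "f \<in> smirnov \<longleftrightarrow> (log_plus_mean f \<longlongrightarrow> ennreal (\<integral>t. W t \<partial>ang)) (at_left 1)"
    by (simp add: smirnov_def W(2))
  also have "\<dots> \<longleftrightarrow> ((\<lambda>r. ennreal (log_mean f r)) \<longlongrightarrow> ennreal (\<integral>t. W t \<partial>ang)) (at_left 1)"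
    by (intro tendsto_cong eventually_mono[OF eventually_left_1]) (simp add: log_plus_mean_eq[OF f])
  also have "\<dots> \<longleftrightarrow> (log_mean f \<longlongrightarrow> (\<integral>t. W t \<partial>ang)) (at_left 1)"
    using W(1) by (intro tendsto_ennreal_iff always_eventually allI log_mean_nonneg integral_nonneg_AE AE_I2)
  finally show ?thesis .
qed

text \<open>Truncated means converge by dominated convergence. Hence convergence of the full means to the mean of the
  boundary function is the same as smallness of the excess over a large constant.\<close>

lemma smirnov_iff:
  "f \<in> smirnov \<longleftrightarrow> f holomorphic_on ball 0 1 \<and> log_uniformly_integrable f"
proof
  assume S: "f \<in> smirnov"
  then have "f \<in> nevanlinna" by (simp add: smirnov_def)
  then obtain L where f: "f holomorphic_on ball 0 1" and L: "\<And>r. 0 \<le> r \<Longrightarrow> r < 1 \<Longrightarrow> log_mean f r \<le> L"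
    unfolding nevanlinna_iff by blast
  from boundary_log_plus[OF f L] obtain W where W: "integrable ang W" "\<And>t. 0 \<le> W t"
    and lim: "AE t in ang. ((\<lambda>r. log_circle f r t) \<longlongrightarrow> W t) (at_left 1)"
    and eq: "ennreal (1 / (2 * pi)) * (\<integral>\<^sup>+ t \<in> {0..2 * pi}. ennreal (log_plus (norm (nt_boundary f (cis t)))) \<partial>lebesgue)
      = ennreal (\<integral>t. W t \<partial>ang)"
    by blast
  have mlim: "(log_mean f \<longlongrightarrow> (\<integral>t. W t \<partial>ang)) (at_left 1)"
    using S smirnov_iff_mean[OF f L W(2) eq] by simp
  have "log_uniformly_integrable f"
    unfolding log_uniformly_integrable_def
  proof (intro allI impI)
    fix e :: real assume e: "0 < e"
    obtain K where K: "0 \<le> K" "(\<integral>t. max 0 (W t - K) \<partial>ang) \<le> e / 2"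
      using truncation_tail[OF W(1), of "e / 2" 0] e by auto
    have "((\<lambda>r. log_mean f r - (\<integral>t. min (log_circle f r t) K \<partial>ang)) \<longlongrightarrow> (\<integral>t. W t \<partial>ang) - (\<integral>t. min (W t) K \<partial>ang)) (at_left 1)"
      by (intro tendsto_diff mlim tendsto_truncated_mean f W(1) lim K(1))
    moreover have "(\<integral>t. W t \<partial>ang) - (\<integral>t. min (W t) K \<partial>ang) < e"
      using integrable_truncations(3)[OF W(1), of K] K(2) e by simp
    ultimately have "eventually (\<lambda>r. log_mean f r - (\<integral>t. min (log_circle f r t) K \<partial>ang) < e) (at_left 1)"
      by (rule order_tendstoD)
    with eventually_left_1 have "eventually (\<lambda>r. (\<integral>t. max 0 (log_circle f r t - K) \<partial>ang) \<le> e) (at_left 1)"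
    proof eventually_elim
      case (elim r)
      then have "integrable ang (log_circle f r)" by (intro integrable_log_circle f) auto
      from integrable_truncations(3)[OF this, of K] elim show ?case by (simp add: log_mean_def)
    qed
    then show "\<exists>K\<ge>0. eventually (\<lambda>r. (\<integral>t. max 0 (log_circle f r t - K) \<partial>ang) \<le> e) (at_left 1)" using K(1) by blast
  qed
  then show "f holomorphic_on ball 0 1 \<and> log_uniformly_integrable f" using f by simp
next
  assume "f holomorphic_on ball 0 1 \<and> log_uniformly_integrable f"
  then have f: "f holomorphic_on ball 0 1" and UI: "log_uniformly_integrable f" by auto
  obtain K where K: "K \<ge> 0" "eventually (\<lambda>r. (\<integral>t. max 0 (log_circle f r t - K) \<partial>ang) \<le> 1) (at_left 1)"
    using UI unfolding log_uniformly_integrable_def by (meson zero_less_one)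
  have "eventually (\<lambda>r. log_mean f r \<le> K + 1) (at_left 1)"
    using K(2) eventually_left_1
  proof eventually_elim
    case (elim r)
    then have i: "integrable ang (log_circle f r)" by (intro integrable_log_circle f) auto
    have "(\<integral>t. min (log_circle f r t) K \<partial>ang) \<le> (\<integral>t. K \<partial>ang)" by (intro integral_mono integrable_truncations i) auto
    then show ?case using integrable_truncations(3)[OF i, of K] elim by (simp add: log_mean_def)
  qed
  from log_mean_bounded_eventually[OF f this] have L: "\<And>r. 0 \<le> r \<Longrightarrow> r < 1 \<Longrightarrow> log_mean f r \<le> K + 1" .
  from boundary_log_plus[OF f L] obtain W where W: "integrable ang W" "\<And>t. 0 \<le> W t"
    and lim: "AE t in ang. ((\<lambda>r. log_circle f r t) \<longlongrightarrow> W t) (at_left 1)"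
    and eq: "ennreal (1 / (2 * pi)) * (\<integral>\<^sup>+ t \<in> {0..2 * pi}. ennreal (log_plus (norm (nt_boundary f (cis t)))) \<partial>lebesgue)
      = ennreal (\<integral>t. W t \<partial>ang)"
    by blast
  have "(log_mean f \<longlongrightarrow> (\<integral>t. W t \<partial>ang)) (at_left 1)"
  proof (rule tendstoI)
    fix e :: real assume e: "0 < e"
    then have e3: "0 < e / 3" by simp
    obtain K1 where K1: "K1 \<ge> 0" "eventually (\<lambda>r. (\<integral>t. max 0 (log_circle f r t - K1) \<partial>ang) \<le> e / 3) (at_left 1)"
      using UI e3 unfolding log_uniformly_integrable_def by blast
    obtain K where K: "K \<ge> K1" "0 \<le> K" "(\<integral>t. max 0 (W t - K) \<partial>ang) \<le> e / 3"
      by (rule truncation_tail[OF W(1) e3])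
    have "eventually (\<lambda>r. dist (\<integral>t. min (log_circle f r t) K \<partial>ang) (\<integral>t. min (W t) K \<partial>ang) < e / 3) (at_left 1)"
      by (intro tendstoD tendsto_truncated_mean f W lim K e3)
    with K1(2) eventually_left_1 show "eventually (\<lambda>r. dist (log_mean f r) (\<integral>t. W t \<partial>ang) < e) (at_left 1)"
    proof eventually_elim
      case (elim r)
      then have i: "integrable ang (log_circle f r)" by (intro integrable_log_circle f) auto
      have "(\<integral>t. max 0 (log_circle f r t - K) \<partial>ang) \<le> (\<integral>t. max 0 (log_circle f r t - K1) \<partial>ang)"
        using K by (intro integral_mono integrable_truncations i) auto
      moreover have "0 \<le> (\<integral>t. max 0 (log_circle f r t - K) \<partial>ang)" "0 \<le> (\<integral>t. max 0 (W t - K) \<partial>ang)"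
        by (intro integral_nonneg_AE AE_I2; simp)+
      ultimately show ?case
        using integrable_truncations(3)[OF i, of K] integrable_truncations(3)[OF W(1), of K] K(3) elim(1) elim(3)
        unfolding log_mean_def dist_real_def by linarith
    qed
  qed
  then show "f \<in> smirnov" using smirnov_iff_mean[OF f L W(2) eq] by simp
qed

lemma log_circle_mult: "log_circle (\<lambda>z. f z * g z) r t \<le> log_circle f r t + log_circle g r t"
  unfolding log_circle_def norm_mult by (intro log_plus_mult) auto

lemma nevanlinna_mult:
  assumes "f \<in> nevanlinna" "g \<in> nevanlinna"
  shows "(\<lambda>z. f z * g z) \<in> nevanlinna"
proof -
  obtain Lf Lg where f: "f holomorphic_on ball 0 1" "\<And>r. 0 \<le> r \<Longrightarrow> r < 1 \<Longrightarrow> log_mean f r \<le> Lf"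
    and g: "g holomorphic_on ball 0 1" "\<And>r. 0 \<le> r \<Longrightarrow> r < 1 \<Longrightarrow> log_mean g r \<le> Lg"
    using assms unfolding nevanlinna_iff by blast
  have fg: "(\<lambda>z. f z * g z) holomorphic_on ball 0 1" by (intro holomorphic_intros f g)
  have "log_mean (\<lambda>z. f z * g z) r \<le> Lf + Lg" if r: "0 \<le> r" "r < 1" for r
  proof -
    have "log_mean (\<lambda>z. f z * g z) r \<le> (\<integral>t. log_circle f r t + log_circle g r t \<partial>ang)"
      unfolding log_mean_def
      by (intro integral_mono log_circle_mult Bochner_Integration.integrable_add integrable_log_circle fg f g r)
    also have "\<dots> = log_mean f r + log_mean g r"
      unfolding log_mean_def by (intro Bochner_Integration.integral_add integrable_log_circle f g r)
    also have "\<dots> \<le> Lf + Lg" by (intro add_mono f g r)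
    finally show ?thesis .
  qed
  then show ?thesis unfolding nevanlinna_iff using fg by blast
qed

lemma smirnov_mult:
  assumes "f \<in> smirnov" "g \<in> smirnov"
  shows "(\<lambda>z. f z * g z) \<in> smirnov"
proof -
  have f: "f holomorphic_on ball 0 1" and g: "g holomorphic_on ball 0 1"
    and UI: "log_uniformly_integrable f" "log_uniformly_integrable g" using assms by (auto simp: smirnov_iff)
  have fg: "(\<lambda>z. f z * g z) holomorphic_on ball 0 1" by (intro holomorphic_intros f g)
  have "log_uniformly_integrable (\<lambda>z. f z * g z)"
    unfolding log_uniformly_integrable_def
  proof (intro allI impI)
    fix e :: real assume e: "0 < e"
    then have e2: "0 < e / 2" by simp
    obtain K1 where K1: "K1 \<ge> 0" "eventually (\<lambda>r. (\<integral>t. max 0 (log_circle f r t - K1) \<partial>ang) \<le> e / 2) (at_left 1)"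
      using UI(1) e2 unfolding log_uniformly_integrable_def by blast
    obtain K2 where K2: "K2 \<ge> 0" "eventually (\<lambda>r. (\<integral>t. max 0 (log_circle g r t - K2) \<partial>ang) \<le> e / 2) (at_left 1)"
      using UI(2) e2 unfolding log_uniformly_integrable_def by blast
    have "eventually (\<lambda>r. (\<integral>t. max 0 (log_circle (\<lambda>z. f z * g z) r t - (K1 + K2)) \<partial>ang) \<le> e) (at_left 1)"
      using K1(2) K2(2) eventually_left_1
    proof eventually_elim
      case (elim r)
      then have i: "integrable ang (log_circle f r)" "integrable ang (log_circle g r)" "integrable ang (log_circle (\<lambda>z. f z * g z) r)"
        using f g fg by (auto intro!: integrable_log_circle)
      have "(\<integral>t. max 0 (log_circle (\<lambda>z. f z * g z) r t - (K1 + K2)) \<partial>ang)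
          \<le> (\<integral>t. max 0 (log_circle f r t - K1) + max 0 (log_circle g r t - K2) \<partial>ang)"
      proof (intro integral_mono integrable_truncations Bochner_Integration.integrable_add i)
        fix t
        show "max 0 (log_circle (\<lambda>z. f z * g z) r t - (K1 + K2)) \<le> max 0 (log_circle f r t - K1) + max 0 (log_circle g r t - K2)"
          using log_circle_mult[of f g r t] by linarith
      qed
      also have "\<dots> = (\<integral>t. max 0 (log_circle f r t - K1) \<partial>ang) + (\<integral>t. max 0 (log_circle g r t - K2) \<partial>ang)"
        by (intro Bochner_Integration.integral_add integrable_truncations i)
      finally show ?case using elim by linarith
    qed
    then show "\<exists>K\<ge>0. eventually (\<lambda>r. (\<integral>t. max 0 (log_circle (\<lambda>z. f z * g z) r t - K) \<partial>ang) \<le> e) (at_left 1)"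
      using K1(1) K2(1) by (intro exI[of _ "K1 + K2"]) auto
  qed
  then show ?thesis using fg by (simp add: smirnov_iff)
qed

section \<open>Green's function and the function phi\<close>

definition pseudo_dist :: "complex \<Rightarrow> complex \<Rightarrow> real" where
  "pseudo_dist a z = norm ((a - z) / (1 - cnj a * z))"

text \<open>Green's function of the unit disc.\<close>

definition green :: "complex \<Rightarrow> complex \<Rightarrow> real" where
  "green a z = - ln (pseudo_dist a z)"

lemma one_minus_cnj_nonzero:
  assumes "norm a < 1" "norm z \<le> 1" shows "1 - cnj a * z \<noteq> 0"
proof
  assume "1 - cnj a * z = 0"
  then have "norm (cnj a * z) = 1" by (metis eq_iff_diff_eq_0 norm_one)
  moreover have "norm a * norm z \<le> norm a * 1" using assms by (intro mult_left_mono) auto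
  ultimately show False using assms by (simp add: norm_mult)
qed

lemma norm_blaschke_factor: "norm (blaschke_factor a z) = pseudo_dist a z"
  by (auto simp: blaschke_factor_def pseudo_dist_def norm_mult norm_divide)

lemma pseudo_commute: "pseudo_dist a z = pseudo_dist z a"
proof -
  have "cnj (1 - cnj a * z) = 1 - cnj z * a" by (simp add: mult.commute)
  then have "norm (1 - cnj a * z) = norm (1 - cnj z * a)" by (metis complex_mod_cnj)
  then show ?thesis by (simp add: pseudo_dist_def norm_divide norm_minus_commute)
qed

lemma green_commute: "green a z = green z a"
  by (simp add: green_def pseudo_commute)

lemma norm_diff_squared: "(norm (1 - cnj a * z))\<^sup>2 - (norm (a - z))\<^sup>2 = (1 - (norm a)\<^sup>2) * (1 - (norm z)\<^sup>2)"
  unfolding cmod_power2 by (simp add: power2_eq_square) algebra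

lemma pseudo_less_1:
  assumes "a \<in> ball 0 1" "z \<in> ball 0 1" shows "pseudo_dist a z < 1"
proof -
  have nz: "1 - cnj a * z \<noteq> 0" using assms by (intro one_minus_cnj_nonzero) auto
  have "0 < (1 - (norm a)\<^sup>2) * (1 - (norm z)\<^sup>2)"
    using assms by (intro mult_pos_pos) (auto simp: abs_square_less_1)
  then have "(norm (a - z))\<^sup>2 < (norm (1 - cnj a * z))\<^sup>2" using norm_diff_squared[of a z] by simp
  then have "norm (a - z) < norm (1 - cnj a * z)" by (rule power2_less_imp_less) simp
  then show ?thesis using nz by (simp add: pseudo_dist_def norm_divide)
qed

lemma pseudo_sphere:
  assumes "a \<in> ball 0 1" "norm z = 1" shows "pseudo_dist a z = 1"
proof -
  have nz: "1 - cnj a * z \<noteq> 0" using assms by (intro one_minus_cnj_nonzero) auto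
  have "(norm (a - z))\<^sup>2 = (norm (1 - cnj a * z))\<^sup>2" using norm_diff_squared[of a z] assms by simp
  then have "norm (a - z) = norm (1 - cnj a * z)" by (rule power2_eq_imp_eq) auto
  then show ?thesis using nz by (simp add: pseudo_dist_def norm_divide)
qed

lemma pseudo_pos:
  assumes "a \<in> ball 0 1" "z \<in> cball 0 1" "a \<noteq> z" shows "0 < pseudo_dist a z"
  using one_minus_cnj_nonzero[of a z] assms by (simp add: pseudo_dist_def norm_divide)

lemma green_nonneg:
  assumes "a \<in> ball 0 1" "z \<in> ball 0 1" shows "0 \<le> green a z"
proof (cases "a = z")
  case False
  then have "0 < pseudo_dist a z" using assms by (intro pseudo_pos) auto
  then show ?thesis unfolding green_def using pseudo_less_1[OF assms] by simp
qed (simp add: green_def pseudo_dist_def)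

text \<open>For \<open>a \<noteq> 0\<close>, \<open>b\<^sub>a z - 1 = - (1 - |a|) * (a + |a| * z) / (a * (1 - cnj a * z))\<close>.\<close>

lemma blaschke_factor_near_1:
  assumes a: "a \<in> ball 0 1" and z: "z \<in> ball 0 1"
  shows "norm (blaschke_factor a z - 1) \<le> 2 * (1 - norm a) / (1 - norm z)"
proof (cases "a = 0")
  case True
  have "norm (z - 1) \<le> 2 * 1" using norm_triangle_ineq4[of z 1] z by simp
  also have "2 * 1 \<le> 2 * (1 / (1 - norm z))" using z by (intro mult_left_mono) auto
  finally show ?thesis using True by (simp add: blaschke_factor_def)
next
  case False
  have nz: "1 - cnj a * z \<noteq> 0" using a z by (intro one_minus_cnj_nonzero) auto
  have sq: "of_real (norm a) * of_real (norm a) = a * cnj a"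
    using complex_norm_square[of a] by (simp add: power2_eq_square)
  have "blaschke_factor a z - 1 = (of_real (norm a) * (a - z) - a * (1 - cnj a * z)) / (a * (1 - cnj a * z))"
  proof -
    have "x / y - 1 = (x - y) / y" if "y \<noteq> 0" for x y :: complex using that by (simp add: diff_divide_distrib)
    from this[of "a * (1 - cnj a * z)" "of_real (norm a) * (a - z)"] show ?thesis
      using False nz by (simp add: blaschke_factor_def)
  qed
  also have "of_real (norm a) * (a - z) - a * (1 - cnj a * z) = - (1 - of_real (norm a)) * (a + of_real (norm a) * z)"
  proof -
    have "- (1 - of_real (norm a)) * (a + of_real (norm a) * z)
        = of_real (norm a) * (a - z) - a + (of_real (norm a) * of_real (norm a)) * z" by (simp add: algebra_simps)
    then show ?thesis unfolding sq by (simp only: right_diff_distrib mult_1_right mult.assoc diff_add_eq diff_diff_eq2)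
  qed
  finally have eq: "norm (blaschke_factor a z - 1) = norm (1 - complex_of_real (norm a)) * norm (a + of_real (norm a) * z) / (norm a * norm (1 - cnj a * z))"
    by (simp only: norm_divide norm_mult norm_minus_cancel)
  have 1: "norm (1 - complex_of_real (norm a)) = 1 - norm a"
  proof -
    have "1 - complex_of_real (norm a) = of_real (1 - norm a)" by simp
    then show ?thesis using a by (simp only: norm_of_real) simp
  qed
  have 2: "norm (a + of_real (norm a) * z) \<le> 2 * norm a"
  proof -
    have "norm (a + of_real (norm a) * z) \<le> norm a + norm a * norm z"
      using norm_triangle_ineq[of a "of_real (norm a) * z"] by (simp add: norm_mult)
    also have "norm a * norm z \<le> norm a * 1" using z by (intro mult_left_mono) auto
    finally show ?thesis by simp
  qed
  have 3: "1 - norm z \<le> norm (1 - cnj a * z)"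
  proof -
    have "norm (cnj a * z) \<le> norm z" using a by (simp add: norm_mult mult_left_le_one_le)
    then show ?thesis using norm_triangle_ineq2[of 1 "cnj a * z"] by simp
  qed
  have "norm (blaschke_factor a z - 1) \<le> (1 - norm a) * (2 * norm a) / (norm a * (1 - norm z))"
    unfolding eq 1 using 2 3 a z False by (intro frac_le mult_left_mono mult_pos_pos) auto
  also have "\<dots> = 2 * (1 - norm a) / (1 - norm z)" using False by simp
  finally show ?thesis .
qed

lemma summable_Ln_blaschke:
  assumes \<Lambda>: "\<Lambda> \<subseteq> ball 0 1" and sp: "\<Lambda> sparse_in ball 0 1" and sm: "(\<lambda>l. 1 - norm l) summable_on \<Lambda>"
    and z: "z \<in> ball 0 1"
  shows "(\<lambda>a. Ln (blaschke_factor a z)) summable_on \<Lambda>"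
proof -
  \<comment> \<open>For \<open>|a| > R\<close> the factor differs from 1 by less than \<open>1/2\<close>, so its logarithm can be estimated.\<close>
  define R where "R = (7 + norm z) / 8"
  have zz: "0 \<le> norm z" "norm z < 1" using z by auto
  have R: "0 < R" unfolding R_def by (intro divide_pos_pos add_pos_nonneg norm_ge_zero) auto
  have R1: "R < 1" unfolding R_def using zz by (simp add: divide_less_eq)
  have "finite (cball 0 R \<inter> \<Lambda>)"
    using R R1 by (intro sparse_in_compact_finite sparse_in_subset[OF sp]) auto
  then have 1: "(\<lambda>a. Ln (blaschke_factor a z)) summable_on (cball 0 R \<inter> \<Lambda>)" by (rule summable_on_finite)
  have "(\<lambda>a. 4 / (1 - norm z) * (1 - norm a)) summable_on (\<Lambda> - cball 0 R)"
    by (intro summable_on_cmult_right summable_on_subset[OF sm]) auto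
  then have "(\<lambda>a. norm (Ln (blaschke_factor a z))) summable_on (\<Lambda> - cball 0 R)"
  proof (rule summable_on_comparison_test)
    fix a assume a: "a \<in> \<Lambda> - cball 0 R"
    then have ab: "a \<in> ball 0 1" "norm a > R" using \<Lambda> by auto
    have le: "norm (blaschke_factor a z - 1) \<le> 2 * (1 - norm a) / (1 - norm z)"
      by (intro blaschke_factor_near_1 ab z)
    also have "\<dots> < 1 / 2" using ab z by (simp add: R_def field_simps)
    finally have "norm (Ln (1 + (blaschke_factor a z - 1))) \<le> 2 * norm (blaschke_factor a z - 1)" by (rule norm_Ln_le)
    moreover have "1 + (blaschke_factor a z - 1) = blaschke_factor a z" by simp
    moreover have "4 / (1 - norm z) * (1 - norm a) = 2 * (2 * (1 - norm a) / (1 - norm z))" by simp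
    ultimately show "norm (Ln (blaschke_factor a z)) \<le> 4 / (1 - norm z) * (1 - norm a)" using le by (metis mult_left_mono order_trans zero_le_numeral)
  qed simp
  then have 2: "(\<lambda>a. Ln (blaschke_factor a z)) summable_on (\<Lambda> - cball 0 R)" by (rule abs_summable_summable)
  have "\<Lambda> = (cball 0 R \<inter> \<Lambda>) \<union> (\<Lambda> - cball 0 R)" by auto
  then show ?thesis using summable_on_Un_disjoint[OF 1 2] by auto
qed

text \<open>The logarithms of the Blaschke factors are absolutely summable, so the finite subproducts converge to the
  exponential of the sum; only the modulus of the limit enters.\<close>

lemma phi_has_sum:
  assumes \<Lambda>: "\<Lambda> \<subseteq> ball 0 1" and sp: "\<Lambda> sparse_in ball 0 1" and sm: "(\<lambda>l. 1 - norm l) summable_on \<Lambda>"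
    and z: "z \<in> \<Lambda>"
  shows "(green z has_sum phi \<Lambda> z) (\<Lambda> - {z})"
proof -
  have zb: "z \<in> ball 0 1" using z \<Lambda> by auto
  have nz: "blaschke_factor a z \<noteq> 0" if "a \<in> \<Lambda> - {z}" for a
  proof -
    have "0 < pseudo_dist a z" using that \<Lambda> zb by (intro pseudo_pos) auto
    then show ?thesis using norm_blaschke_factor[of a z] by auto
  qed
  obtain L where L: "((\<lambda>a. Ln (blaschke_factor a z)) has_sum L) (\<Lambda> - {z})"
    using summable_on_subset[OF summable_Ln_blaschke[OF \<Lambda> sp sm zb], of "\<Lambda> - {z}"] unfolding summable_on_def by auto
  have "((\<lambda>F. exp (\<Sum>a\<in>F. Ln (blaschke_factor a z))) \<longlongrightarrow> exp L) (finite_subsets_at_top (\<Lambda> - {z}))"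
    using L unfolding has_sum_def by (intro tendsto_exp)
  moreover have "eventually (\<lambda>F. exp (\<Sum>a\<in>F. Ln (blaschke_factor a z)) = (\<Prod>a\<in>F. blaschke_factor a z)) (finite_subsets_at_top (\<Lambda> - {z}))"
  proof (rule eventually_finite_subsets_at_top_weakI)
    fix F assume F: "finite F" "F \<subseteq> \<Lambda> - {z}"
    then have "exp (\<Sum>a\<in>F. Ln (blaschke_factor a z)) = (\<Prod>a\<in>F. exp (Ln (blaschke_factor a z)))" by (intro exp_sum)
    also have "\<dots> = (\<Prod>a\<in>F. blaschke_factor a z)" by (rule prod.cong[OF refl], rule exp_Ln, rule nz) (use F in auto)
    finally show "exp (\<Sum>a\<in>F. Ln (blaschke_factor a z)) = (\<Prod>a\<in>F. blaschke_factor a z)" .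
  qed
  ultimately have "((\<lambda>F. \<Prod>a\<in>F. blaschke_factor a z) \<longlongrightarrow> exp L) (finite_subsets_at_top (\<Lambda> - {z}))"
    by (rule Lim_transform_eventually)
  then have "blaschke_product (\<Lambda> - {z}) z = exp L"
    unfolding blaschke_product_def by (intro tendsto_Lim) auto
  then have "phi \<Lambda> z = - Re L" using z by (simp add: phi_def norm_exp_eq_Re ln_inverse)
  moreover have "((\<lambda>a. - Re (Ln (blaschke_factor a z))) has_sum - Re L) (\<Lambda> - {z})"
    using has_sum_Re[OF L] by (simp add: has_sum_uminus)
  moreover have "- Re (Ln (blaschke_factor a z)) = green z a" if "a \<in> \<Lambda> - {z}" for a
    unfolding green_commute[of z a] using nz[OF that] by (simp add: green_def norm_blaschke_factor)
  then have "((\<lambda>a. - Re (Ln (blaschke_factor a z))) has_sum - Re L) (\<Lambda> - {z}) \<longleftrightarrow> (green z has_sum - Re L) (\<Lambda> - {z})"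
    by (rule has_sum_cong)
  ultimately show ?thesis by (simp only:)
qed

section \<open>Locally optimal cuts\<close>

text \<open>Take a cut of maximal weight. Moving \<open>z\<close> to the other side exchanges the weight at \<open>z\<close> across the cut with the
  weight at \<open>z\<close> within its own side, and cannot be profitable.\<close>

lemma finite_max_cut:
  fixes W :: "'a \<Rightarrow> 'a \<Rightarrow> real"
  assumes F: "finite F" and sym: "\<And>x y. W x y = W y x"
  obtains S where "S \<subseteq> F"
    "\<And>z. z \<in> F \<Longrightarrow> (\<Sum>a\<in>F - {z}. W z a) \<le> 2 * (\<Sum>a | a \<in> F - {z} \<and> (a \<in> S) \<noteq> (z \<in> S). W z a)"
proof -
  define cut where "cut S = (\<Sum>x\<in>S. \<Sum>y\<in>F - S. W x y)" for S
  have flip: "cut S - cut (S - {z}) = (\<Sum>y\<in>F - S. W z y) - (\<Sum>x\<in>S - {z}. W z x)" if S: "S \<subseteq> F" "z \<in> S" for S z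
  proof -
    have fS: "finite S" using S F finite_subset by blast
    have "cut S = (\<Sum>y\<in>F - S. W z y) + (\<Sum>x\<in>S - {z}. \<Sum>y\<in>F - S. W x y)"
      unfolding cut_def using fS S by (subst sum.remove[of S z]) auto
    moreover have "F - (S - {z}) = insert z (F - S)" using S by auto
    then have "cut (S - {z}) = (\<Sum>x\<in>S - {z}. W x z + (\<Sum>y\<in>F - S. W x y))"
      unfolding cut_def using S F by (intro sum.cong refl) simp
    then have "cut (S - {z}) = (\<Sum>x\<in>S - {z}. W z x) + (\<Sum>x\<in>S - {z}. \<Sum>y\<in>F - S. W x y)"
      by (simp add: sum.distrib sym[of z])
    ultimately show ?thesis by simp
  qed
  have "finite (cut ` Pow F)" "cut ` Pow F \<noteq> {}" using F by auto
  then have "Max (cut ` Pow F) \<in> cut ` Pow F" by (rule Max_in)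
  then obtain S where S: "S \<subseteq> F" "cut S = Max (cut ` Pow F)" by auto
  have max: "cut S' \<le> cut S" if "S' \<subseteq> F" for S' unfolding S(2) using that F by (intro Max_ge) auto
  have "(\<Sum>a\<in>F - {z}. W z a) \<le> 2 * (\<Sum>a | a \<in> F - {z} \<and> (a \<in> S) \<noteq> (z \<in> S). W z a)" if z: "z \<in> F" for z
  proof (cases "z \<in> S")
    case True
    have "(\<Sum>x\<in>S - {z}. W z x) \<le> (\<Sum>y\<in>F - S. W z y)" using flip[OF S(1) True] max[OF subset_trans[OF Diff_subset S(1)], of "{z}"] by linarith
    moreover have "F - {z} = (S - {z}) \<union> (F - S)" using S(1) True by auto
    moreover have "finite S" using S(1) F finite_subset by blast
    then have "(\<Sum>a\<in>(S - {z}) \<union> (F - S). W z a) = (\<Sum>x\<in>S - {z}. W z x) + (\<Sum>y\<in>F - S. W z y)"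
      using F by (intro sum.union_disjoint) auto
    moreover have "{a. a \<in> F - {z} \<and> (a \<in> S) \<noteq> (z \<in> S)} = F - S" using True by auto
    ultimately show ?thesis by simp
  next
    case False
    have S': "insert z S \<subseteq> F" "z \<in> insert z S" "insert z S - {z} = S" using S(1) z False by auto
    have "(\<Sum>y\<in>F - insert z S. W z y) \<le> (\<Sum>x\<in>S. W z x)" using flip[OF S'(1,2)] max[OF S'(1)] S'(3) by simp
    moreover have "F - {z} = S \<union> (F - insert z S)" using S(1) False by auto
    moreover have "finite S" using S(1) F finite_subset by blast
    then have "(\<Sum>a\<in>S \<union> (F - insert z S). W z a) = (\<Sum>x\<in>S. W z x) + (\<Sum>y\<in>F - insert z S. W z y)"
      using F by (intro sum.union_disjoint) auto
    moreover have "{a. a \<in> F - {z} \<and> (a \<in> S) \<noteq> (z \<in> S)} = S" using False S(1) by auto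
    ultimately show ?thesis by simp
  qed
  with S(1) that show ?thesis by blast
qed

text \<open>Optimal cuts of finite subsets have a subsequence that converges pointwise. The inequality at \<open>z\<close> survives in the
  limit because all but a small part of the weight at \<open>z\<close> belongs to a finite set.\<close>

lemma countable_cut:
  fixes W :: "'a \<Rightarrow> 'a \<Rightarrow> real"
  assumes \<Lambda>: "countable \<Lambda>" and sym: "\<And>x y. W x y = W y x"
    and nn: "\<And>x y. x \<in> \<Lambda> \<Longrightarrow> y \<in> \<Lambda> \<Longrightarrow> 0 \<le> W x y"
    and sm: "\<And>z. z \<in> \<Lambda> \<Longrightarrow> W z summable_on (\<Lambda> - {z})"
  obtains S where
    "\<And>z. z \<in> \<Lambda> \<Longrightarrow> infsum (W z) (\<Lambda> - {z}) \<le> 2 * infsum (W z) {a \<in> \<Lambda> - {z}. (a \<in> S) \<noteq> (z \<in> S)}"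
proof -
  define F where "F n = {x \<in> \<Lambda>. to_nat_on \<Lambda> x \<le> n}" for n
  have finF: "finite (F n)" for n
  proof -
    have "inj_on (to_nat_on \<Lambda>) (F n)" using inj_on_to_nat_on[OF \<Lambda>] by (rule inj_on_subset) (auto simp: F_def)
    moreover have "finite (to_nat_on \<Lambda> ` F n)" by (rule finite_subset[of _ "{..n}"]) (auto simp: F_def)
    ultimately show ?thesis by (simp add: finite_image_iff)
  qed
  have "\<exists>S. S \<subseteq> F n \<and> (\<forall>z\<in>F n. (\<Sum>a\<in>F n - {z}. W z a) \<le> 2 * (\<Sum>a | a \<in> F n - {z} \<and> (a \<in> S) \<noteq> (z \<in> S). W z a))" for n
  proof (rule finite_max_cut[OF finF[of n], of W])
    show "W x y = W y x" for x y by (rule sym)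
  qed blast
  then have "\<exists>S. \<forall>n. S n \<subseteq> F n \<and> (\<forall>z\<in>F n. (\<Sum>a\<in>F n - {z}. W z a) \<le> 2 * (\<Sum>a | a \<in> F n - {z} \<and> (a \<in> S n) \<noteq> (z \<in> S n). W z a))"
    by (intro choice allI)
  then obtain S where S: "\<And>n z. z \<in> F n \<Longrightarrow>
      (\<Sum>a\<in>F n - {z}. W z a) \<le> 2 * (\<Sum>a | a \<in> F n - {z} \<and> (a \<in> S n) \<noteq> (z \<in> S n). W z a)" by blast
  define f :: "nat \<Rightarrow> 'a \<Rightarrow> real" where "f n x = of_bool (x \<in> S n)" for n x
  obtain k where k: "strict_mono (k :: nat \<Rightarrow> nat)" and conv: "\<And>x. x \<in> \<Lambda> \<Longrightarrow> \<exists>l. (\<lambda>n. f (k n) x) \<longlonglongrightarrow> l"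
    by (rule function_convergent_subsequence[OF \<Lambda>, of f 1]) (auto simp: f_def)
  define T where "T = {x \<in> \<Lambda>. eventually (\<lambda>n. x \<in> S (k n)) sequentially}"
  have ev: "eventually (\<lambda>n. (x \<in> S (k n)) = (x \<in> T)) sequentially" if x: "x \<in> \<Lambda>" for x
  proof -
    obtain l where l: "(\<lambda>n. f (k n) x) \<longlonglongrightarrow> l" using conv[OF x] by auto
    then have e: "eventually (\<lambda>n. dist (f (k n) x) l < 1/2) sequentially" by (rule tendstoD) simp
    show ?thesis
    proof (cases "eventually (\<lambda>n. x \<in> S (k n)) sequentially")
      case True
      then have "x \<in> T" using x by (simp add: T_def)
      show ?thesis by (rule eventually_mono[OF True]) (simp add: \<open>x \<in> T\<close>)
    next
      case False
      then have "frequently (\<lambda>n. x \<notin> S (k n)) sequentially" by (simp add: frequently_def)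
      then have "frequently (\<lambda>n. x \<notin> S (k n) \<and> dist (f (k n) x) l < 1/2) sequentially"
        using e by (rule frequently_eventually_frequently)
      then obtain n where "x \<notin> S (k n)" "dist (f (k n) x) l < 1/2" using frequently_ex by blast
      then have "\<bar>l\<bar> < 1/2" by (simp add: f_def dist_real_def)
      then have "x \<notin> S (k n)" if "dist (f (k n) x) l < 1/2" for n
        using that by (auto simp: f_def dist_real_def abs_if split: if_splits)
      then have out: "eventually (\<lambda>n. x \<notin> S (k n)) sequentially" by (rule eventually_mono[OF e])
      have "x \<notin> T" using False by (simp add: T_def)
      then show ?thesis by (intro eventually_mono[OF out]) simp
    qed
  qed
  have "infsum (W z) (\<Lambda> - {z}) \<le> 2 * infsum (W z) {a \<in> \<Lambda> - {z}. (a \<in> T) \<noteq> (z \<in> T)}" if z: "z \<in> \<Lambda>" for z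
  proof (rule field_le_epsilon)
    let ?X = "{a \<in> \<Lambda> - {z}. (a \<in> T) \<noteq> (z \<in> T)}"
    fix e :: real assume e: "0 < e"
    have smX: "W z summable_on ?X" by (rule summable_on_subset[OF sm[OF z]]) auto
    obtain G where G: "finite G" "G \<subseteq> \<Lambda> - {z}" "dist (sum (W z) G) (infsum (W z) (\<Lambda> - {z})) \<le> e / 3"
      using has_sum_finite_approximation[OF has_sum_infsum[OF sm[OF z]], of "e / 3"] e by auto
    have "eventually (\<lambda>n. \<forall>x\<in>insert z G. (x \<in> S (k n)) = (x \<in> T)) sequentially"
      using G z ev by (intro eventually_ball_finite) auto
    moreover have "eventually (\<lambda>n. \<forall>x\<in>insert z G. x \<in> F (k n)) sequentially"
    proof (intro eventually_ball_finite ballI)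
      fix x assume "x \<in> insert z G"
      then have x: "x \<in> \<Lambda>" using G z by auto
      show "eventually (\<lambda>n. x \<in> F (k n)) sequentially"
        using eventually_ge_at_top[of "to_nat_on \<Lambda> x"]
      proof eventually_elim
        case (elim n)
        then have "to_nat_on \<Lambda> x \<le> k n" using seq_suble[OF k, of n] by simp
        then show ?case using x by (simp add: F_def)
      qed
    qed (use G in auto)
    ultimately have "eventually (\<lambda>n. (\<forall>x\<in>insert z G. (x \<in> S (k n)) = (x \<in> T)) \<and> (\<forall>x\<in>insert z G. x \<in> F (k n))) sequentially"
      by (rule eventually_conj)
    then obtain n where n: "\<forall>x\<in>insert z G. (x \<in> S (k n)) = (x \<in> T)" "\<forall>x\<in>insert z G. x \<in> F (k n)"
      by (auto simp: eventually_sequentially)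
    define H where "H = F (k n) - {z}"
    have H: "finite H" "H \<subseteq> \<Lambda> - {z}" "G \<subseteq> H" using finF n(2) G by (auto simp: H_def F_def)
    have nnz: "0 \<le> W z a" if "a \<in> \<Lambda>" for a using nn[OF z that] .
    have HT: "sum (W z) H \<le> infsum (W z) (\<Lambda> - {z})"
      using H nnz by (intro finite_sum_le_infsum sm z) auto
    have split: "sum (W z) H = sum (W z) G + sum (W z) (H - G)" using H by (simp add: sum.subset_diff[of G H])
    have "sum (W z) {a \<in> H. (a \<in> S (k n)) \<noteq> (z \<in> S (k n))} \<le> sum (W z) ({a \<in> G. (a \<in> T) \<noteq> (z \<in> T)} \<union> (H - G))"
      using H n(1) nnz by (intro sum_mono2) (use G in auto)
    also have "\<dots> = sum (W z) {a \<in> G. (a \<in> T) \<noteq> (z \<in> T)} + sum (W z) (H - G)"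
      using G H by (intro sum.union_disjoint) auto
    also have "sum (W z) {a \<in> G. (a \<in> T) \<noteq> (z \<in> T)} \<le> infsum (W z) ?X"
      using G nnz by (intro finite_sum_le_infsum smX) auto
    finally have "sum (W z) {a \<in> H. (a \<in> S (k n)) \<noteq> (z \<in> S (k n))} \<le> infsum (W z) ?X + sum (W z) (H - G)" by simp
    moreover have "sum (W z) H \<le> 2 * sum (W z) {a \<in> H. (a \<in> S (k n)) \<noteq> (z \<in> S (k n))}"
      using S[of z "k n"] n(2) by (simp add: H_def)
    moreover have "infsum (W z) (\<Lambda> - {z}) \<le> sum (W z) G + e / 3" using G(3) unfolding dist_real_def by linarith
    moreover have "sum (W z) G \<le> sum (W z) H" using H nnz by (intro sum_mono2) auto
    ultimately show "infsum (W z) (\<Lambda> - {z}) \<le> 2 * infsum (W z) ?X + e"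
      using HT split by linarith
  qed
  then show ?thesis by (rule that)
qed

section \<open>Jensen's inequality\<close>

text \<open>Division by a finite Blaschke product, which has modulus 1 on the circle.\<close>

lemma divide_out_zeros:
  assumes A: "finite A" "A \<subseteq> ball 0 1" and R: "1 < R" and g: "g holomorphic_on ball 0 R" "\<And>a. a \<in> A \<Longrightarrow> g a = 0"
  obtains h where "h holomorphic_on ball 0 R"
    "\<And>w. w \<in> cball 0 1 \<Longrightarrow> norm (g w) = norm (h w) * (\<Prod>a\<in>A. pseudo_dist a w)"
proof -
  have "\<exists>h. h holomorphic_on ball 0 R \<and> (\<forall>w\<in>cball 0 1. norm (g w) = norm (h w) * (\<Prod>a\<in>A. pseudo_dist a w))"
    using A g(2)
  proof (induction A rule: finite_induct)
    case empty then show ?case using g(1) by auto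
  next
    case (insert a A)
    then obtain h where h: "h holomorphic_on ball 0 R" "\<And>w. w \<in> cball 0 1 \<Longrightarrow> norm (g w) = norm (h w) * (\<Prod>a\<in>A. pseudo_dist a w)"
      by auto
    have a: "a \<in> ball 0 1" using insert by auto
    have "(\<Prod>b\<in>A. pseudo_dist b a) \<noteq> 0"
    proof -
      have "pseudo_dist b a \<noteq> 0" if "b \<in> A" for b using pseudo_pos[of b a] that insert a by force
      then show ?thesis using insert.hyps by simp
    qed
    then have ha: "h a = 0" using h(2)[of a] insert.prems(2)[of a] a by auto
    define h' where "h' w = (if w = a then deriv h a else (h w - h a) / (w - a)) * (1 - cnj a * w)" for w
    have "h' holomorphic_on ball 0 R" unfolding h'_def
      by (intro holomorphic_on_mult pole_lemma_open h holomorphic_intros) auto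
    moreover have "norm (g w) = norm (h' w) * (\<Prod>b\<in>insert a A. pseudo_dist b w)" if w: "w \<in> cball 0 1" for w
    proof (cases "w = a")
      case True
      then show ?thesis using h(2)[OF w] ha insert.hyps by (simp add: pseudo_dist_def)
    next
      case False
      have nz: "1 - cnj a * w \<noteq> 0" using a w by (intro one_minus_cnj_nonzero) auto
      have "norm (h w) = norm (h' w) * pseudo_dist a w"
        using False nz by (simp add: h'_def ha pseudo_dist_def norm_mult norm_divide norm_minus_commute)
      then show ?thesis using h(2)[OF w] insert.hyps by (simp add: mult.assoc)
    qed
    ultimately show ?case by blast
  qed
  with that show ?thesis by blast
qed

text \<open>Division by the Blaschke product of \<open>A\<close> raises \<open>log |g z|\<close> from 0 to the sum of Green's functions and does not
  change \<open>|g|\<close> on the circle.\<close>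

lemma Jensen_inequality:
  assumes A: "finite A" "A \<subseteq> ball 0 1" and R: "1 < R" and g: "g holomorphic_on ball 0 R" "\<And>a. a \<in> A \<Longrightarrow> g a = 0"
    and z: "z \<in> ball 0 1" "norm (g z) = 1"
  shows "(\<Sum>a\<in>A. green a z) \<le> (\<integral>t. poisson z t * log_plus (norm (g (cis t))) \<partial>ang)"
proof -
  obtain h where h: "h holomorphic_on ball 0 R" "\<And>w. w \<in> cball 0 1 \<Longrightarrow> norm (g w) = norm (h w) * (\<Prod>a\<in>A. pseudo_dist a w)"
    using divide_out_zeros[OF A R g] by metis
  have pos: "0 < pseudo_dist a z" if "a \<in> A" for a
  proof -
    have "a \<noteq> z" using g(2)[OF that] z by auto
    then show ?thesis using that A z by (intro pseudo_pos) auto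
  qed
  have P: "0 < (\<Prod>a\<in>A. pseudo_dist a z)" using pos by (intro prod_pos) auto
  have "1 = norm (h z) * (\<Prod>a\<in>A. pseudo_dist a z)" using h(2)[of z] z by auto
  then have hz: "norm (h z) = 1 / (\<Prod>a\<in>A. pseudo_dist a z)" using P by (simp add: field_simps)
  have "(\<Sum>a\<in>A. green a z) = - ln (\<Prod>a\<in>A. pseudo_dist a z)"
    unfolding green_def sum_negf using pos by (subst ln_prod[OF A(1)]) force+
  also have "\<dots> = ln (norm (h z))" unfolding hz using P by (simp add: ln_div)
  also have "\<dots> \<le> log_plus (norm (h z))" using hz P by (intro ln_le_log_plus) auto
  also have "\<dots> \<le> (\<integral>t. poisson z t * log_plus (norm (h (cis t))) \<partial>ang)"
    using R by (intro log_plus_le_Poisson z holomorphic_on_imp_continuous_on holomorphic_on_subset[OF h(1)]) auto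
  also have "\<dots> = (\<integral>t. poisson z t * log_plus (norm (g (cis t))) \<partial>ang)"
  proof (intro Bochner_Integration.integral_cong refl)
    fix t
    have "(\<Prod>a\<in>A. pseudo_dist a (cis t)) = 1" using A by (intro prod.neutral ballI pseudo_sphere) auto
    then show "poisson z t * log_plus (norm (h (cis t))) = poisson z t * log_plus (norm (g (cis t)))"
      using h(2)[of "cis t"] by simp
  qed
  finally show ?thesis .
qed

lemma Jensen_dilated:
  assumes f: "f holomorphic_on ball 0 1" and A: "finite A" "\<And>a. a \<in> A \<Longrightarrow> f a = 0" "\<And>a. a \<in> A \<Longrightarrow> norm a < r"
    and l: "norm l < r" "f l = 1" and r: "r < 1"
  shows "(\<Sum>a\<in>A. green (a / of_real r) (l / of_real r)) \<le> (\<integral>t. poisson (l / of_real r) t * log_circle f r t \<partial>ang)"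
proof -
  have r0: "0 < r" using l(1) norm_ge_zero[of l] by linarith
  let ?g = "\<lambda>z. f (of_real r * z)"
  let ?s = "\<lambda>a. a / complex_of_real r"
  have inj: "inj_on ?s A" using r0 by (auto simp: inj_on_def)
  have "(f \<circ> (\<lambda>z. of_real r * z)) holomorphic_on ball 0 (1 / r)"
    using r0 by (intro holomorphic_on_compose_gen[OF _ f] holomorphic_intros) (auto simp: norm_mult field_simps)
  then have hg: "?g holomorphic_on ball 0 (1 / r)" by (simp add: o_def)
  have "(\<Sum>a\<in>?s ` A. green a (?s l)) \<le> (\<integral>t. poisson (?s l) t * log_plus (norm (?g (cis t))) \<partial>ang)"
  proof (rule Jensen_inequality[OF _ _ _ hg])
    show "finite (?s ` A)" using A by simp
    show "?s ` A \<subseteq> ball 0 1" using A(3) r0 by (auto simp: norm_divide)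
    show "1 < 1 / r" using r r0 by simp
    show "?g a = 0" if "a \<in> ?s ` A" for a using that A(2) r0 by auto
    show "?s l \<in> ball 0 1" using l r0 by (simp add: norm_divide)
    show "norm (?g (?s l)) = 1" using l r0 by simp
  qed
  then show ?thesis using inj by (simp add: sum.reindex log_circle_def)
qed

section \<open>From free interpolation to the maximal function\<close>

text \<open>The hypothesis is strict and both sides depend continuously on the radius. On a circle of radius close to 1 it
  would contradict Jensen's inequality if the excess of \<open>log\<^sup>+|f|\<close> over \<open>K\<close> had small density at \<open>\<zeta>\<close>.\<close>

lemma interpolating_eventually_high_density:
  assumes f: "f holomorphic_on ball 0 1" and A: "finite A" "A \<subseteq> ball 0 1" "\<And>a. a \<in> A \<Longrightarrow> f a = 0"
    and l: "l \<in> ball 0 1" "f l = 1" and \<zeta>: "\<zeta> \<in> sphere 0 1" and KT: "0 \<le> K" "0 \<le> T"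
    and less: "K + 32 * T * dist \<zeta> l / (1 - norm l) < (\<Sum>a\<in>A. green a l)"
  shows "eventually (\<lambda>n. \<zeta> \<in> high_density (circle_density (\<lambda>t. max 0 (log_circle f (radii n) t - K))) T) sequentially"
proof -
  have lnA: "a \<noteq> l" if "a \<in> A" for a using A(3)[OF that] l by auto
  let ?\<psi> = "\<lambda>r::real. (\<Sum>a\<in>A. green (a / of_real r) (l / of_real r)) - (K + 32 * T * dist \<zeta> (l / of_real r) / (1 - norm (l / complex_of_real r)))"
  have g: "((\<lambda>r. green (a / of_real r) (l / of_real r)) \<longlongrightarrow> green (a / of_real 1) (l / of_real 1)) (at_left 1)" if a: "a \<in> A" for a
  proof -
    have nz: "1 - cnj (a / of_real 1) * (l / of_real 1) \<noteq> 0"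
      using one_minus_cnj_nonzero[of a l] a A l by auto
    have "norm ((a / of_real 1 - l / of_real 1) / (1 - cnj (a / of_real 1) * (l / of_real 1))) \<noteq> 0"
      using nz lnA[OF a] by simp
    then show ?thesis unfolding green_def pseudo_dist_def using nz
      by (intro tendsto_minus tendsto_ln tendsto_norm tendsto_divide tendsto_diff tendsto_mult tendsto_cnj
            tendsto_const tendsto_of_real tendsto_ident_at) auto
  qed
  have "(?\<psi> \<longlongrightarrow> ?\<psi> 1) (at_left 1)"
    using l by (intro tendsto_diff tendsto_sum tendsto_add tendsto_divide tendsto_mult tendsto_dist tendsto_const
        tendsto_norm tendsto_of_real tendsto_ident_at g) auto
  moreover have "0 < ?\<psi> 1" using less by simp
  ultimately have "eventually (\<lambda>r. 0 < ?\<psi> r) (at_left 1)" by (rule order_tendstoD)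
  then have 1: "eventually (\<lambda>n. 0 < ?\<psi> (radii n)) sequentially" using radii_at_left by (rule eventually_compose_filterlim)
  have "eventually (\<lambda>n. norm x < radii n) sequentially" if "x \<in> insert l A" for x
    using that A l by (intro order_tendstoD(1)[OF radii_tendsto]) auto
  then have 2: "eventually (\<lambda>n. \<forall>x\<in>insert l A. norm x < radii n) sequentially"
    using A by (intro eventually_ball_finite) auto
  from 1 2 show ?thesis
  proof eventually_elim
    case (elim n)
    let ?r = "radii n"
    let ?z = "l / complex_of_real ?r"
    have r: "0 < ?r" "?r < 1" using radii by auto
    have z: "?z \<in> ball 0 1" using elim(2) r by (simp add: norm_divide)
    define v where "v t = max 0 (log_circle f ?r t - K)" for t
    have iv: "integrable ang (log_circle f ?r)" using r by (intro integrable_log_circle f) auto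
    have v: "integrable ang v" "0 \<le> v t" for t
      unfolding v_def using integrable_truncations(1)[OF iv] by auto
    show ?case
    proof (rule ccontr)
      assume "\<zeta> \<notin> high_density (circle_density (\<lambda>t. max 0 (log_circle f ?r t - K))) T"
      then have "\<zeta> \<notin> high_density (circle_density v) T" by (simp add: v_def[abs_def])
      then have "(\<integral>t. poisson ?z t * v t \<partial>ang) \<le> 32 * T * dist \<zeta> ?z / (1 - norm ?z)"
        by (intro poisson_le_maximal v KT z \<zeta>)
      moreover have "(\<integral>t. poisson ?z t * log_circle f ?r t \<partial>ang) \<le> (\<integral>t. K * poisson ?z t + poisson ?z t * v t \<partial>ang)"
      proof (rule integral_mono)
        show "integrable ang (\<lambda>t. poisson ?z t * log_circle f ?r t)" by (rule integrable_poisson_mult[OF z iv])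
        show "integrable ang (\<lambda>t. K * poisson ?z t + poisson ?z t * v t)"
          using integral_poisson(2)[OF z] integrable_poisson_mult[OF z v(1)] by auto
        fix t
        have "poisson ?z t * log_circle f ?r t \<le> poisson ?z t * (K + v t)"
          using poisson_nonneg[OF z, of t] by (intro mult_left_mono) (auto simp: v_def)
        then show "poisson ?z t * log_circle f ?r t \<le> K * poisson ?z t + poisson ?z t * v t" by (simp add: algebra_simps)
      qed
      moreover have "(\<integral>t. K * poisson ?z t + poisson ?z t * v t \<partial>ang) = K + (\<integral>t. poisson ?z t * v t \<partial>ang)"
        using integral_poisson[OF z] integrable_poisson_mult[OF z v(1)] by simp
      moreover have "(\<Sum>a\<in>A. green (a / of_real ?r) ?z) \<le> (\<integral>t. poisson ?z t * log_circle f ?r t \<partial>ang)"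
        using elim(2) r l A by (intro Jensen_dilated f) auto
      ultimately show False using elim(1) by linarith
    qed
  qed
qed

lemma outer_measure_circ_Un: "outer_measure_of circ (A \<union> B) \<le> outer_measure_of circ A + outer_measure_of circ B"
proof -
  obtain A' B' where A': "A' \<in> sets circ" "A \<subseteq> A'" "outer_measure_of circ A = emeasure circ A'"
    and B': "B' \<in> sets circ" "B \<subseteq> B'" "outer_measure_of circ B = emeasure circ B'"
    using outer_measure_of_attain[of A circ] outer_measure_of_attain[of B circ] by auto
  have "outer_measure_of circ (A \<union> B) \<le> outer_measure_of circ (A' \<union> B')"
    using A' B' by (intro outer_measure_of_mono) auto
  also have "\<dots> = emeasure circ (A' \<union> B')" using A' B' by (intro outer_measure_of_eq) auto
  also have "\<dots> \<le> emeasure circ A' + emeasure circ B'" using A' B' by (intro emeasure_subadditive) auto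
  finally show ?thesis using A' B' by simp
qed

text \<open>The two growth conditions serve both classes: in the Nevanlinna class they hold with \<open>K = 0\<close> and some \<open>E\<close>, in
  the Smirnov class for every \<open>E > 0\<close> with a suitable \<open>K\<close>.\<close>

lemma weak_type_from_interpolation:
  assumes \<alpha>: "\<alpha> \<ge> 1" and \<Lambda>: "\<Lambda> \<subseteq> ball 0 1" "\<Lambda> sparse_in ball 0 1" "(\<lambda>l. 1 - norm l) summable_on \<Lambda>"
    and cut: "\<And>z. z \<in> \<Lambda> \<Longrightarrow> infsum (green z) (\<Lambda> - {z}) \<le> 2 * infsum (green z) {a \<in> \<Lambda> - {z}. (a \<in> S) \<noteq> (z \<in> S)}"
    and f1: "f1 holomorphic_on ball 0 1" "\<And>l. l \<in> \<Lambda> \<Longrightarrow> f1 l = of_bool (l \<in> S)"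
    and f2: "f2 holomorphic_on ball 0 1" "\<And>l. l \<in> \<Lambda> \<Longrightarrow> f2 l = of_bool (l \<notin> S)"
    and K: "0 \<le> K" and E: "0 \<le> E"
    and b1: "eventually (\<lambda>r. (\<integral>t. max 0 (log_circle f1 r t - K) \<partial>ang) \<le> E) (at_left 1)"
    and b2: "eventually (\<lambda>r. (\<integral>t. max 0 (log_circle f2 r t - K) \<partial>ang) \<le> E) (at_left 1)"
    and \<tau>: "0 < \<tau>" "4 * K \<le> \<tau>"
  shows "outer_measure_of circ {\<zeta> \<in> sphere 0 1. H_maximal \<alpha> (phi \<Lambda>) \<zeta> > ennreal \<tau>} \<le> ennreal (81920 * pi * \<alpha> * E / \<tau>)"
proof -
  define c where "c = 32 * pi * \<alpha>"
  have c: "0 < c" using \<alpha> by (simp add: c_def)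
  \<comment> \<open>With \<open>d = 1 - |l|\<close> and \<open>R = |\<zeta> - l|\<close>, \<open>phi \<Lambda> l\<close> exceeds both \<open>\<tau>\<close> and \<open>\<tau> * R / (c * d)\<close>, hence their mean. The cut
    halves it, which leaves \<open>\<tau> / 4\<close> for \<open>K\<close> and \<open>\<tau> * R / (4 * c * d) = 32 * T * R / d\<close> for the maximal function.\<close>
  define T where "T = \<tau> / (128 * c)"
  have T: "0 < T" using \<tau> c by (simp add: T_def)
  have "eventually (\<lambda>n. (\<integral>t. max 0 (log_circle f1 (radii n) t - K) \<partial>ang) \<le> E \<and> (\<integral>t. max 0 (log_circle f2 (radii n) t - K) \<partial>ang) \<le> E) sequentially"
    using eventually_conj[OF b1 b2] radii_at_left by (rule eventually_compose_filterlim)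
  then obtain N where N: "\<And>n. n \<ge> N \<Longrightarrow> (\<integral>t. max 0 (log_circle f1 (radii n) t - K) \<partial>ang) \<le> E"
      "\<And>n. n \<ge> N \<Longrightarrow> (\<integral>t. max 0 (log_circle f2 (radii n) t - K) \<partial>ang) \<le> E"
    unfolding eventually_sequentially by blast
  define G where "G f n = high_density (circle_density (\<lambda>t. max 0 (log_circle f (radii n) t - K))) T" for f n
  have Gm: "outer_measure_of circ (G f n) \<le> ennreal (10 * E / T)"
    if "f holomorphic_on ball 0 1" "(\<integral>t. max 0 (log_circle f (radii n) t - K) \<partial>ang) \<le> E" for f n
  proof -
    have "integrable ang (log_circle f (radii n))" using radii[of n] by (intro integrable_log_circle that) auto
    then have "outer_measure_of circ (G f n) \<le> ennreal (10 * (\<integral>t. max 0 (log_circle f (radii n) t - K) \<partial>ang) / T)"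
      unfolding G_def by (intro outer_measure_high_density integrable_truncations T) auto
    also have "\<dots> \<le> ennreal (10 * E / T)" using that(2) T by (intro ennreal_leI divide_right_mono mult_left_mono) auto
    finally show ?thesis .
  qed
  show ?thesis
  proof (rule outer_measure_liminf)
    show "outer_measure_of circ (G f1 (n + N) \<union> G f2 (n + N)) \<le> ennreal (81920 * pi * \<alpha> * E / \<tau>)" for n
    proof -
      have "outer_measure_of circ (G f1 (n + N) \<union> G f2 (n + N)) \<le> ennreal (10 * E / T) + ennreal (10 * E / T)"
        by (intro order_trans[OF outer_measure_circ_Un] add_mono Gm f1 f2 N) auto
      also have "\<dots> = ennreal (10 * E / T + 10 * E / T)" using E T by (intro ennreal_plus[symmetric]) auto
      also have "10 * E / T + 10 * E / T = 81920 * pi * \<alpha> * E / \<tau>" using \<tau> \<alpha> by (simp add: T_def c_def)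
      finally show ?thesis .
    qed
    fix \<zeta> assume "\<zeta> \<in> {\<zeta> \<in> sphere 0 1. H_maximal \<alpha> (phi \<Lambda>) \<zeta> > ennreal \<tau>}"
    then have \<zeta>: "\<zeta> \<in> sphere 0 1" and "ennreal \<tau> < H_maximal \<alpha> (phi \<Lambda>) \<zeta>" by auto
    then obtain l where l: "l \<in> \<Lambda>" and big: "ennreal \<tau> < ennreal (phi \<Lambda> l) * hl_maximal (indicator (shadow \<alpha> l)) \<zeta>"
      unfolding H_maximal_eq[OF \<Lambda>(1)] less_SUP_iff by auto
    have lb: "l \<in> ball 0 1" using l \<Lambda> by auto
    define d where "d = 1 - norm l"
    define R where "R = dist \<zeta> l"
    have d: "0 < d" using lb by (simp add: d_def)
    have R: "0 < R" using \<zeta> lb by (auto simp: R_def)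
    have sum': "(green l has_sum phi \<Lambda> l) (\<Lambda> - {l})" by (rule phi_has_sum[OF \<Lambda> l])
    let ?X = "{a \<in> \<Lambda> - {l}. (a \<in> S) \<noteq> (l \<in> S)}"
    have smX: "green l summable_on ?X"
      by (rule summable_on_subset[OF has_sum_imp_summable[OF sum']]) auto
    have phiX: "phi \<Lambda> l \<le> 2 * infsum (green l) ?X"
      using cut[OF l] infsumI[OF sum'] by simp
    have gnn: "0 \<le> green l a" if "a \<in> \<Lambda>" for a using that \<Lambda>(1) lb by (intro green_nonneg) auto
    have phi0: "0 \<le> phi \<Lambda> l" using has_sum_nonneg[OF sum'] gnn by auto
    have b_1: "\<tau> < phi \<Lambda> l"
    proof -
      have "ennreal (phi \<Lambda> l) * hl_maximal (indicator (shadow \<alpha> l)) \<zeta> \<le> ennreal (phi \<Lambda> l) * 1"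
        by (intro mult_left_mono hl_maximal_indicator_le_1) auto
      then have "ennreal \<tau> < ennreal (phi \<Lambda> l)" using big by (simp add: less_le_trans)
      then show ?thesis using \<tau> by (simp add: ennreal_less_iff)
    qed
    have b_2: "\<tau> < phi \<Lambda> l * (c * d / R)"
    proof -
      have "ennreal (phi \<Lambda> l) * hl_maximal (indicator (shadow \<alpha> l)) \<zeta> \<le> ennreal (phi \<Lambda> l) * ennreal (c * d / R)"
        unfolding c_def d_def R_def by (intro mult_left_mono hl_maximal_shadow_le \<alpha> lb \<zeta>) auto
      also have "\<dots> = ennreal (phi \<Lambda> l * (c * d / R))" using phi0 c d R by (intro ennreal_mult[symmetric]) auto
      finally have "ennreal \<tau> < ennreal (phi \<Lambda> l * (c * d / R))" using big by (simp add: less_le_trans)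
      then show ?thesis using \<tau> by (simp add: ennreal_less_iff)
    qed
    have "\<tau> * R / (c * d) < phi \<Lambda> l" using b_2 c d R by (simp add: field_simps)
    moreover have "t / 4 + q / 4 < x" if "q < p" "t < p" "p \<le> 2 * x" for t q p x :: real
      using that by (simp add: field_simps)
    ultimately have "\<tau> / 4 + \<tau> * R / (c * d) / 4 < infsum (green l) ?X" using b_1 phiX by blast
    moreover have "\<tau> * R / (c * d) / 4 = 32 * T * R / d" using c d by (simp add: T_def)
    ultimately have less: "K + 32 * T * R / d < infsum (green l) ?X" using \<tau>(2) by linarith
    obtain A where A: "finite A" "A \<subseteq> ?X" "K + 32 * T * R / d < sum (green l) A"
    proof -
      define e where "e = (infsum (green l) ?X - (K + 32 * T * R / d)) / 2"
      have e: "0 < e" using less by (simp add: e_def)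
      obtain A where "finite A" "A \<subseteq> ?X" "dist (sum (green l) A) (infsum (green l) ?X) \<le> e"
        using has_sum_finite_approximation[OF has_sum_infsum[OF smX] e] by blast
      then show ?thesis using that[of A] e unfolding e_def dist_real_def by (auto simp: field_simps abs_if split: if_splits)
    qed
    have lessA: "K + 32 * T * dist \<zeta> l / (1 - norm l) < (\<Sum>a\<in>A. green a l)"
      using A(3) by (simp add: R_def d_def green_commute[of l])
    have Ab: "A \<subseteq> ball 0 1" using A(2) \<Lambda>(1) by auto
    have "eventually (\<lambda>n. \<zeta> \<in> G f1 n \<union> G f2 n) sequentially"
    proof (cases "l \<in> S")
      case True
      have "eventually (\<lambda>n. \<zeta> \<in> G f1 n) sequentially"
        unfolding G_def using True l A(2) f1(2) T
        by (intro interpolating_eventually_high_density[OF f1(1) A(1) Ab _ lb _ \<zeta> K _ lessA]) auto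
      then show ?thesis by eventually_elim simp
    next
      case False
      have "eventually (\<lambda>n. \<zeta> \<in> G f2 n) sequentially"
        unfolding G_def using False l A(2) f2(2) T
        by (intro interpolating_eventually_high_density[OF f2(1) A(1) Ab _ lb _ \<zeta> K _ lessA]) auto
      then show ?thesis by eventually_elim simp
    qed
    then show "eventually (\<lambda>n. \<zeta> \<in> G f1 (n + N) \<union> G f2 (n + N)) sequentially"
      by (rule sequentially_offset)
  qed
qed

lemma countable_sparse_disc:
  assumes "\<Lambda> \<subseteq> ball 0 1" "\<Lambda> sparse_in ball (0::complex) 1"
  shows "countable \<Lambda>"
proof -
  have "finite (cball 0 (radii n) \<inter> \<Lambda>)" for n
    using radii[of n] by (intro sparse_in_compact_finite sparse_in_subset[OF assms(2)]) auto
  then have "countable (\<Union>n. cball 0 (radii n) \<inter> \<Lambda>)" by (intro countable_UN) (auto intro: countable_finite)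
  moreover have "\<Lambda> \<subseteq> (\<Union>n. cball 0 (radii n) \<inter> \<Lambda>)"
  proof
    fix x assume x: "x \<in> \<Lambda>"
    then have "eventually (\<lambda>n. norm x < radii n) sequentially"
      using assms(1) by (intro order_tendstoD(1)[OF radii_tendsto]) auto
    then obtain n where "norm x < radii n" by (auto simp: eventually_sequentially)
    then show "x \<in> (\<Union>n. cball 0 (radii n) \<inter> \<Lambda>)" using x by (auto intro!: exI[of _ n])
  qed
  ultimately show ?thesis by (rule countable_subset[rotated])
qed

lemma free_interpolating_indicator:
  assumes "free_interpolating \<Lambda> X" "(\<lambda>_. 1) \<in> X"
  obtains f where "f \<in> X" "\<And>l. l \<in> \<Lambda> \<Longrightarrow> f l = of_bool (l \<in> S)"
proof -
  have a: "restrict (\<lambda>_. 1) \<Lambda> \<in> trace_space X \<Lambda>" using assms(2) by (auto simp: trace_space_def)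
  have "bounded ((\<lambda>l. of_bool (l \<in> S) :: complex) ` \<Lambda>)"
    by (rule boundedI[of _ 1]) auto
  with a assms(1) have "restrict (\<lambda>l. of_bool (l \<in> S) * restrict (\<lambda>_. 1) \<Lambda> l) \<Lambda> \<in> trace_space X \<Lambda>"
    unfolding free_interpolating_def by blast
  then obtain f where f: "f \<in> X" "restrict (\<lambda>l. of_bool (l \<in> S) * restrict (\<lambda>_. 1) \<Lambda> l) \<Lambda> = restrict f \<Lambda>"
    by (auto simp: trace_space_def)
  have "f l = of_bool (l \<in> S)" if "l \<in> \<Lambda>" for l
    using fun_cong[OF f(2), of l] that by simp
  with that f(1) show ?thesis by blast
qed

lemma one_in_smirnov: "(\<lambda>_. 1) \<in> smirnov"
proof -
  have "log_circle (\<lambda>_. 1) r t = 0" for r t by (simp add: log_circle_def log_plus_def)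
  then show ?thesis unfolding smirnov_iff log_uniformly_integrable_def by (auto intro!: exI[of _ 0])
qed

lemma smirnov_subset_nevanlinna: "smirnov \<subseteq> nevanlinna"
  by (auto simp: smirnov_def)

lemma cut_exists:
  assumes \<Lambda>: "\<Lambda> \<subseteq> ball 0 1" "\<Lambda> sparse_in ball 0 1" "(\<lambda>l. 1 - norm l) summable_on \<Lambda>"
  obtains S where "\<And>z. z \<in> \<Lambda> \<Longrightarrow> infsum (green z) (\<Lambda> - {z}) \<le> 2 * infsum (green z) {a \<in> \<Lambda> - {z}. (a \<in> S) \<noteq> (z \<in> S)}"
proof (rule countable_cut[of \<Lambda> green])
  show "countable \<Lambda>" by (rule countable_sparse_disc[OF \<Lambda>(1,2)])
  show "green x y = green y x" for x y by (rule green_commute)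
  show "0 \<le> green x y" if "x \<in> \<Lambda>" "y \<in> \<Lambda>" for x y using that \<Lambda>(1) by (intro green_nonneg) auto
  show "green z summable_on (\<Lambda> - {z})" if "z \<in> \<Lambda>" for z
    by (rule has_sum_imp_summable[OF phi_has_sum[OF \<Lambda> that]])
qed (use that in blast)

lemma free_interpolating_across_cut:
  assumes \<Lambda>: "\<Lambda> \<subseteq> ball 0 1" "\<Lambda> sparse_in ball 0 1" "(\<lambda>l. 1 - norm l) summable_on \<Lambda>"
    and free: "free_interpolating \<Lambda> X" "(\<lambda>_. 1) \<in> X"
  obtains S f1 f2 where
    "\<And>z. z \<in> \<Lambda> \<Longrightarrow> infsum (green z) (\<Lambda> - {z}) \<le> 2 * infsum (green z) {a \<in> \<Lambda> - {z}. (a \<in> S) \<noteq> (z \<in> S)}"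
    "f1 \<in> X" "\<And>l. l \<in> \<Lambda> \<Longrightarrow> f1 l = of_bool (l \<in> S)" "f2 \<in> X" "\<And>l. l \<in> \<Lambda> \<Longrightarrow> f2 l = of_bool (l \<notin> S)"
proof -
  obtain S where cut: "\<And>z. z \<in> \<Lambda> \<Longrightarrow> infsum (green z) (\<Lambda> - {z}) \<le> 2 * infsum (green z) {a \<in> \<Lambda> - {z}. (a \<in> S) \<noteq> (z \<in> S)}"
    by (rule cut_exists[OF \<Lambda>]) blast
  obtain f1 where f1: "f1 \<in> X" "\<And>l. l \<in> \<Lambda> \<Longrightarrow> f1 l = of_bool (l \<in> S)"
    by (rule free_interpolating_indicator[OF free, of S]) blast
  obtain f2 where f2: "f2 \<in> X" "\<And>l. l \<in> \<Lambda> \<Longrightarrow> f2 l = of_bool (l \<in> - S)"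
    by (rule free_interpolating_indicator[OF free, of "- S"]) blast
  show ?thesis by (rule that[OF cut f1 f2(1)]) (use f2(2) in auto)
qed

lemma emeasure_H_maximal_le:
  assumes \<Lambda>: "\<Lambda> \<subseteq> ball 0 1" "\<Lambda> sparse_in ball 0 1"
  shows "emeasure circle_measure {\<zeta> \<in> sphere 0 1. H_maximal \<alpha> (phi \<Lambda>) \<zeta> > c}
    \<le> outer_measure_of circ {\<zeta> \<in> sphere 0 1. H_maximal \<alpha> (phi \<Lambda>) \<zeta> > c}"
proof (rule emeasure_circle_measure_le)
  have [measurable]: "H_maximal \<alpha> (phi \<Lambda>) \<in> borel_measurable circle_measure"
    by (intro H_maximal_measurable \<Lambda> countable_sparse_disc)
  have "{\<zeta> \<in> space circle_measure. H_maximal \<alpha> (phi \<Lambda>) \<zeta> > c} \<in> sets circle_measure" by measurable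
  then show "{\<zeta> \<in> sphere 0 1. H_maximal \<alpha> (phi \<Lambda>) \<zeta> > c} \<in> sets circle_measure" by simp
qed

lemma nevanlinna_interpolating_imp_weak_L1:
  assumes \<alpha>: "\<alpha> \<ge> 1" and \<Lambda>: "\<Lambda> \<subseteq> ball 0 1" "\<Lambda> sparse_in ball 0 1" "(\<lambda>l. 1 - norm l) summable_on \<Lambda>"
    and free: "free_interpolating \<Lambda> nevanlinna"
  shows "H_maximal \<alpha> (phi \<Lambda>) \<in> weak_L1_circle"
proof -
  have one: "(\<lambda>_. 1) \<in> nevanlinna" using one_in_smirnov smirnov_subset_nevanlinna by blast
  obtain S f1 f2 where
    cut: "\<And>z. z \<in> \<Lambda> \<Longrightarrow> infsum (green z) (\<Lambda> - {z}) \<le> 2 * infsum (green z) {a \<in> \<Lambda> - {z}. (a \<in> S) \<noteq> (z \<in> S)}"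
    and f1: "f1 \<in> nevanlinna" "\<And>l. l \<in> \<Lambda> \<Longrightarrow> f1 l = of_bool (l \<in> S)"
    and f2: "f2 \<in> nevanlinna" "\<And>l. l \<in> \<Lambda> \<Longrightarrow> f2 l = of_bool (l \<notin> S)"
    by (rule free_interpolating_across_cut[OF \<Lambda> free one]) blast
  obtain L1 L2 where L: "\<And>r. 0 \<le> r \<Longrightarrow> r < 1 \<Longrightarrow> log_mean f1 r \<le> L1" "\<And>r. 0 \<le> r \<Longrightarrow> r < 1 \<Longrightarrow> log_mean f2 r \<le> L2"
    and holo: "f1 holomorphic_on ball 0 1" "f2 holomorphic_on ball 0 1"
    using f1 f2 unfolding nevanlinna_iff by blast
  define E where "E = max L1 L2"
  have E: "0 \<le> E" using L(1)[of 0] log_mean_nonneg[of f1 0] by (simp add: E_def)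
  have ev: "eventually (\<lambda>r. (\<integral>t. max 0 (log_circle f r t - 0) \<partial>ang) \<le> E) (at_left 1)"
    if "\<And>r. 0 \<le> r \<Longrightarrow> r < 1 \<Longrightarrow> log_mean f r \<le> E" for f
    using eventually_left_1 by eventually_elim (use that in \<open>simp add: log_mean_def max_absorb2\<close>)
  have "outer_measure_of circ {\<zeta> \<in> sphere 0 1. H_maximal \<alpha> (phi \<Lambda>) \<zeta> > ennreal \<tau>} \<le> ennreal (81920 * pi * \<alpha> * E / \<tau>)"
    if "0 < \<tau>" for \<tau>
  proof (rule weak_type_from_interpolation[OF \<alpha> \<Lambda> cut holo(1) f1(2) holo(2) f2(2) _ E ev ev that])
    show "log_mean f1 r \<le> E" if "0 \<le> r" "r < 1" for r using L(1)[OF that] by (simp add: E_def)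
    show "log_mean f2 r \<le> E" if "0 \<le> r" "r < 1" for r using L(2)[OF that] by (simp add: E_def)
  qed (use that in auto)
  then have "ennreal \<tau> * emeasure circle_measure {\<zeta> \<in> sphere 0 1. H_maximal \<alpha> (phi \<Lambda>) \<zeta> > ennreal \<tau>} \<le> ennreal (81920 * pi * \<alpha> * E)"
    if "\<tau> \<in> {0<..}" for \<tau>
  proof -
    have \<tau>: "0 < \<tau>" using that by simp
    have "ennreal \<tau> * emeasure circle_measure {\<zeta> \<in> sphere 0 1. H_maximal \<alpha> (phi \<Lambda>) \<zeta> > ennreal \<tau>}
        \<le> ennreal \<tau> * ennreal (81920 * pi * \<alpha> * E / \<tau>)"
      using order_trans[OF emeasure_H_maximal_le[OF \<Lambda>(1,2)] \<open>\<And>\<tau>. 0 < \<tau> \<Longrightarrow> _\<close>[OF \<tau>]] by (intro mult_left_mono) auto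
    also have "\<dots> = ennreal (81920 * pi * \<alpha> * E)" using \<tau> E \<alpha> by (simp add: ennreal_mult[symmetric])
    finally show ?thesis .
  qed
  then have "(SUP \<tau> \<in> {0::real<..}. ennreal \<tau> * emeasure circle_measure {\<zeta> \<in> sphere 0 1. H_maximal \<alpha> (phi \<Lambda>) \<zeta> > ennreal \<tau>})
      \<le> ennreal (81920 * pi * \<alpha> * E)"
    by (rule SUP_least)
  also have "\<dots> < \<infinity>" by simp
  finally show ?thesis unfolding weak_L1_circle_def
    using H_maximal_measurable[OF \<Lambda>(1) countable_sparse_disc[OF \<Lambda>(1,2)]] by simp
qed

lemma smirnov_interpolating_imp_weak_L1_0:
  assumes \<alpha>: "\<alpha> \<ge> 1" and \<Lambda>: "\<Lambda> \<subseteq> ball 0 1" "\<Lambda> sparse_in ball 0 1" "(\<lambda>l. 1 - norm l) summable_on \<Lambda>"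
    and free: "free_interpolating \<Lambda> smirnov"
  shows "H_maximal \<alpha> (phi \<Lambda>) \<in> weak_L1_0_circle"
proof -
  obtain S f1 f2 where
    cut: "\<And>z. z \<in> \<Lambda> \<Longrightarrow> infsum (green z) (\<Lambda> - {z}) \<le> 2 * infsum (green z) {a \<in> \<Lambda> - {z}. (a \<in> S) \<noteq> (z \<in> S)}"
    and f1: "f1 \<in> smirnov" "\<And>l. l \<in> \<Lambda> \<Longrightarrow> f1 l = of_bool (l \<in> S)"
    and f2: "f2 \<in> smirnov" "\<And>l. l \<in> \<Lambda> \<Longrightarrow> f2 l = of_bool (l \<notin> S)"
    by (rule free_interpolating_across_cut[OF \<Lambda> free one_in_smirnov]) blast
  have holo: "f1 holomorphic_on ball 0 1" "f2 holomorphic_on ball 0 1"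
    and UI: "log_uniformly_integrable f1" "log_uniformly_integrable f2" using f1 f2 by (auto simp: smirnov_iff)
  have "((\<lambda>t::real. ennreal t * emeasure circle_measure {\<zeta> \<in> sphere 0 1. H_maximal \<alpha> (phi \<Lambda>) \<zeta> > ennreal t}) \<longlongrightarrow> 0) at_top"
  proof (rule order_tendstoI)
    fix a :: ennreal assume "0 < a"
    then obtain b where b: "0 < b" "ennreal b < a"
    proof (cases a)
      case (real x)
      then show ?thesis using \<open>0 < a\<close> by (intro that[of "x / 2"]) (auto simp: ennreal_less_iff)
    next
      case top
      then show ?thesis by (intro that[of 1]) auto
    qed
    define E where "E = b / (81920 * pi * \<alpha>)"
    have E: "0 < E" using b \<alpha> by (simp add: E_def)
    obtain K1 where K1: "K1 \<ge> 0" "eventually (\<lambda>r. (\<integral>t. max 0 (log_circle f1 r t - K1) \<partial>ang) \<le> E) (at_left 1)"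
      using UI(1) E unfolding log_uniformly_integrable_def by blast
    obtain K2 where K2: "K2 \<ge> 0" "eventually (\<lambda>r. (\<integral>t. max 0 (log_circle f2 r t - K2) \<partial>ang) \<le> E) (at_left 1)"
      using UI(2) E unfolding log_uniformly_integrable_def by blast
    define K where "K = max K1 K2"
    have ev: "eventually (\<lambda>r. (\<integral>t. max 0 (log_circle f r t - K) \<partial>ang) \<le> E) (at_left 1)"
      if f: "f holomorphic_on ball 0 1" and K': "K' \<le> K"
        and e: "eventually (\<lambda>r. (\<integral>t. max 0 (log_circle f r t - K') \<partial>ang) \<le> E) (at_left 1)" for f K'
      using e eventually_left_1
    proof eventually_elim
      case (elim r)
      then have i: "integrable ang (log_circle f r)" by (intro integrable_log_circle f) auto
      have "(\<integral>t. max 0 (log_circle f r t - K) \<partial>ang) \<le> (\<integral>t. max 0 (log_circle f r t - K') \<partial>ang)"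
        using K' by (intro integral_mono integrable_truncations i) auto
      then show ?case using elim by linarith
    qed
    have ev1: "eventually (\<lambda>r. (\<integral>t. max 0 (log_circle f1 r t - K) \<partial>ang) \<le> E) (at_left 1)"
      by (rule ev[OF holo(1) _ K1(2)]) (simp add: K_def)
    have ev2: "eventually (\<lambda>r. (\<integral>t. max 0 (log_circle f2 r t - K) \<partial>ang) \<le> E) (at_left 1)"
      by (rule ev[OF holo(2) _ K2(2)]) (simp add: K_def)
    have K0: "0 \<le> K" using K1(1) by (simp add: K_def)
    show "eventually (\<lambda>t::real. ennreal t * emeasure circle_measure {\<zeta> \<in> sphere 0 1. H_maximal \<alpha> (phi \<Lambda>) \<zeta> > ennreal t} < a) at_top"
      using eventually_gt_at_top[of "4 * K"]
    proof eventually_elim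
      case (elim \<tau>)
      then have \<tau>: "0 < \<tau>" using K0 by simp
      have "outer_measure_of circ {\<zeta> \<in> sphere 0 1. H_maximal \<alpha> (phi \<Lambda>) \<zeta> > ennreal \<tau>} \<le> ennreal (81920 * pi * \<alpha> * E / \<tau>)"
        using elim E by (intro weak_type_from_interpolation[OF \<alpha> \<Lambda> cut holo(1) f1(2) holo(2) f2(2) K0 _ ev1 ev2 \<tau>]) auto
      then have "ennreal \<tau> * emeasure circle_measure {\<zeta> \<in> sphere 0 1. H_maximal \<alpha> (phi \<Lambda>) \<zeta> > ennreal \<tau>}
          \<le> ennreal \<tau> * ennreal (81920 * pi * \<alpha> * E / \<tau>)"
        using order_trans[OF emeasure_H_maximal_le[OF \<Lambda>(1,2)]] by (intro mult_left_mono) auto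
      also have "\<dots> = ennreal b" using \<tau> b \<alpha> by (simp add: ennreal_mult[symmetric] E_def)
      finally show ?case using b(2) by (rule le_less_trans)
    qed
  qed simp
  then show ?thesis unfolding weak_L1_0_circle_def
    using H_maximal_measurable[OF \<Lambda>(1) countable_sparse_disc[OF \<Lambda>(1,2)]] by simp
qed

section \<open>A harmonic majorant from the nontangential maximal function\<close>

text \<open>With \<open>x = |l|\<close> and \<open>u\<close> the angle between \<open>\<xi>\<close> and \<open>l\<close>, \<open>|\<xi> - l|\<^sup>2 = (1 - x)\<^sup>2 + 2 * x * (1 - cos u)\<close> is at most
  \<open>(1 - x)\<^sup>2 * (1 + x)\<close> for \<open>|u| \<le> 1 - x\<close>, hence at most \<open>(1 - x\<^sup>2)\<^sup>2\<close>.\<close>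

lemma shadow_contains_arc:
  assumes \<alpha>: "\<alpha> \<ge> 1" and l: "l \<in> ball 0 1"
  shows "cis ` {Arg l - (1 - norm l) .. Arg l + (1 - norm l)} \<subseteq> shadow \<alpha> l"
proof
  fix \<xi> assume "\<xi> \<in> cis ` {Arg l - (1 - norm l) .. Arg l + (1 - norm l)}"
  then obtain s where s: "\<xi> = cis s" "\<bar>s - Arg l\<bar> \<le> 1 - norm l" by (auto simp: abs_le_iff)
  define x where "x = norm l"
  have x: "0 \<le> x" "x < 1" using l by (auto simp: x_def)
  have lx: "l = of_real x * cis (Arg l)" using rcis_cmod_Arg[of l] by (simp add: rcis_def x_def)
  define u where "u = s - Arg l"
  have u: "\<bar>u\<bar> \<le> 1 - x" using s by (simp add: u_def x_def)
  have "1 - cos u = 2 * (sin (u / 2))\<^sup>2" using cos_double_sin[of "u / 2"] by simp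
  moreover have "(sin (u / 2))\<^sup>2 \<le> (u / 2)\<^sup>2" by (rule abs_le_square_iff[THEN iffD1, OF abs_sin_x_le_abs_x])
  moreover have "u\<^sup>2 \<le> (1 - x)\<^sup>2" using u x abs_le_square_iff[of u "1 - x"] by simp
  ultimately have c: "2 * (1 - cos u) \<le> (1 - x)\<^sup>2" by (simp add: power_divide)
  have "(dist \<xi> l)\<^sup>2 = (1 - x)\<^sup>2 + x * (2 * (1 - cos u))"
    unfolding s(1) using dist_cis_radial_squared[of s x "Arg l"] lx[symmetric]
    by (simp add: u_def power2_eq_square algebra_simps)
  also have "\<dots> \<le> (1 - x)\<^sup>2 + x * (1 - x)\<^sup>2" using c x by (intro add_left_mono mult_left_mono) auto
  also have "\<dots> = (1 - x)\<^sup>2 * (1 + x)" by (simp add: algebra_simps)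
  also have "\<dots> \<le> (1 - x)\<^sup>2 * (1 + x)\<^sup>2" using x by (intro mult_left_mono) (auto simp: power2_eq_square)
  also have "\<dots> = (1 - x\<^sup>2)\<^sup>2" by (simp add: power2_eq_square algebra_simps)
  finally have "(dist \<xi> l)\<^sup>2 \<le> (1 - x\<^sup>2)\<^sup>2" .
  moreover have x2: "0 \<le> 1 - x\<^sup>2" using x by (simp add: power_le_one)
  ultimately have "dist \<xi> l \<le> 1 - x\<^sup>2" by (rule power2_le_imp_le)
  also have "\<dots> \<le> \<alpha> * (1 - x\<^sup>2)" using \<alpha> x2 mult_right_mono[of 1 \<alpha> "1 - x\<^sup>2"] by simp
  finally show "\<xi> \<in> shadow \<alpha> l" using l s by (simp add: shadow_def stolz_def x_def dist_norm norm_minus_commute)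
qed

lemma measure_shadow_ge:
  assumes \<alpha>: "\<alpha> \<ge> 1" and l: "l \<in> ball 0 1"
  shows "(1 - norm l) / pi \<le> measure circ (shadow \<alpha> l)"
proof -
  define d where "d = 1 - norm l"
  have d: "0 \<le> d" "d \<le> 1" using l by (auto simp: d_def)
  have "emeasure circ (cis ` {Arg l - d .. Arg l + d}) = ennreal ((Arg l + d - (Arg l - d)) / (2 * pi))"
    using d pi_gt3 by (intro emeasure_circ_arc) linarith+
  also have "(Arg l + d - (Arg l - d)) / (2 * pi) = d / pi" by simp
  finally have "ennreal ((1 - norm l) / pi) = emeasure circ (cis ` {Arg l - (1 - norm l) .. Arg l + (1 - norm l)})"
    by (simp add: d_def)
  also have "\<dots> \<le> emeasure circ (shadow \<alpha> l)"
    by (intro emeasure_mono shadow_contains_arc assms) auto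
  also have "\<dots> = ennreal (measure circ (shadow \<alpha> l))" by (rule circ.emeasure_eq_measure)
  finally show ?thesis by (simp add: ennreal_le_iff)
qed

text \<open>On the shadow of \<open>l\<close> the Poisson kernel is at least \<open>1 / (\<alpha>\<^sup>2 * (1 - |l|\<^sup>2))\<close> and the maximal function at least
  \<open>\<phi> l\<close>, and the shadow has measure at least \<open>(1 - |l|) / pi\<close>. Therefore \<open>w = 2 * pi * \<alpha>\<^sup>2 * M \<phi>\<close> works.\<close>

lemma harmonic_majorant_from_nt_maximal:
  assumes \<alpha>: "\<alpha> \<ge> 1" and \<phi>: "\<And>l. l \<in> \<Lambda> \<Longrightarrow> 0 \<le> \<phi> l" and \<Lambda>: "\<Lambda> \<subseteq> ball 0 1" and M: "nt_maximal \<alpha> \<phi> \<in> L1_circle"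
  obtains w where "integrable ang w" "\<And>t. 0 \<le> w t" "\<And>l. l \<in> \<Lambda> \<Longrightarrow> \<phi> l \<le> (\<integral>t. poisson l t * w t \<partial>ang)"
proof -
  have Mm: "nt_maximal \<alpha> \<phi> \<in> borel_measurable circle_measure" and Mfin: "(\<integral>\<^sup>+\<zeta>. nt_maximal \<alpha> \<phi> \<zeta> \<partial>circle_measure) < \<infinity>"
    using M by (auto simp: L1_circle_def)
  obtain g :: "complex \<Rightarrow> ennreal" where g [measurable]: "g \<in> borel_measurable borel"
    and gi: "(\<integral>\<^sup>+\<zeta>. g \<zeta> \<partial>circ) = (\<integral>\<^sup>+\<zeta>. nt_maximal \<alpha> \<phi> \<zeta> \<partial>circle_measure)"
    and gM: "AE \<zeta> in circ. g \<zeta> \<ge> nt_maximal \<alpha> \<phi> \<zeta>"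
    by (rule nn_integral_circle_measure[OF Mm])
  have cm: "cis \<in> measurable ang borel" by simp
  have gang: "(\<integral>\<^sup>+t. g (cis t) \<partial>ang) < \<infinity>"
    using Mfin gi[symmetric] unfolding circ_def by (simp add: nn_integral_distr[OF cm])
  define v where "v t = enn2real (g (cis t))" for t
  have "AE t in ang. g (cis t) \<noteq> \<infinity>"
    using gang by (intro nn_integral_noteq_infinite) auto
  then have vg: "AE t in ang. ennreal (v t) = g (cis t)"
    by eventually_elim (simp add: v_def less_top)
  have v0: "0 \<le> v t" for t by (simp add: v_def)
  have vi: "integrable ang v"
  proof (rule integrableI_nonneg)
    show "v \<in> borel_measurable ang" unfolding v_def by measurable
    show "AE t in ang. 0 \<le> v t" using v0 by simp
    have "(\<integral>\<^sup>+t. ennreal (v t) \<partial>ang) = (\<integral>\<^sup>+t. g (cis t) \<partial>ang)" by (rule nn_integral_cong_AE[OF vg])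
    then show "(\<integral>\<^sup>+t. ennreal (v t) \<partial>ang) < \<infinity>" using gang by simp
  qed
  have "AE t in ang. g (cis t) \<ge> nt_maximal \<alpha> \<phi> (cis t)"
    using gM unfolding circ_def by (rule AE_distrD[OF cm])
  with vg have vM: "AE t in ang. nt_maximal \<alpha> \<phi> (cis t) \<le> ennreal (v t)" by eventually_elim simp
  define w where "w t = 2 * pi * \<alpha>\<^sup>2 * v t" for t
  have wi: "integrable ang w" unfolding w_def using vi by simp
  have w0: "0 \<le> w t" for t using v0[of t] by (simp add: w_def)
  have "\<phi> l \<le> (\<integral>t. poisson l t * w t \<partial>ang)" if l: "l \<in> \<Lambda>" for l
  proof -
    have lb: "l \<in> ball 0 1" using l \<Lambda> by auto
    define D where "D = 1 - (norm l)\<^sup>2"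
    have D: "0 < D" using lb one_minus_norm_squared(1)[OF lb] by (simp add: D_def)
    define c where "c = 2 * pi * \<phi> l / D"
    have c0: "0 \<le> c" using \<phi>[OF l] D by (simp add: c_def)
    have ind: "integrable ang (\<lambda>t. c * indicator (shadow \<alpha> l) (cis t) :: real)"
      by (intro integrable_mult_right ang.integrable_const_bound[of _ 1]) (auto simp: indicator_def)
    have "measure circ (shadow \<alpha> l) = (\<integral>\<xi>. indicator (shadow \<alpha> l) \<xi> \<partial>circ)" by simp
    also have "\<dots> = (\<integral>t. indicator (shadow \<alpha> l) (cis t) \<partial>ang)"
      unfolding circ_def by (rule integral_distr[OF cm]) simp
    finally have ms: "(\<integral>t. indicator (shadow \<alpha> l) (cis t) \<partial>ang) = measure circ (shadow \<alpha> l)" by simp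
    have "\<phi> l * 1 \<le> \<phi> l * (2 * (1 - norm l) / D)"
    proof (intro mult_left_mono \<phi> l)
      show "1 \<le> 2 * (1 - norm l) / D" using D one_minus_norm_squared(2)[OF lb] by (simp add: D_def)
    qed
    also have "\<dots> = c * ((1 - norm l) / pi)" by (simp add: c_def)
    also have "\<dots> \<le> c * measure circ (shadow \<alpha> l)" by (intro mult_left_mono measure_shadow_ge \<alpha> lb c0)
    also have "\<dots> = (\<integral>t. c * indicator (shadow \<alpha> l) (cis t) \<partial>ang)" by (simp add: ms)
    also have "\<dots> \<le> (\<integral>t. poisson l t * w t \<partial>ang)"
    proof (rule integral_mono_AE[OF ind integrable_poisson_mult[OF lb wi]])
      show "AE t in ang. c * indicator (shadow \<alpha> l) (cis t) \<le> poisson l t * w t"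
        using vM
      proof eventually_elim
        case (elim t)
        show ?case
        proof (cases "cis t \<in> shadow \<alpha> l")
          case True
          then have st: "l \<in> stolz \<alpha> (cis t)" by (simp add: shadow_def)
          then have "ennreal (\<phi> l) \<le> nt_maximal \<alpha> \<phi> (cis t)" unfolding nt_maximal_def by (rule SUP_upper)
          also have "\<dots> \<le> ennreal (v t)" by (rule elim)
          finally have \<phi>v: "\<phi> l \<le> v t" using v0[of t] by (simp add: ennreal_le_iff)
          have "dist (cis t) l \<le> \<alpha> * D" using st by (simp add: stolz_def D_def dist_norm norm_minus_commute)
          then have "(dist (cis t) l)\<^sup>2 \<le> (\<alpha> * D)\<^sup>2" by (intro power_mono) auto
          moreover have "0 < (dist (cis t) l)\<^sup>2" using dist_cis_pos[OF lb, of t] by simp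
          ultimately have "D / (\<alpha> * D)\<^sup>2 \<le> poisson l t"
            unfolding poisson_def D_def[symmetric] using D by (intro divide_left_mono mult_pos_pos) auto
          moreover have "D / (\<alpha> * D)\<^sup>2 = 1 / (\<alpha>\<^sup>2 * D)" using D by (simp add: power2_eq_square)
          ultimately have "1 / (\<alpha>\<^sup>2 * D) * (2 * pi * \<alpha>\<^sup>2 * \<phi> l) \<le> poisson l t * w t"
            unfolding w_def using \<phi>v \<phi>[OF l] \<alpha> D poisson_nonneg[OF lb, of t] by (intro mult_mono) auto
          moreover have "1 / (\<alpha>\<^sup>2 * D) * (2 * pi * \<alpha>\<^sup>2 * \<phi> l) = c" using \<alpha> by (simp add: c_def)
          ultimately show ?thesis using True by simp
        next
          case False
          then show ?thesis using poisson_nonneg[OF lb, of t] w0[of t] by simp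
        qed
      qed
    qed
    finally show ?thesis by simp
  qed
  from that[OF wi w0 this] show ?thesis .
qed

section \<open>Two sources of Smirnov functions\<close>

text \<open>The excess of the Poisson integral of \<open>w\<close> over \<open>K\<close> is at most the Poisson integral of the excess of \<open>w\<close> over \<open>K\<close>,
  whose mean over every circle is the mean of that excess.\<close>

lemma exp_herglotz_in_smirnov:
  assumes w: "integrable ang w" "\<And>t. 0 \<le> w t"
  shows "(\<lambda>z. exp (herglotz w z)) \<in> smirnov"
  unfolding smirnov_iff log_uniformly_integrable_def
proof (intro conjI allI impI)
  show "(\<lambda>z. exp (herglotz w z)) holomorphic_on ball 0 1"
    by (intro holomorphic_intros holomorphic_herglotz w)
  fix e :: real assume e: "0 < e"
  obtain K where K: "0 \<le> K" "(\<integral>t. max 0 (w t - K) \<partial>ang) \<le> e"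
    using truncation_tail[OF w(1) e, of 0] by auto
  let ?u = "\<lambda>t. max 0 (w t - K)"
  have ui: "integrable ang ?u" by (rule integrable_truncations(1)[OF w(1)])
  have "eventually (\<lambda>r. (\<integral>t. max 0 (log_circle (\<lambda>z. exp (herglotz w z)) r t - K) \<partial>ang) \<le> e) (at_left 1)"
    using eventually_left_1
  proof eventually_elim
    case (elim r)
    then have zb: "of_real r * cis t \<in> ball 0 1" for t by (simp add: norm_mult)
    have pt: "max 0 (log_circle (\<lambda>z. exp (herglotz w z)) r t - K) \<le> Re (herglotz ?u (of_real r * cis t))" for t
    proof -
      let ?z = "of_real r * cis t"
      have u0: "0 \<le> Re (herglotz ?u ?z)"
        unfolding Re_herglotz[OF zb ui] using poisson_nonneg[OF zb] by (intro integral_nonneg_AE AE_I2) simp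
      have "Re (herglotz w ?z) \<le> (\<integral>s. K * poisson ?z s + poisson ?z s * ?u s \<partial>ang)"
        unfolding Re_herglotz[OF zb w(1)]
      proof (rule integral_mono[OF integrable_poisson_mult[OF zb w(1)]])
        show "integrable ang (\<lambda>s. K * poisson ?z s + poisson ?z s * ?u s)"
          using integral_poisson(2)[OF zb] integrable_poisson_mult[OF zb ui] by (intro Bochner_Integration.integrable_add integrable_mult_right)
        fix s
        have "poisson ?z s * w s \<le> poisson ?z s * (K + ?u s)"
          using poisson_nonneg[OF zb] by (intro mult_left_mono) auto
        then show "poisson ?z s * w s \<le> K * poisson ?z s + poisson ?z s * ?u s" by (simp add: algebra_simps)
      qed
      also have "\<dots> = K + Re (herglotz ?u ?z)"
        unfolding Re_herglotz[OF zb ui]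
        using integral_poisson[OF zb] integrable_poisson_mult[OF zb ui]
        by (subst Bochner_Integration.integral_add) auto
      finally have "log_plus (exp (Re (herglotz w ?z))) \<le> K + Re (herglotz ?u ?z)"
        using u0 K(1) by (subst log_plus_le_iff) auto
      then show ?thesis using u0 by (simp add: log_circle_def norm_exp_eq_Re)
    qed
    have mv: "(\<integral>t. Re (herglotz ?u (of_real r * cis t)) \<partial>ang) = Re (herglotz ?u 0)"
      "integrable ang (\<lambda>t. Re (herglotz ?u (of_real r * cis t)))"
      using elim mean_value_Re[OF holomorphic_herglotz[OF ui], of r] by auto
    have "integrable ang (log_circle (\<lambda>z. exp (herglotz w z)) r)"
      using elim by (intro integrable_log_circle holomorphic_intros holomorphic_herglotz w) auto
    then have "(\<integral>t. max 0 (log_circle (\<lambda>z. exp (herglotz w z)) r t - K) \<partial>ang) \<le> Re (herglotz ?u 0)"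
      unfolding mv(1)[symmetric] by (intro integral_mono integrable_truncations mv pt)
    also have "Re (herglotz ?u 0) = (\<integral>t. ?u t \<partial>ang)"
      by (subst Re_herglotz[OF _ ui]) (auto simp: poisson_def)
    finally show ?case using K(2) by simp
  qed
  then show "\<exists>K\<ge>0. eventually (\<lambda>r. (\<integral>t. max 0 (log_circle (\<lambda>z. exp (herglotz w z)) r t - K) \<partial>ang) \<le> e) (at_left 1)"
    using K(1) by blast
qed

text \<open>The Hardy space of exponent 1 is contained in the Smirnov class, since \<open>log\<^sup>+ x - K \<le> exp (- K) * x\<close>.\<close>

lemma bounded_means_in_smirnov:
  assumes k: "k holomorphic_on ball 0 1" and C: "\<And>r. 0 < r \<Longrightarrow> r < 1 \<Longrightarrow> (\<integral>t. norm (k (of_real r * cis t)) \<partial>ang) \<le> C"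
  shows "k \<in> smirnov"
  unfolding smirnov_iff log_uniformly_integrable_def
proof (intro conjI allI impI k)
  fix e :: real assume e: "0 < e"
  have "0 \<le> (\<integral>t. norm (k (of_real (1/2) * cis t)) \<partial>ang)" by (intro integral_nonneg_AE AE_I2) simp
  also have "\<dots> \<le> C" by (rule C) auto
  finally have C0: "0 \<le> C" .
  \<comment> \<open>Chosen so that \<open>exp (- K) * C \<le> e\<close>; the summand 1 keeps \<open>K\<close> nonnegative.\<close>
  define K where "K = ln (C / e + 1)"
  have K0: "0 \<le> K" using C0 e by (simp add: K_def)
  have eK: "exp (- K) * C \<le> e"
  proof -
    have pos: "0 < C / e + 1" using C0 e by (simp add: add_nonneg_pos)
    have "C \<le> e * (C / e + 1)" using e by (simp add: distrib_left)
    then have "C / (C / e + 1) \<le> e" using pos by (simp add: divide_le_eq)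
    then show ?thesis using pos by (simp add: K_def exp_minus field_simps)
  qed
  have pt: "max 0 (log_plus x - K) \<le> exp (- K) * x" if "0 \<le> x" for x
  proof -
    have "x = exp K * (exp (- K) * x)" by (simp add: exp_minus)
    also have "\<dots> \<le> exp K * exp (exp (- K) * x)"
      using exp_ge_add_one_self[of "exp (- K) * x"] by (intro mult_left_mono) (linarith, simp)
    finally have "x \<le> exp (K + exp (- K) * x)" by (simp add: exp_add)
    then have "log_plus x \<le> K + exp (- K) * x" using K0 that by (subst log_plus_le_iff) auto
    then show ?thesis using that by simp
  qed
  have "eventually (\<lambda>r. (\<integral>t. max 0 (log_circle k r t - K) \<partial>ang) \<le> e) (at_left 1)"
    using eventually_left_1
  proof eventually_elim
    case (elim r)
    have ck: "continuous_on UNIV (\<lambda>t. k (of_real r * cis t))"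
      using elim by (intro continuous_on_circle holomorphic_on_imp_continuous_on k) auto
    have "(\<integral>t. max 0 (log_circle k r t - K) \<partial>ang) \<le> (\<integral>t. exp (- K) * norm (k (of_real r * cis t)) \<partial>ang)"
    proof (rule integral_mono)
      show "integrable ang (\<lambda>t. max 0 (log_circle k r t - K))"
        using elim by (intro integrable_truncations integrable_log_circle k) auto
      show "integrable ang (\<lambda>t. exp (- K) * norm (k (of_real r * cis t)))"
        by (intro integrable_ang_cont continuous_intros ck)
      show "max 0 (log_circle k r t - K) \<le> exp (- K) * norm (k (of_real r * cis t))" for t
        unfolding log_circle_def by (rule pt) simp
    qed
    also have "\<dots> = exp (- K) * (\<integral>t. norm (k (of_real r * cis t)) \<partial>ang)" by simp
    also have "\<dots> \<le> exp (- K) * C" using elim C by (intro mult_left_mono) auto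
    finally show ?case using eK by simp
  qed
  then show "\<exists>K\<ge>0. eventually (\<lambda>r. (\<integral>t. max 0 (log_circle k r t - K) \<partial>ang) \<le> e) (at_left 1)" using K0 by blast
qed

section \<open>Interpolation with Smirnov functions\<close>

text \<open>The Blaschke factor without its unimodular constant, so that the origin is no special case.\<close>

definition moebius :: "complex \<Rightarrow> complex \<Rightarrow> complex" where
  "moebius a z = (a - z) / (1 - cnj a * z)"

lemma norm_moebius: "norm (moebius a z) = pseudo_dist a z" by (simp add: moebius_def pseudo_dist_def)

lemma holomorphic_moebius: "a \<in> ball 0 1 \<Longrightarrow> moebius a holomorphic_on ball 0 1"
  unfolding moebius_def using one_minus_cnj_nonzero[of a] by (intro holomorphic_intros) (auto simp: less_imp_le)

text \<open>A multiple of the squared Cauchy kernel, normalised to be 1 at \<open>l\<close>. Its mean over circles is of order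
  \<open>1 - |l|\<close>, which makes the sum over a Blaschke sequence converge in the mean.\<close>

definition bump :: "complex \<Rightarrow> complex \<Rightarrow> complex" where
  "bump l z = ((1 - of_real ((norm l)\<^sup>2)) / (1 - cnj l * z))\<^sup>2"

lemma holomorphic_bump: "l \<in> ball 0 1 \<Longrightarrow> bump l holomorphic_on ball 0 1"
  unfolding bump_def using one_minus_cnj_nonzero[of l] by (intro holomorphic_intros) (auto simp: less_imp_le)

lemma norm_bump: "norm (bump l z) = ((1 - (norm l)\<^sup>2) / norm (1 - cnj l * z))\<^sup>2"
proof -
  have "1 - complex_of_real ((norm l)\<^sup>2) = of_real (1 - (norm l)\<^sup>2)" by simp
  then show ?thesis unfolding bump_def norm_power norm_divide by (simp only: norm_of_real power_divide power2_abs)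
qed

lemma bump_self:
  assumes "l \<in> ball 0 1" shows "bump l l = 1"
proof -
  have "cnj l * l = of_real ((norm l)\<^sup>2)" by (simp only: complex_norm_square mult.commute)
  then show ?thesis using one_minus_cnj_nonzero[of l l] assms unfolding bump_def by (simp add: less_imp_le)
qed

lemma norm_bump_le:
  assumes l: "l \<in> ball 0 1" and z: "z \<in> ball 0 1"
  shows "norm (bump l z) \<le> 4 * (1 - norm l) / (1 - norm z)\<^sup>2"
proof -
  have z1: "0 < 1 - norm z" and l1: "0 < 1 - norm l" "1 - norm l \<le> 1" using z l by auto
  have "norm (cnj l * z) \<le> norm z" using l by (simp add: norm_mult mult_left_le_one_le)
  then have "1 - norm z \<le> norm (1 - cnj l * z)" using norm_triangle_ineq2[of 1 "cnj l * z"] by simp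
  then have "(1 - (norm l)\<^sup>2) / norm (1 - cnj l * z) \<le> 2 * (1 - norm l) / (1 - norm z)"
    using one_minus_norm_squared[OF l] z1 l1 by (intro frac_le) auto
  then have "((1 - (norm l)\<^sup>2) / norm (1 - cnj l * z))\<^sup>2 \<le> (2 * (1 - norm l) / (1 - norm z))\<^sup>2"
    using one_minus_norm_squared[OF l] l1 by (intro power_mono) auto
  also have "\<dots> = 4 * ((1 - norm l) * (1 - norm l)) / (1 - norm z)\<^sup>2"
  proof -
    have "(2 * x / y)\<^sup>2 = 4 * (x * x) / y\<^sup>2" for x y :: real by (simp add: power_divide power2_eq_square)
    then show ?thesis by blast
  qed
  also have "\<dots> \<le> 4 * ((1 - norm l) * 1) / (1 - norm z)\<^sup>2" using l1 by (intro divide_right_mono mult_left_mono) auto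
  finally show ?thesis unfolding norm_bump by simp
qed

text \<open>On the circle of radius \<open>r\<close> the modulus of the kernel is a multiple of the Poisson kernel of \<open>r * l\<close>.\<close>

lemma integral_bump_le:
  assumes l: "l \<in> ball 0 1" and r: "0 < r" "r < 1"
  shows "(\<integral>t. norm (bump l (of_real r * cis t)) \<partial>ang) \<le> 2 * (1 - norm l)"
proof -
  let ?z = "of_real r * l"
  have nz: "norm ?z = r * norm l" using r by (simp add: norm_mult)
  have rl: "r * norm l \<le> norm l" using r by (simp add: mult_left_le_one_le)
  have zb: "?z \<in> ball 0 1" using nz rl l by simp
  define D where "D = 1 - (norm l)\<^sup>2"
  define D' where "D' = 1 - (norm ?z)\<^sup>2"
  have D: "0 < D" using l one_minus_norm_squared(1)[OF l] by (simp add: D_def)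
  have D': "D \<le> D'" unfolding D_def D'_def nz using rl r by (intro diff_left_mono power_mono) auto
  have "norm (bump l (of_real r * cis t)) = D\<^sup>2 / D' * poisson ?z t" for t
  proof -
    have "cis t * cnj (1 - cnj l * (of_real r * cis t)) = cis t - of_real r * l * (cis t * cnj (cis t))"
      by (simp add: algebra_simps)
    also have "cis t * cnj (cis t) = 1" using complex_norm_square[of "cis t"] by simp
    finally have "norm (cis t * cnj (1 - cnj l * (of_real r * cis t))) = dist (cis t) ?z" by (simp add: dist_norm)
    then have "norm (1 - cnj l * (of_real r * cis t)) = dist (cis t) ?z" by (simp only: norm_mult norm_cis complex_mod_cnj mult_1_left)
    then show ?thesis unfolding norm_bump poisson_def D_def[symmetric] D'_def[symmetric] using D D'
      by (simp add: power_divide)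
  qed
  then have "(\<integral>t. norm (bump l (of_real r * cis t)) \<partial>ang) = D\<^sup>2 / D'"
    using integral_poisson(1)[OF zb] by simp
  also have "\<dots> \<le> D\<^sup>2 / D" using D D' by (intro divide_left_mono) auto
  also have "\<dots> = D" using D by (simp add: power2_eq_square)
  also have "\<dots> \<le> 2 * (1 - norm l)" unfolding D_def by (rule one_minus_norm_squared(2)[OF l])
  finally show ?thesis .
qed

text \<open>Lagrange interpolation with Blaschke products in place of polynomials. The growth condition on the data cancels
  the smallness of the Blaschke products at the nodes.\<close>

lemma finite_interpolation:
  assumes F: "finite F" "F \<subseteq> ball 0 1" and B: "0 \<le> B"
    and c: "\<And>l. l \<in> F \<Longrightarrow> norm (c l) \<le> B * exp (- (\<Sum>a\<in>F - {l}. green a l))"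
  obtains k where "k holomorphic_on ball 0 1" "\<And>l. l \<in> F \<Longrightarrow> k l = c l"
    "\<And>z. z \<in> ball 0 1 \<Longrightarrow> norm (k z) \<le> B * (\<Sum>l\<in>F. norm (bump l z))"
proof -
  define P where "P l z = (\<Prod>a\<in>F - {l}. moebius a z)" for l z
  define k where "k z = (\<Sum>l\<in>F. c l * (P l z / P l l) * bump l z)" for z
  have Fb: "a \<in> ball 0 1" if "a \<in> F" for a using that F by auto
  have pp: "0 < pseudo_dist a l" if "l \<in> F" "a \<in> F - {l}" for a l using that Fb by (intro pseudo_pos) (auto simp: less_imp_le)
  have nP: "norm (P l l) = exp (- (\<Sum>a\<in>F - {l}. green a l))" if l: "l \<in> F" for l
  proof -
    have "exp (- (\<Sum>a\<in>F - {l}. green a l)) = (\<Prod>a\<in>F - {l}. exp (- green a l))"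
      using F by (simp add: exp_sum flip: sum_negf)
    also have "\<dots> = (\<Prod>a\<in>F - {l}. pseudo_dist a l)" using pp[OF l] by (intro prod.cong refl) (simp add: green_def)
    finally show ?thesis by (simp add: P_def norm_moebius flip: prod_norm)
  qed
  have P0: "P l l \<noteq> 0" if "l \<in> F" for l using nP[OF that] by auto
  have hol: "k holomorphic_on ball 0 1"
    unfolding k_def P_def using P0[unfolded P_def] Fb by (intro holomorphic_intros holomorphic_moebius holomorphic_bump) auto
  have val: "k l = c l" if l: "l \<in> F" for l
  proof -
    have "k l = (\<Sum>l'\<in>{l}. c l' * (P l' l / P l' l') * bump l' l)"
      unfolding k_def
    proof (rule sum.mono_neutral_right[OF F(1)])
      show "\<forall>i\<in>F - {l}. c i * (P i l / P i i) * bump i l = 0"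
      proof
        fix i assume i: "i \<in> F - {l}"
        have "P i l = 0" unfolding P_def using i l F(1) by (intro prod_zero bexI[of _ l]) (auto simp: moebius_def)
        then show "c i * (P i l / P i i) * bump i l = 0" by simp
      qed
    qed (use l in auto)
    then show ?thesis using P0[OF l] bump_self[OF Fb[OF l]] by simp
  qed
  have bd: "norm (k z) \<le> B * (\<Sum>l\<in>F. norm (bump l z))" if z: "z \<in> ball 0 1" for z
  proof -
    have "norm (c l * (P l z / P l l) * bump l z) \<le> B * norm (bump l z)" if l: "l \<in> F" for l
    proof -
      have "norm (P l z) = (\<Prod>a\<in>F - {l}. pseudo_dist a z)" by (simp add: P_def norm_moebius flip: prod_norm)
      also have "\<dots> \<le> 1" using Fb z pseudo_less_1 by (intro prod_le_1) (auto simp: pseudo_dist_def less_imp_le)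
      finally have "norm (P l z) \<le> 1" .
      moreover have "norm (c l) / norm (P l l) \<le> B" using c[OF l] nP[OF l] by (simp add: divide_le_eq)
      ultimately have "norm (c l) / norm (P l l) * norm (P l z) \<le> B * 1" using B by (intro mult_mono) auto
      then have "norm (c l) / norm (P l l) * norm (P l z) * norm (bump l z) \<le> B * norm (bump l z)"
        by (intro mult_right_mono) auto
      then show ?thesis by (simp add: norm_mult norm_divide)
    qed
    then show ?thesis unfolding k_def sum_distrib_left by (intro order_trans[OF norm_sum] sum_mono)
  qed
  from that[OF hol val bd] show ?thesis .
qed

text \<open>The bound for finite subsets of \<open>\<Lambda>\<close> does not depend on the subset, so a normal family argument gives the
  interpolating function for \<open>\<Lambda>\<close>.\<close>

lemma interpolation_bounded_means:
  assumes \<Lambda>: "\<Lambda> \<subseteq> ball 0 1" "\<Lambda> sparse_in ball 0 1" "(\<lambda>l. 1 - norm l) summable_on \<Lambda>"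
    and B: "0 \<le> B" and c: "\<And>l. l \<in> \<Lambda> \<Longrightarrow> norm (c l) \<le> B * exp (- phi \<Lambda> l)"
  obtains k where "k \<in> smirnov" "\<And>l. l \<in> \<Lambda> \<Longrightarrow> k l = c l"
proof -
  define F where "F n = cball 0 (radii n) \<inter> \<Lambda>" for n
  have finF: "finite (F n)" for n
    unfolding F_def using radii[of n] by (intro sparse_in_compact_finite sparse_in_subset[OF \<Lambda>(2)]) auto
  have Fb: "F n \<subseteq> ball 0 1" for n using \<Lambda> by (auto simp: F_def)
  define S where "S = infsum (\<lambda>l. 1 - norm l) \<Lambda>"
  have FS: "(\<Sum>l\<in>F n. 1 - norm l) \<le> S" for n
    unfolding S_def using \<Lambda> finF by (intro finite_sum_le_infsum) (auto simp: F_def less_imp_le)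
  have S0: "0 \<le> S" unfolding S_def using \<Lambda> by (intro infsum_nonneg) (auto simp: less_imp_le)
  have "\<exists>k. k holomorphic_on ball 0 1 \<and> (\<forall>l\<in>F n. k l = c l) \<and> (\<forall>z\<in>ball 0 1. norm (k z) \<le> B * (\<Sum>l\<in>F n. norm (bump l z)))" for n
  proof (rule finite_interpolation[OF finF Fb B])
    fix l assume l: "l \<in> F n"
    then have l\<Lambda>: "l \<in> \<Lambda>" by (simp add: F_def)
    have hs: "(green l has_sum phi \<Lambda> l) (\<Lambda> - {l})" by (rule phi_has_sum[OF \<Lambda> l\<Lambda>])
    have "(\<Sum>a\<in>F n - {l}. green a l) = (\<Sum>a\<in>F n - {l}. green l a)" by (simp only: green_commute[of _ l])
    also have "\<dots> \<le> phi \<Lambda> l"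
      using l\<Lambda> \<Lambda>(1) finF by (intro finite_sum_le_has_sum[OF hs] green_nonneg) (auto simp: F_def)
    finally have "B * exp (- phi \<Lambda> l) \<le> B * exp (- (\<Sum>a\<in>F n - {l}. green a l))"
      using B by (intro mult_left_mono) auto
    then show "norm (c l) \<le> B * exp (- (\<Sum>a\<in>F n - {l}. green a l))" using c[OF l\<Lambda>] by linarith
  qed blast
  then have "\<exists>k. \<forall>n. k n holomorphic_on ball 0 1 \<and> (\<forall>l\<in>F n. k n l = c l) \<and> (\<forall>z\<in>ball 0 1. norm (k n z) \<le> B * (\<Sum>l\<in>F n. norm (bump l z)))"
    by (intro choice allI)
  then obtain k where kh: "\<And>n. k n holomorphic_on ball 0 1" and kv: "\<And>n l. l \<in> F n \<Longrightarrow> k n l = c l"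
    and kb: "\<And>n z. z \<in> ball 0 1 \<Longrightarrow> norm (k n z) \<le> B * (\<Sum>l\<in>F n. norm (bump l z))" by blast
  have kb': "norm (k n z) \<le> B * (4 * S / (1 - norm z)\<^sup>2)" if z: "z \<in> ball 0 1" for n z
  proof -
    have "(\<Sum>l\<in>F n. norm (bump l z)) \<le> (\<Sum>l\<in>F n. 4 / (1 - norm z)\<^sup>2 * (1 - norm l))"
      using norm_bump_le[OF _ z] Fb by (intro sum_mono) force
    also have "\<dots> = 4 / (1 - norm z)\<^sup>2 * (\<Sum>l\<in>F n. 1 - norm l)" by (simp only: sum_distrib_left)
    also have "\<dots> \<le> 4 / (1 - norm z)\<^sup>2 * S" by (intro mult_left_mono FS) auto
    finally have "(\<Sum>l\<in>F n. norm (bump l z)) \<le> 4 * S / (1 - norm z)\<^sup>2" by simp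
    then show ?thesis using kb[OF z, of n] B by (meson mult_left_mono order_trans)
  qed
  obtain g \<kappa> where g: "g holomorphic_on ball 0 1" and \<kappa>: "strict_mono (\<kappa> :: nat \<Rightarrow> nat)"
    and lim: "\<And>x. x \<in> ball 0 1 \<Longrightarrow> (\<lambda>n. k (\<kappa> n) x) \<longlonglongrightarrow> g x"
  proof (rule Montel_radial_bound[of k "\<lambda>x. B * (4 * S / (1 - x)\<^sup>2)"])
    show "B * (4 * S / (1 - x)\<^sup>2) \<le> B * (4 * S / (1 - y)\<^sup>2)" if "0 \<le> x" "x \<le> y" "y < 1" for x y :: real
      using that S0 B by (intro mult_left_mono divide_left_mono power_mono mult_pos_pos) auto
  qed (use kh kb' that in auto)
  have gv: "g l = c l" if l: "l \<in> \<Lambda>" for l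
  proof -
    have lb: "l \<in> ball 0 1" using l \<Lambda> by auto
    have "eventually (\<lambda>n. norm l < radii n) sequentially"
      using lb by (intro order_tendstoD(1)[OF radii_tendsto]) auto
    then have "eventually (\<lambda>n. norm l < radii (\<kappa> n)) sequentially"
      by (rule eventually_subseq[OF \<kappa>])
    then have "eventually (\<lambda>n. k (\<kappa> n) l = c l) sequentially"
      by eventually_elim (auto intro!: kv simp: F_def l)
    then have "(\<lambda>n. k (\<kappa> n) l) \<longlonglongrightarrow> c l" by (rule tendsto_eventually)
    with lim[OF lb] show ?thesis by (rule LIMSEQ_unique)
  qed
  have "(\<integral>t. norm (g (of_real r * cis t)) \<partial>ang) \<le> B * (2 * S)" if r: "0 < r" "r < 1" for r
  proof (rule LIMSEQ_le_const2)
    have zb: "of_real r * cis t \<in> ball 0 1" for t using r by (simp add: norm_mult)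
    have cont: "continuous_on UNIV (\<lambda>t. h (of_real r * cis t))" if "h holomorphic_on ball 0 1" for h :: "complex \<Rightarrow> complex"
      using r by (intro continuous_on_circle holomorphic_on_imp_continuous_on that) auto
    show "(\<lambda>n. \<integral>t. norm (k (\<kappa> n) (of_real r * cis t)) \<partial>ang) \<longlonglongrightarrow> (\<integral>t. norm (g (of_real r * cis t)) \<partial>ang)"
    proof (rule integral_dominated_convergence[where w = "\<lambda>_. B * (4 * S / (1 - r)\<^sup>2)"])
      show "(\<lambda>t. norm (g (of_real r * cis t))) \<in> borel_measurable ang"
        by (intro borel_measurable_ang_cont continuous_on_norm cont g)
      show "(\<lambda>t. norm (k (\<kappa> n) (of_real r * cis t))) \<in> borel_measurable ang" for n
        by (intro borel_measurable_ang_cont continuous_on_norm cont kh)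
      show "AE t in ang. (\<lambda>n. norm (k (\<kappa> n) (of_real r * cis t))) \<longlonglongrightarrow> norm (g (of_real r * cis t))"
        by (intro AE_I2 tendsto_norm lim zb)
      show "AE t in ang. norm (norm (k (\<kappa> n) (of_real r * cis t))) \<le> B * (4 * S / (1 - r)\<^sup>2)" for n
      proof (rule AE_I2)
        fix t
        show "norm (norm (k (\<kappa> n) (of_real r * cis t))) \<le> B * (4 * S / (1 - r)\<^sup>2)"
          using kb'[OF zb[of t], of "\<kappa> n"] r by (simp add: norm_mult)
      qed
    qed simp
    have "(\<integral>t. norm (k m (of_real r * cis t)) \<partial>ang) \<le> B * (2 * S)" for m
    proof -
      have ib: "integrable ang (\<lambda>t. norm (bump l (of_real r * cis t)))" if "l \<in> F m" for l
        using that Fb[of m] by (intro integrable_ang_cont continuous_on_norm cont holomorphic_bump) auto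
      have "(\<integral>t. norm (k m (of_real r * cis t)) \<partial>ang) \<le> (\<integral>t. B * (\<Sum>l\<in>F m. norm (bump l (of_real r * cis t))) \<partial>ang)"
      proof (rule integral_mono)
        show "integrable ang (\<lambda>t. norm (k m (of_real r * cis t)))"
          by (intro integrable_ang_cont continuous_on_norm cont kh)
        show "integrable ang (\<lambda>t. B * (\<Sum>l\<in>F m. norm (bump l (of_real r * cis t))))"
          by (intro integrable_mult_right Bochner_Integration.integrable_sum ib)
        show "norm (k m (of_real r * cis t)) \<le> B * (\<Sum>l\<in>F m. norm (bump l (of_real r * cis t)))" for t
          by (rule kb[OF zb])
      qed
      also have "\<dots> = B * (\<Sum>l\<in>F m. \<integral>t. norm (bump l (of_real r * cis t)) \<partial>ang)"
        using ib by (simp add: Bochner_Integration.integral_sum)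
      also have "\<dots> \<le> B * (\<Sum>l\<in>F m. 2 * (1 - norm l))"
        using Fb[of m] r B by (intro mult_left_mono sum_mono integral_bump_le) auto
      also have "\<dots> \<le> B * (2 * S)" using FS[of m] B unfolding sum_distrib_left[symmetric] by (intro mult_left_mono) auto
      finally show ?thesis .
    qed
    then show "\<exists>N. \<forall>n\<ge>N. (\<integral>t. norm (k (\<kappa> n) (of_real r * cis t)) \<partial>ang) \<le> B * (2 * S)" by blast
  qed
  from bounded_means_in_smirnov[OF g this] have "g \<in> smirnov" .
  from that[OF this gv] show ?thesis .
qed

text \<open>The harmonic majorant makes \<open>\<omega> l * exp (- F l)\<close> admissible data for the preceding lemma.\<close>

lemma smirnov_interpolation:
  assumes \<alpha>: "\<alpha> \<ge> 1" and \<Lambda>: "\<Lambda> \<subseteq> ball 0 1" "\<Lambda> sparse_in ball 0 1" "(\<lambda>l. 1 - norm l) summable_on \<Lambda>"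
    and M: "nt_maximal \<alpha> (phi \<Lambda>) \<in> L1_circle" and \<omega>: "bounded (\<omega> ` \<Lambda>)"
  obtains h where "h \<in> smirnov" "\<And>l. l \<in> \<Lambda> \<Longrightarrow> h l = \<omega> l"
proof -
  have \<phi>0: "0 \<le> phi \<Lambda> l" if l: "l \<in> \<Lambda>" for l
    using has_sum_nonneg[OF phi_has_sum[OF \<Lambda> l]] l \<Lambda>(1) green_nonneg by (meson DiffD1 subsetD)
  obtain w where w: "integrable ang w" "\<And>t. 0 \<le> w t" and major: "\<And>l. l \<in> \<Lambda> \<Longrightarrow> phi \<Lambda> l \<le> (\<integral>t. poisson l t * w t \<partial>ang)"
    using harmonic_majorant_from_nt_maximal[OF \<alpha> \<phi>0 \<Lambda>(1) M] by blast
  obtain B where "\<forall>x\<in>\<omega> ` \<Lambda>. norm x \<le> B" using \<omega> unfolding bounded_iff by blast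
  then have B: "norm (\<omega> l) \<le> max B 0" if "l \<in> \<Lambda>" for l using that by (force simp: le_max_iff_disj)
  define c where "c l = \<omega> l * exp (- herglotz w l)" for l
  have cb: "norm (c l) \<le> max B 0 * exp (- phi \<Lambda> l)" if l: "l \<in> \<Lambda>" for l
  proof -
    have lb: "l \<in> ball 0 1" using l \<Lambda> by auto
    have "exp (- Re (herglotz w l)) \<le> exp (- phi \<Lambda> l)" using major[OF l] Re_herglotz[OF lb w(1)] by simp
    then show ?thesis unfolding c_def norm_mult norm_exp_eq_Re using B[OF l] by (intro mult_mono) auto
  qed
  obtain k where k: "k \<in> smirnov" "\<And>l. l \<in> \<Lambda> \<Longrightarrow> k l = c l"
    by (rule interpolation_bounded_means[OF \<Lambda> _ cb]) auto
  have "(\<lambda>z. exp (herglotz w z) * k z) \<in> smirnov" by (intro smirnov_mult exp_herglotz_in_smirnov w k)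
  moreover have "exp (herglotz w l) * k l = \<omega> l" if "l \<in> \<Lambda>" for l
    using k(2)[OF that] by (simp add: c_def exp_minus)
  ultimately show ?thesis by (rule that)
qed

lemma free_interpolating_if_multiplier:
  assumes "\<And>\<omega>. bounded (\<omega> ` \<Lambda>) \<Longrightarrow> \<exists>h\<in>Y. \<forall>l\<in>\<Lambda>. h l = \<omega> l"
    and "\<And>f h. f \<in> X \<Longrightarrow> h \<in> Y \<Longrightarrow> (\<lambda>z. f z * h z) \<in> X"
  shows "free_interpolating \<Lambda> X"
  unfolding free_interpolating_def
proof (intro ballI allI impI)
  fix a and \<omega> :: "complex \<Rightarrow> complex" assume "a \<in> trace_space X \<Lambda>" and \<omega>: "bounded (\<omega> ` \<Lambda>)"
  then obtain f where f: "f \<in> X" "a = restrict f \<Lambda>" by (auto simp: trace_space_def)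
  obtain h where h: "h \<in> Y" "\<And>l. l \<in> \<Lambda> \<Longrightarrow> h l = \<omega> l" using assms(1)[OF \<omega>] by blast
  have "restrict (\<lambda>l. \<omega> l * a l) \<Lambda> = restrict (\<lambda>z. f z * h z) \<Lambda>"
    using h(2) f(2) by (auto simp: restrict_def fun_eq_iff)
  then show "restrict (\<lambda>l. \<omega> l * a l) \<Lambda> \<in> trace_space X \<Lambda>"
    using assms(2)[OF f(1) h(1)] by (auto simp: trace_space_def)
qed

theorem corollary1p9:
  fixes \<Lambda> :: "complex set" and \<alpha> :: real
  assumes "\<alpha> \<ge> 1"
    and "\<Lambda> \<subseteq> ball 0 1"
    and "\<Lambda> sparse_in ball 0 1"
    and "(\<lambda>l. 1 - norm l) summable_on \<Lambda>"
  shows "(free_interpolating \<Lambda> nevanlinna \<longrightarrow> H_maximal \<alpha> (phi \<Lambda>) \<in> weak_L1_circle)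
    \<and> (free_interpolating \<Lambda> smirnov \<longrightarrow> H_maximal \<alpha> (phi \<Lambda>) \<in> weak_L1_0_circle)
    \<and> (nt_maximal \<alpha> (phi \<Lambda>) \<in> L1_circle \<longrightarrow>
         free_interpolating \<Lambda> smirnov \<and> free_interpolating \<Lambda> nevanlinna)"
proof (intro conjI impI)
  show "H_maximal \<alpha> (phi \<Lambda>) \<in> weak_L1_circle" if "free_interpolating \<Lambda> nevanlinna"
    by (rule nevanlinna_interpolating_imp_weak_L1[OF assms that])
  show "H_maximal \<alpha> (phi \<Lambda>) \<in> weak_L1_0_circle" if "free_interpolating \<Lambda> smirnov"
    by (rule smirnov_interpolating_imp_weak_L1_0[OF assms that])
next
  assume M: "nt_maximal \<alpha> (phi \<Lambda>) \<in> L1_circle"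
  have int: "\<exists>h\<in>smirnov. \<forall>l\<in>\<Lambda>. h l = \<omega> l" if "bounded (\<omega> ` \<Lambda>)" for \<omega>
    by (rule smirnov_interpolation[OF assms M that]) auto
  show "free_interpolating \<Lambda> smirnov"
    by (rule free_interpolating_if_multiplier[OF int smirnov_mult])
  show "free_interpolating \<Lambda> nevanlinna"
  proof (rule free_interpolating_if_multiplier[OF int])
    show "(\<lambda>z. f z * h z) \<in> nevanlinna" if "f \<in> nevanlinna" "h \<in> smirnov" for f h
      using nevanlinna_mult[OF that(1)] that(2) smirnov_subset_nevanlinna by blast
  qed
qed

end
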